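(* Let SEA-BREW be the versioned ciphertext-policy attribute-based encryption scheme given by the primitives $\mathrm{Setup}$, $\mathrm{Encrypt}$, $\mathrm{KeyGen}$, $\mathrm{UpdateMK}$, $\mathrm{UpdateEK}$, $\mathrm{UpdateDK}$, $\mathrm{UpdateCP}$ defined in the context. In the generic bilinear group model, with the hash function $H$ modeled as a random oracle, SEA-BREW is secure against an adaptive chosen plaintext attack (IND-CPA) by an honest-but-curious cloud server colluding with a set of consumers; that is, for every probabilistic polynomial-time adversary $\mathcal{A}$, the advantage $\Pr[b'=b]-\frac12$ of $\mathcal{A}$ in Game 2 (defined in the context) against SEA-BREW is not non-negligible in the security parameter $\kappa$.
   Context: **Groups.** $\mathbb{G}_0$ is a multiplicative cyclic group of prime order $p$ of size (bit length) $\kappa$ with generator $g$, and $e:\mathbb{G}_0\times\mathbb{G}_0\to\mathbb{G}_1$ is an efficiently computable, bilinear, non-degenerate map. $H:\{0,1\}^*\to\mathbb{G}_0$ is a hash function modeled as a random oracle. Attributes are strings; messages are elements of $\mathbb{G}_1$. **Generic bilinear group model.** Elements of $\mathbb{G}_0$ and $\mathbb{G}_1$ are represented by independent random injective encodings $\psi_0,\psi_1:\mathbb{Z}_p\to\{0,1\}^m$ (with $m>3\log_2 p$), $\psi_0(x)$ representing $g^x$ and $\psi_1(x)$ representing $e(g,g)^x$. All parties manipulate group elements only through oracles for the group operations in $\mathbb{G}_0$ and $\mathbb{G}_1$ and for the bilinear map $e$; the adversary also has oracle access to $H$. **Policies.** An access policy $\mathcal{P}$ is a tree. Each non-leaf node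 $x$ is a threshold gate with threshold value $k_x$ ($1\le k_x\le$ number of children), true iff at least $k_x$ of its children are true. Each leaf $y$ carries an attribute $\operatorname{att}(y)$ and has $k_y=1$. An attribute set $\gamma$ satisfies $\mathcal{P}$ if the root evaluates to true when exactly the leaves $y$ with $\operatorname{att}(y)\in\gamma$ are set to true. The nodes are assigned distinct indices $\operatorname{index}(x)\in\{1,\dots,num\}$, where $num$ is the number of nodes. **Scheme.** A superscript $(i)$ denotes a version number. The scalars $\beta^{(i)}$ are understood to be nonzero. - $\mathrm{Setup}(\kappa)$: choose $\alpha,\beta^{(0)}\in\mathbb{Z}_p$ at random. Output the encryption key $EK^{(0)}=\{\mathbb{G}_0,g,h=g^{\beta^{(0)}},l=e(g,g)^\alpha,v_{EK}=0\}$ and the master key $MK^{(0)}=\{\beta^{(0)},g^\alpha,v_{MK}=0\}$. - $\mathrm{Encrypt}(M,\mathcal{P},EK)$: for each node $x$ choose a polynomial $q_x$ over $\mathbb{Z}_p$ of degree $d_x=k_x-1$, top-down. For the root $R$ choose random $s\in\mathbb{Z}_p$ and set $q_R(0)=s$; for any other node $x$ set $q_x(0)=q_{\operatorname{parent}(x)}(\operatorname{index}(x))$; in each case choose $d_x$ other points of $q_x$ at random. With $Y$ the set of leaves, output $$CP=\{\mathcal{P},\ \tilde C=M\,e(g,g)^{\alpha s},\ C=h^s,\ v_{CP}=v_{EK},\ \forall y\in Y:\ C_y=g^{q_y(0)},\ C'_y=H(\operatorname{att}(y))^{q_y(0)}\}.$$ - $\mathrm{KeyGen}(MK,\gamma)$,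 with $\beta$ the current component of $MK$: choose random $r\in\mathbb{Z}_p$ and $r_j\in\mathbb{Z}_p$ for each $j\in\gamma$. Output $$DK=\{D=g^{(\alpha+r)/\beta},\ v_{DK}=v_{MK},\ \forall j\in\gamma:\ D_j=g^r H(j)^{r_j},\ D'_j=g^{r_j}\}.$$ - $\mathrm{UpdateMK}(MK)$: increment $v_{MK}$ by one; choose a new $\beta^{(v_{MK})}\in\mathbb{Z}_p$ at random; set $U_{CP}^{(v_{MK})}=\beta^{(v_{MK})}/\beta^{(v_{MK}-1)}$, $U_{EK}^{(v_{MK})}=g^{\beta^{(v_{MK})}}$, $U_{DK}^{(v_{MK})}=\beta^{(v_{MK}-1)}/\beta^{(v_{MK})}$. The new master key is $\{\beta^{(v_{MK})},g^\alpha,v_{MK}\}$. - $\mathrm{UpdateEK}$: replace $h$ in the encryption key by $U_{EK}^{(v_{MK})}$ and set $v_{EK}=v_{MK}$. - $\mathrm{UpdateDK}$: for a decryption key of version $v_{DK}<v_{MK}$, replace $D$ by $D^{U'}$ with $U'=\prod_{i=v_{DK}+1}^{v_{MK}}U_{DK}^{(i)}$; the version becomes $v_{MK}$ and all other components are unchanged. - $\mathrm{UpdateCP}$: for a ciphertext of version $v_{CP}<v_{MK}$, replace $C$ by $C^{U'}$ with $U'=\prod_{i=v_{CP}+1}^{v_{MK}}U_{CP}^{(i)}$; the version becomes $v_{MK}$ and all other components are unchanged. **Game 2** (between a challenger and an adversary $\mathcal{A}$). *Setup.* The challenger runs $\mathrm{Setup}$ and sends $EK^{(0)}$ to $\mathcal{A}$.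 *Phase 1.* $\mathcal{A}$ may adaptively issue queries of the following types. - encryption key update: the challenger runs $\mathrm{UpdateMK}$ and sends to $\mathcal{A}$ the updated encryption key and also the update quantities $U_{DK}^{(i)}$ for all $i\in[1,n]$, where $n$ is the (new) latest version. - generate decryption key: $\mathcal{A}$ provides an attribute set $\gamma$; the challenger runs $\mathrm{KeyGen}$ on $\gamma$ with the current master key and sends the resulting decryption key to $\mathcal{A}$. - generate decryption key's $D$ field: $\mathcal{A}$ provides an attribute set $\gamma$; the challenger runs $\mathrm{KeyGen}$ on $\gamma$ with the current master key and sends only the field $D$ of the generated decryption key to $\mathcal{A}$. - decryption key update: $\mathcal{A}$ provides a decryption key; the challenger runs $\mathrm{UpdateDK}$ on it and returns the key updated to the latest version. - ciphertext update: $\mathcal{A}$ provides a ciphertext; the challenger runs $\mathrm{UpdateCP}$ on it and returns the ciphertext updated to the latest version. *Challenge.* $\mathcal{A}$ submits two equal-length messages $m_0,m_1$ and a challenge policy $\mathcal{P}^*$ not satisfied by any attribute set queried in a generate decryption key query in Phase 1 (attribute sets in generate decryption key's $D$ field queries are allowed to satisfy $\mathcal{P}^*$). The challenger picks a uniform bit $b\in\{0,1\}$ and sends $CP^*=\mathrm{Encrypt}(m_b,\mathcal{P}^*,EK^{(n)})$ to $\mathcal{A}$, where $n$ is the current version, i.e. the number of encryption key update queries made so far. *Phase 2.* As Phase 1, except that $\mathcal{A}$ may not issue generate decryption key queries for attribute sets satisfying $\mathcal{P}^*$ (generate decryption key's $D$ field queries remain unrestricted). *Guess.* $\mathcal{A}$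 outputs a bit $b'$. Its advantage is $\Pr[b'=b]-\frac12$. *)

theory Defs
  imports
    "HOL-Probability.Probability"
    "HOL-Computational_Algebra.Polynomial"
    "HOL-Number_Theory.Modular_Inverse"
    "HOL-Library.Log_Nat"
begin

section \<open>Access policies\<close>

type_synonym attribute = "bool list"

text \<open>The first argument of a node is its index; a leaf has the threshold value 1.\<close>

datatype policy =
    Leaf nat attribute
  | Gate nat nat "policy list"

fun index :: "policy \<Rightarrow> nat" where
  "index (Leaf i a) = i"
| "index (Gate i k ts) = i"

fun indices :: "policy \<Rightarrow> nat list" where
  "indices (Leaf i a) = [i]"
| "indices (Gate i k ts) = i # concat (map indices ts)"

fun leaves :: "policy \<Rightarrow> attribute list" where
  "leaves (Leaf i a) = [a]"
| "leaves (Gate i k ts) = concat (map leaves ts)"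

fun thresholds_ok :: "policy \<Rightarrow> bool" where
  "thresholds_ok (Leaf i a) = True"
| "thresholds_ok (Gate i k ts) = (1 \<le> k \<and> k \<le> length ts \<and> (\<forall>t\<in>set ts. thresholds_ok t))"

definition wf_policy :: "policy \<Rightarrow> bool" where
  "wf_policy P \<longleftrightarrow>
     thresholds_ok P \<and> distinct (indices P) \<and> set (indices P) \<subseteq> {1..length (indices P)}"

fun satisfies :: "attribute set \<Rightarrow> policy \<Rightarrow> bool" where
  "satisfies \<gamma> (Leaf i a) = (a \<in> \<gamma>)"
| "satisfies \<gamma> (Gate i k ts) = (k \<le> length (filter (satisfies \<gamma>) ts))"


section \<open>Keys and ciphertexts\<close>

text \<open>
  The parameters \<open>'a\<close> and \<open>'b\<close> are the representations of the elements of the groups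
  \<open>G\<^sub>0\<close> and \<open>G\<^sub>1\<close>. Two representations are used: discrete logarithms, i.e. an
  integer \<open>x\<close> in \<open>{0..<p}\<close> stands for \<open>g\<^sup>x\<close> resp. \<open>e(g,g)\<^sup>x\<close> (the view of
  the scheme), and the bit strings assigned to them by the random encodings (the view of the
  adversary). The map functions of the datatypes translate between them.
\<close>

datatype ('a, 'b) enc_key =
  EncKey (ek_g: 'a) (ek_h: 'a) (ek_l: 'b) (ek_version: nat)

datatype 'a master_key =
  MasterKey (mk_beta: int) (mk_g_alpha: 'a) (mk_version: nat)

datatype 'a dec_key =
  DecKey (dk_D: 'a) (dk_version: nat) (dk_attrs: "(attribute \<times> 'a \<times> 'a) list")

text \<open>The pairs \<open>(C\<^sub>y, C'\<^sub>y)\<close> are listed in the order of the leaves \<open>y\<close> of the policy.\<close>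

datatype ('a, 'b) ciphertext =
  Ciphertext (cp_policy: policy) (cp_Ct: 'b) (cp_C: 'a) (cp_version: nat)
    (cp_leaves: "('a \<times> 'a) list")


section \<open>The scheme\<close>

text \<open>
  All group elements are given by their discrete logarithms, so that multiplication,
  exponentiation and pairing become addition, multiplication and multiplication modulo \<open>p\<close>.
\<close>

abbreviation Zp :: "nat \<Rightarrow> int set" where
  "Zp p \<equiv> {0..<int p}"

definition sample_Zp :: "nat \<Rightarrow> int pmf" where
  "sample_Zp p = pmf_of_set (Zp p)"

definition sample_Zp_unit :: "nat \<Rightarrow> int pmf" where
  "sample_Zp_unit p = pmf_of_set {1..<int p}"

definition div_Zp :: "nat \<Rightarrow> int \<Rightarrow> int \<Rightarrow> int" where
  "div_Zp p x y = x * modular_inverse (int p) y mod int p"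

text \<open>The random oracle is sampled lazily: the table holds the hash values fixed so far.\<close>

type_synonym hash_table = "bool list \<Rightarrow> int option"

definition hash :: "nat \<Rightarrow> bool list \<Rightarrow> hash_table \<Rightarrow> (int \<times> hash_table) pmf" where
  "hash p x tab = (case tab x of
      Some y \<Rightarrow> return_pmf (y, tab)
    | None \<Rightarrow> do { y \<leftarrow> sample_Zp p; return_pmf (y, tab(x \<mapsto> y)) })"

definition Setup :: "nat \<Rightarrow> ((int, int) enc_key \<times> int master_key) pmf" where
  "Setup p = do {
     \<alpha> \<leftarrow> sample_Zp p;
     \<beta> \<leftarrow> sample_Zp_unit p;
     return_pmf (EncKey 1 \<beta> \<alpha> 0, MasterKey \<beta> \<alpha> 0) }"

text \<open>
  Fixing \<open>q(0)\<close> and choosing \<open>d\<close> other points at random amounts to a uniform choice among the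
  polynomials of degree at most \<open>d\<close> over \<open>\<int>/p\<int>\<close> with the given value at 0. Polynomials
  over \<open>\<int>/p\<int>\<close> are represented by integer polynomials with reduced coefficients.
\<close>

definition sample_poly :: "nat \<Rightarrow> nat \<Rightarrow> int \<Rightarrow> int poly pmf" where
  "sample_poly p d v =
     pmf_of_set {q. degree q \<le> d \<and> poly q 0 = v \<and> (\<forall>i. coeff q i \<in> Zp p)}"

text \<open>
  \<open>share p x v\<close> chooses the polynomials of the subtree \<open>x\<close>, where \<open>v\<close> is the value of
  \<open>q\<^sub>x\<close> at 0, and returns the values \<open>q\<^sub>y(0)\<close> for its leaves \<open>y\<close>. The polynomial
  of a leaf has degree 0, so it is the constant \<open>v\<close>.
\<close>

fun share :: "nat \<Rightarrow> policy \<Rightarrow> int \<Rightarrow> int list pmf"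
and share_list :: "nat \<Rightarrow> int poly \<Rightarrow> policy list \<Rightarrow> int list pmf" where
  "share p (Leaf i a) v = return_pmf [v]"
| "share p (Gate i k ts) v = do { q \<leftarrow> sample_poly p (k - 1) v; share_list p q ts }"
| "share_list p q [] = return_pmf []"
| "share_list p q (t # ts) = do {
     xs \<leftarrow> share p t (poly q (int (index t)) mod int p);
     ys \<leftarrow> share_list p q ts;
     return_pmf (xs @ ys) }"

fun encrypt_leaves ::
  "nat \<Rightarrow> int \<Rightarrow> (attribute \<times> int) list \<Rightarrow> hash_table \<Rightarrow> ((int \<times> int) list \<times> hash_table) pmf"
where
  "encrypt_leaves p g [] tab = return_pmf ([], tab)"
| "encrypt_leaves p g ((a, q) # ys) tab = do {
     (h, tab) \<leftarrow> hash p a tab;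
     (cs, tab) \<leftarrow> encrypt_leaves p g ys tab;
     return_pmf ((g * q mod int p, h * q mod int p) # cs, tab) }"

definition Encrypt ::
  "nat \<Rightarrow> int \<Rightarrow> policy \<Rightarrow> (int, int) enc_key \<Rightarrow> hash_table
     \<Rightarrow> ((int, int) ciphertext \<times> hash_table) pmf"
where
  "Encrypt p M P ek tab = do {
     s \<leftarrow> sample_Zp p;
     qs \<leftarrow> share p P s;
     (cs, tab) \<leftarrow> encrypt_leaves p (ek_g ek) (zip (leaves P) qs) tab;
     return_pmf
       (Ciphertext P ((M + ek_l ek * s) mod int p) (ek_h ek * s mod int p) (ek_version ek) cs,
        tab) }"

fun keygen_attrs ::
  "nat \<Rightarrow> int \<Rightarrow> attribute list \<Rightarrow> hash_table
     \<Rightarrow> ((attribute \<times> int \<times> int) list \<times> hash_table) pmf"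
where
  "keygen_attrs p r [] tab = return_pmf ([], tab)"
| "keygen_attrs p r (j # js) tab = do {
     rj \<leftarrow> sample_Zp p;
     (h, tab) \<leftarrow> hash p j tab;
     (ds, tab) \<leftarrow> keygen_attrs p r js tab;
     return_pmf ((j, (r + h * rj) mod int p, rj) # ds, tab) }"

text \<open>Attribute sets are given as lists without repetitions.\<close>

definition KeyGen ::
  "nat \<Rightarrow> int master_key \<Rightarrow> attribute list \<Rightarrow> hash_table \<Rightarrow> (int dec_key \<times> hash_table) pmf"
where
  "KeyGen p mk \<gamma> tab = do {
     r \<leftarrow> sample_Zp p;
     (ds, tab) \<leftarrow> keygen_attrs p r \<gamma> tab;
     return_pmf (DecKey (div_Zp p (mk_g_alpha mk + r) (mk_beta mk)) (mk_version mk) ds, tab) }"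

text \<open>The update quantities; \<open>u_ek\<close> is an element of \<open>G\<^sub>0\<close>, the other two are scalars.\<close>

record update =
  u_cp :: int
  u_ek :: int
  u_dk :: int

definition UpdateMK :: "nat \<Rightarrow> int master_key \<Rightarrow> (int master_key \<times> update) pmf" where
  "UpdateMK p mk = do {
     \<beta> \<leftarrow> sample_Zp_unit p;
     return_pmf
       (MasterKey \<beta> (mk_g_alpha mk) (mk_version mk + 1),
        \<lparr> u_cp = div_Zp p \<beta> (mk_beta mk), u_ek = \<beta>, u_dk = div_Zp p (mk_beta mk) \<beta> \<rparr>) }"

definition UpdateEK :: "update \<Rightarrow> nat \<Rightarrow> (int, int) enc_key \<Rightarrow> (int, int) enc_key" where
  "UpdateEK u n ek = EncKey (ek_g ek) (u_ek u) (ek_l ek) n"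

text \<open>In the following two definitions \<open>us i\<close> holds the update quantities of version \<open>i\<close>.\<close>

definition UpdateDK :: "nat \<Rightarrow> (nat \<Rightarrow> update) \<Rightarrow> nat \<Rightarrow> int dec_key \<Rightarrow> int dec_key" where
  "UpdateDK p us n dk =
     DecKey (dk_D dk * (\<Prod>i\<in>{dk_version dk + 1..n}. u_dk (us i)) mod int p) n (dk_attrs dk)"

definition UpdateCP ::
  "nat \<Rightarrow> (nat \<Rightarrow> update) \<Rightarrow> nat \<Rightarrow> (int, int) ciphertext \<Rightarrow> (int, int) ciphertext"
where
  "UpdateCP p us n cp =
     Ciphertext (cp_policy cp) (cp_Ct cp)
       (cp_C cp * (\<Prod>i\<in>{cp_version cp + 1..n}. u_cp (us i)) mod int p) n (cp_leaves cp)"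


section \<open>Messages\<close>

text \<open>
  Everything exchanged between the adversary and its environment is a nested list of bit
  strings, written as a word over a finite alphabet. Natural numbers are written in binary,
  least significant bit first.
\<close>

datatype symbol = Bit_0 | Bit_1 | Sep | Open | Close

datatype sexp = Atom "bool list" | Node "sexp list"

fun word_of :: "sexp \<Rightarrow> symbol list" where
  "word_of (Atom bs) = map (\<lambda>b. if b then Bit_1 else Bit_0) bs @ [Sep]"
| "word_of (Node xs) = Open # concat (map word_of xs) @ [Close]"

fun bits :: "nat \<Rightarrow> bool list" where
  "bits n = (if n = 0 then [] else odd n # bits (n div 2))"

declare bits.simps [simp del]

definition num :: "nat \<Rightarrow> sexp" where
  "num n = Atom (bits n)"

type_synonym enc = "bool list"

fun sexp_policy :: "policy \<Rightarrow> sexp" where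
  "sexp_policy (Leaf i a) = Node [num i, Atom a]"
| "sexp_policy (Gate i k ts) = Node [num i, num k, Node (map sexp_policy ts)]"

fun sexp_enc_key :: "(enc, enc) enc_key \<Rightarrow> sexp" where
  "sexp_enc_key (EncKey g h l v) = Node [Atom g, Atom h, Atom l, num v]"

fun sexp_dec_key :: "enc dec_key \<Rightarrow> sexp" where
  "sexp_dec_key (DecKey d v ds) =
     Node [Atom d, num v, Node (map (\<lambda>(j, x, y). Node [Atom j, Atom x, Atom y]) ds)]"

fun sexp_ciphertext :: "(enc, enc) ciphertext \<Rightarrow> sexp" where
  "sexp_ciphertext (Ciphertext P ct c v cs) =
     Node [sexp_policy P, Atom ct, Atom c, num v,
       Node (map (\<lambda>(x, y). Node [Atom x, Atom y]) cs)]"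

datatype query =
    Mult0 enc enc
  | Inv0 enc
  | Mult1 enc enc
  | Inv1 enc
  | Pairing enc enc
  | Hash "bool list"
  | Update_Enc_Key
  | Gen_Dec_Key "attribute list"
  | Gen_D_Field "attribute list"
  | Update_Dec_Key "enc dec_key"
  | Update_Ciphertext "(enc, enc) ciphertext"
  | Challenge enc enc policy

fun sexp_query :: "query \<Rightarrow> sexp" where
  "sexp_query (Mult0 x y) = Node [num 0, Atom x, Atom y]"
| "sexp_query (Inv0 x) = Node [num 1, Atom x]"
| "sexp_query (Mult1 x y) = Node [num 2, Atom x, Atom y]"
| "sexp_query (Inv1 x) = Node [num 3, Atom x]"
| "sexp_query (Pairing x y) = Node [num 4, Atom x, Atom y]"
| "sexp_query (Hash x) = Node [num 5, Atom x]"
| "sexp_query Update_Enc_Key = Node [num 6]"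
| "sexp_query (Gen_Dec_Key \<gamma>) = Node [num 7, Node (map Atom \<gamma>)]"
| "sexp_query (Gen_D_Field \<gamma>) = Node [num 8, Node (map Atom \<gamma>)]"
| "sexp_query (Update_Dec_Key dk) = Node [num 9, sexp_dec_key dk]"
| "sexp_query (Update_Ciphertext cp) = Node [num 10, sexp_ciphertext cp]"
| "sexp_query (Challenge m0 m1 P) = Node [num 11, Atom m0, Atom m1, sexp_policy P]"

definition decode_query :: "symbol list \<Rightarrow> query option" where
  "decode_query w =
     (if w \<in> range (word_of \<circ> sexp_query) then Some (inv (word_of \<circ> sexp_query) w) else None)"

lemma bits_inject [simp]: "bits m = bits n \<longleftrightarrow> m = n"
proof
  assume "bits m = bits n"
  then show "m = n"
  proof (induction m arbitrary: n rule: bits.induct)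
    case (1 m)
    show ?case
    proof (cases "m = 0 \<or> n = 0")
      case True
      with 1(2) show ?thesis by (auto simp: bits.simps split: if_splits)
    next
      case False
      with 1(2) have *: "odd m = odd n" "bits (m div 2) = bits (n div 2)"
        by (simp_all add: bits.simps[of m] bits.simps[of n])
      from *(2) have "m div 2 = n div 2" using 1(1) False by blast
      with *(1) show ?thesis by (metis div_mult_mod_eq odd_iff_mod_2_eq_one
          not_mod_2_eq_1_eq_0)
    qed
  qed
qed simp

lemma num_inject [simp]: "num m = num n \<longleftrightarrow> m = n"
  by (simp add: num_def)

lemma word_of_Atom_prefix:
  "map (\<lambda>b. if b then Bit_1 else Bit_0) bs @ Sep # u =
     map (\<lambda>b. if b then Bit_1 else Bit_0) cs @ Sep # v \<Longrightarrow> bs = cs \<and> u = v"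
proof (induction bs arbitrary: cs)
  case Nil
  then show ?case by (cases cs) (auto split: if_splits)
next
  case (Cons b bs)
  then show ?case by (cases cs) (auto split: if_splits)
qed

lemma word_of_prefix_free: "word_of x @ u = word_of y @ v \<Longrightarrow> x = y \<and> u = v"
proof (induction x arbitrary: y u v rule: word_of.induct)
  case (1 bs)
  show ?case
  proof (cases y)
    case (Atom cs)
    with 1 show ?thesis using word_of_Atom_prefix[of bs u cs v] by simp
  next
    case (Node ys)
    with 1 show ?thesis by (cases bs) (auto split: if_splits)
  qed
next
  case (2 xs)
  show ?case
  proof (cases y)
    case (Atom cs)
    with 2(2) show ?thesis by (cases cs) (auto split: if_splits)
  next
    case (Node ys)
    have hd: "word_of z \<noteq> [] \<and> hd (word_of z) \<noteq> Close" for z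
    proof (cases z)
      case (Atom cs)
      then show ?thesis by (cases cs) auto
    qed simp
    have "concat (map word_of xs) @ Close # u = concat (map word_of ys) @ Close # v
            \<Longrightarrow> xs = ys \<and> u = v"
      using 2(1)
    proof (induction xs arbitrary: ys)
      case Nil
      show ?case
      proof (cases ys)
        case Nil
        with Nil.prems show ?thesis by simp
      next
        case (Cons y' ys')
        with Nil.prems hd[of y'] show ?thesis by (cases "word_of y'") auto
      qed
    next
      case (Cons x xs)
      show ?case
      proof (cases ys)
        case Nil
        with Cons.prems(1) hd[of x] show ?thesis by (cases "word_of x") auto
      next
        case (Cons y' ys')
        with Cons.prems(1) have "word_of x @ (concat (map word_of xs) @ Close # u) =
            word_of y' @ (concat (map word_of ys') @ Close # v)"
          by simp
        from Cons.prems(2)[OF _ this] have x: "x = y'" and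
          eq: "concat (map word_of xs) @ Close # u = concat (map word_of ys') @ Close # v"
          by simp_all
        have "xs = ys' \<and> u = v"
          by (rule Cons.IH[OF eq]) (rule Cons.prems(2), simp_all)
        with x Cons show ?thesis by simp
      qed
    qed
    with 2(2) Node show ?thesis by simp
  qed
qed

lemma inj_word_of: "inj word_of"
  by (rule injI) (use word_of_prefix_free[where u = "[]" and v = "[]"] in auto)

lemma sexp_policy_inject [simp]: "sexp_policy P = sexp_policy Q \<longleftrightarrow> P = Q"
proof
  assume "sexp_policy P = sexp_policy Q"
  then show "P = Q"
  proof (induction P arbitrary: Q rule: sexp_policy.induct)
    case (1 i a)
    then show ?case by (cases Q) auto
  next
    case (2 i k ts)
    then obtain us where Q: "Q = Gate i k us" and eq: "map sexp_policy ts = map sexp_policy us"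
      by (cases Q) auto
    have "ts = us"
      using eq 2(1)
    proof (induction ts arbitrary: us)
      case (Cons t ts)
      then show ?case by (cases us) auto
    qed simp
    with Q show ?case by simp
  qed
qed simp

lemma sexp_dec_key_inject [simp]: "sexp_dec_key x = sexp_dec_key y \<longleftrightarrow> x = y"
  by (cases x; cases y) (auto simp: inj_map_eq_map inj_def)

lemma sexp_ciphertext_inject [simp]: "sexp_ciphertext x = sexp_ciphertext y \<longleftrightarrow> x = y"
  by (cases x; cases y) (auto simp: inj_map_eq_map inj_def)

lemma inj_sexp_query: "inj sexp_query"
proof (rule injI)
  fix x y assume "sexp_query x = sexp_query y"
  then show "x = y" by (cases x; cases y) (auto simp: inj_map_eq_map inj_def)
qed

lemma decode_query_word_of [simp]: "decode_query (word_of (sexp_query q)) = Some q"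
proof -
  have "inj (word_of \<circ> sexp_query)"
    using inj_compose[OF inj_word_of inj_sexp_query] .
  from inv_f_f[OF this, of q] show ?thesis by (auto simp: decode_query_def)
qed


section \<open>Probabilistic polynomial-time adversaries\<close>

text \<open>
  An adversary is a probabilistic Turing machine with a two-way infinite work tape, a read-once
  inbox for the messages it receives, and an append-only outbox for the messages it sends. In
  each step it sees the scanned work symbol, the next inbox symbol and a fresh coin. The control
  \<open>Ask\<close> sends the contents of the outbox; the reply replaces the contents of the inbox.
\<close>

datatype control = Continue | Ask | Halt bool

datatype move = Move_Left | Stay | Move_Right

record instruction =
  next_state :: nat
  write_symbol :: "symbol option"
  move_head :: move
  consume :: bool
  emit :: "symbol option"
  control_of :: control

record machine =
  num_states :: nat
  transition :: "nat \<Rightarrow> symbol option \<Rightarrow> symbol option \<Rightarrow> bool \<Rightarrow> instruction"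

definition wf_machine :: "machine \<Rightarrow> bool" where
  "wf_machine A \<longleftrightarrow>
     0 < num_states A \<and>
     (\<forall>q<num_states A. \<forall>x y c. next_state (transition A q x y c) < num_states A)"

record config =
  state :: nat
  tape :: "int \<Rightarrow> symbol option"
  head :: int
  inbox :: "symbol list"
  outbox :: "symbol list"

text \<open>Initially the work tape holds the security parameter in unary.\<close>

definition initial_config :: "nat \<Rightarrow> symbol list \<Rightarrow> config" where
  "initial_config \<kappa> w =
     \<lparr> state = 0, tape = (\<lambda>i. if 0 \<le> i \<and> i < int \<kappa> then Some Bit_1 else None), head = 0,
       inbox = w, outbox = [] \<rparr>"

definition fetch :: "machine \<Rightarrow> config \<Rightarrow> bool \<Rightarrow> instruction" where
  "fetch A c coin =
     transition A (state c) (tape c (head c))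
       (case inbox c of [] \<Rightarrow> None | x # xs \<Rightarrow> Some x) coin"

definition execute :: "instruction \<Rightarrow> config \<Rightarrow> config" where
  "execute i c =
     \<lparr> state = next_state i,
       tape = (tape c)(head c := write_symbol i),
       head =
         (case move_head i of
            Move_Left \<Rightarrow> head c - 1
          | Stay \<Rightarrow> head c
          | Move_Right \<Rightarrow> head c + 1),
       inbox = (if consume i then tl (inbox c) else inbox c),
       outbox = outbox c @ (case emit i of None \<Rightarrow> [] | Some x \<Rightarrow> [x]) \<rparr>"

definition deliver :: "symbol list \<Rightarrow> config \<Rightarrow> config" where
  "deliver w c = c\<lparr> inbox := w, outbox := [] \<rparr>"

text \<open>Halting within \<open>t\<close> steps, whatever the coins and the replies are.\<close>

primrec halts_within :: "machine \<Rightarrow> nat \<Rightarrow> config \<Rightarrow> bool" where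
  "halts_within A 0 c = False"
| "halts_within A (Suc t) c = (\<forall>coin.
     let i = fetch A c coin; c' = execute i c in
     (case control_of i of
        Continue \<Rightarrow> halts_within A t c'
      | Ask \<Rightarrow> (\<forall>w. halts_within A t (deliver w c'))
      | Halt b \<Rightarrow> True))"

definition runs_in_time :: "machine \<Rightarrow> nat poly \<Rightarrow> bool" where
  "runs_in_time A T \<longleftrightarrow> (\<forall>\<kappa> w. halts_within A (poly T \<kappa>) (initial_config \<kappa> w))"

text \<open>
  Running a machine for at most \<open>t\<close> steps against a stateful environment; the result is the
  output bit (if the machine halts) and the final state of the environment.
\<close>

primrec run ::
  "machine \<Rightarrow> (symbol list \<Rightarrow> 's \<Rightarrow> (symbol list \<times> 's) pmf) \<Rightarrow> nat \<Rightarrow> config \<Rightarrow> 's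
     \<Rightarrow> (bool option \<times> 's) pmf"
where
  "run A env 0 c \<sigma> = return_pmf (None, \<sigma>)"
| "run A env (Suc t) c \<sigma> = do {
     coin \<leftarrow> bernoulli_pmf (1 / 2);
     let i = fetch A c coin; c' = execute i c in
     (case control_of i of
        Continue \<Rightarrow> run A env t c' \<sigma>
      | Ask \<Rightarrow> do { (w, \<sigma>') \<leftarrow> env (outbox c') \<sigma>; run A env t (deliver w c') \<sigma>' }
      | Halt b \<Rightarrow> return_pmf (Some b, \<sigma>)) }"


section \<open>The generic bilinear group model\<close>

definition encodings :: "nat \<Rightarrow> nat \<Rightarrow> (int \<Rightarrow> enc) set" where
  "encodings p m = {\<psi> \<in> Zp p \<rightarrow>\<^sub>E {bs. length bs = m}. inj_on \<psi> (Zp p)}"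

text \<open>The strings that represent group elements, and the discrete logarithm of such a string.\<close>

definition valid :: "nat \<Rightarrow> (int \<Rightarrow> enc) \<Rightarrow> enc \<Rightarrow> bool" where
  "valid p \<psi> x \<longleftrightarrow> x \<in> \<psi> ` Zp p"

definition dlog :: "nat \<Rightarrow> (int \<Rightarrow> enc) \<Rightarrow> enc \<Rightarrow> int" where
  "dlog p \<psi> x = inv_into (Zp p) \<psi> x"


section \<open>The game\<close>

text \<open>
  The challenger remembers the attribute sets of the generate decryption key queries answered so
  far and, once the challenge has been issued, the challenge policy and the bit.
\<close>

record challenger =
  ch_ek :: "(int, int) enc_key"
  ch_mk :: "int master_key"
  ch_updates :: "nat \<Rightarrow> update"
  ch_hash :: hash_table
  ch_queried :: "attribute set set"
  ch_challenge :: "(policy \<times> bool) option"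

text \<open>
  Queries that are malformed, contain strings that do not represent group elements, or are not
  permitted by the rules of the game are rejected without any effect.
\<close>

definition reject :: "challenger \<Rightarrow> (sexp \<times> challenger) pmf" where
  "reject \<sigma> = return_pmf (Node [], \<sigma>)"

fun answer ::
  "nat \<Rightarrow> (int \<Rightarrow> enc) \<Rightarrow> (int \<Rightarrow> enc) \<Rightarrow> query \<Rightarrow> challenger \<Rightarrow> (sexp \<times> challenger) pmf"
where
  "answer p \<psi>0 \<psi>1 (Mult0 x y) \<sigma> =
     (if valid p \<psi>0 x \<and> valid p \<psi>0 y
      then return_pmf (Atom (\<psi>0 ((dlog p \<psi>0 x + dlog p \<psi>0 y) mod int p)), \<sigma>)
      else reject \<sigma>)"
| "answer p \<psi>0 \<psi>1 (Inv0 x) \<sigma> =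
     (if valid p \<psi>0 x
      then return_pmf (Atom (\<psi>0 (- dlog p \<psi>0 x mod int p)), \<sigma>)
      else reject \<sigma>)"
| "answer p \<psi>0 \<psi>1 (Mult1 x y) \<sigma> =
     (if valid p \<psi>1 x \<and> valid p \<psi>1 y
      then return_pmf (Atom (\<psi>1 ((dlog p \<psi>1 x + dlog p \<psi>1 y) mod int p)), \<sigma>)
      else reject \<sigma>)"
| "answer p \<psi>0 \<psi>1 (Inv1 x) \<sigma> =
     (if valid p \<psi>1 x
      then return_pmf (Atom (\<psi>1 (- dlog p \<psi>1 x mod int p)), \<sigma>)
      else reject \<sigma>)"
| "answer p \<psi>0 \<psi>1 (Pairing x y) \<sigma> =
     (if valid p \<psi>0 x \<and> valid p \<psi>0 y
      then return_pmf (Atom (\<psi>1 (dlog p \<psi>0 x * dlog p \<psi>0 y mod int p)), \<sigma>)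
      else reject \<sigma>)"
| "answer p \<psi>0 \<psi>1 (Hash x) \<sigma> = do {
     (h, tab) \<leftarrow> hash p x (ch_hash \<sigma>);
     return_pmf (Atom (\<psi>0 h), \<sigma>\<lparr> ch_hash := tab \<rparr>) }"
| "answer p \<psi>0 \<psi>1 Update_Enc_Key \<sigma> = do {
     (mk, u) \<leftarrow> UpdateMK p (ch_mk \<sigma>);
     let n = mk_version mk;
         us = (ch_updates \<sigma>)(n := u);
         ek = UpdateEK u n (ch_ek \<sigma>);
         \<sigma>' = \<sigma>\<lparr> ch_mk := mk, ch_ek := ek, ch_updates := us \<rparr> in
     return_pmf
       (Node [sexp_enc_key (map_enc_key \<psi>0 \<psi>1 ek),
              Node (map (\<lambda>i. num (nat (u_dk (us i)))) [1..<n + 1])], \<sigma>') }"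
| "answer p \<psi>0 \<psi>1 (Gen_Dec_Key \<gamma>) \<sigma> =
     (if distinct \<gamma> \<and>
         (case ch_challenge \<sigma> of None \<Rightarrow> True | Some (P, b) \<Rightarrow> \<not> satisfies (set \<gamma>) P)
      then do {
        (dk, tab) \<leftarrow> KeyGen p (ch_mk \<sigma>) \<gamma> (ch_hash \<sigma>);
        return_pmf
          (sexp_dec_key (map_dec_key \<psi>0 dk),
           \<sigma>\<lparr> ch_hash := tab, ch_queried := insert (set \<gamma>) (ch_queried \<sigma>) \<rparr>) }
      else reject \<sigma>)"
| "answer p \<psi>0 \<psi>1 (Gen_D_Field \<gamma>) \<sigma> =
     (if distinct \<gamma>
      then do {
        (dk, tab) \<leftarrow> KeyGen p (ch_mk \<sigma>) \<gamma> (ch_hash \<sigma>);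
        return_pmf (Atom (\<psi>0 (dk_D dk)), \<sigma>\<lparr> ch_hash := tab \<rparr>) }
      else reject \<sigma>)"
| "answer p \<psi>0 \<psi>1 (Update_Dec_Key dk) \<sigma> =
     (let n = mk_version (ch_mk \<sigma>) in
      if dk_version dk < n \<and> distinct (map fst (dk_attrs dk)) \<and>
         (\<forall>x\<in>set_dec_key dk. valid p \<psi>0 x)
      then return_pmf
        (sexp_dec_key (map_dec_key \<psi>0
           (UpdateDK p (ch_updates \<sigma>) n (map_dec_key (dlog p \<psi>0) dk))), \<sigma>)
      else reject \<sigma>)"
| "answer p \<psi>0 \<psi>1 (Update_Ciphertext cp) \<sigma> =
     (let n = mk_version (ch_mk \<sigma>) in
      if cp_version cp < n \<and> wf_policy (cp_policy cp) \<and>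
         length (cp_leaves cp) = length (leaves (cp_policy cp)) \<and>
         (\<forall>x\<in>set1_ciphertext cp. valid p \<psi>0 x) \<and> (\<forall>x\<in>set2_ciphertext cp. valid p \<psi>1 x)
      then return_pmf
        (sexp_ciphertext (map_ciphertext \<psi>0 \<psi>1
           (UpdateCP p (ch_updates \<sigma>) n (map_ciphertext (dlog p \<psi>0) (dlog p \<psi>1) cp))), \<sigma>)
      else reject \<sigma>)"
| "answer p \<psi>0 \<psi>1 (Challenge m0 m1 P) \<sigma> =
     (if ch_challenge \<sigma> = None \<and> valid p \<psi>1 m0 \<and> valid p \<psi>1 m1 \<and> length m0 = length m1 \<and>
         wf_policy P \<and> (\<forall>\<gamma>\<in>ch_queried \<sigma>. \<not> satisfies \<gamma> P)
      then do {
        b \<leftarrow> bernoulli_pmf (1 / 2);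
        (cp, tab) \<leftarrow>
          Encrypt p (dlog p \<psi>1 (if b then m1 else m0)) P (ch_ek \<sigma>) (ch_hash \<sigma>);
        return_pmf
          (sexp_ciphertext (map_ciphertext \<psi>0 \<psi>1 cp),
           \<sigma>\<lparr> ch_hash := tab, ch_challenge := Some (P, b) \<rparr>) }
      else reject \<sigma>)"

definition environment ::
  "nat \<Rightarrow> (int \<Rightarrow> enc) \<Rightarrow> (int \<Rightarrow> enc) \<Rightarrow> symbol list \<Rightarrow> challenger
     \<Rightarrow> (symbol list \<times> challenger) pmf"
where
  "environment p \<psi>0 \<psi>1 w \<sigma> = map_pmf (apfst word_of)
     (case decode_query w of None \<Rightarrow> reject \<sigma> | Some q \<Rightarrow> answer p \<psi>0 \<psi>1 q \<sigma>)"

text \<open>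
  The adversary \<open>A\<close> is run for at most \<open>t\<close> steps. The first message consists of the group order
  and the encryption key. The result is \<open>True\<close> if a challenge has been issued and the bit has
  been guessed correctly.
\<close>

definition Game2 :: "nat \<Rightarrow> nat \<Rightarrow> machine \<Rightarrow> nat \<Rightarrow> nat \<Rightarrow> bool pmf" where
  "Game2 p m A t \<kappa> = do {
     \<psi>0 \<leftarrow> pmf_of_set (encodings p m);
     \<psi>1 \<leftarrow> pmf_of_set (encodings p m);
     (ek, mk) \<leftarrow> Setup p;
     (guess, \<sigma>) \<leftarrow>
       run A (environment p \<psi>0 \<psi>1) t
         (initial_config \<kappa> (word_of (Node [num p, sexp_enc_key (map_enc_key \<psi>0 \<psi>1 ek)])))
         \<lparr> ch_ek = ek, ch_mk = mk, ch_updates = (\<lambda>i. undefined), ch_hash = Map.empty,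
           ch_queried = {}, ch_challenge = None \<rparr>;
     return_pmf (case ch_challenge \<sigma> of None \<Rightarrow> False | Some (P, b) \<Rightarrow> guess = Some b) }"

definition advantage :: "nat \<Rightarrow> nat \<Rightarrow> machine \<Rightarrow> nat \<Rightarrow> nat \<Rightarrow> real" where
  "advantage p m A t \<kappa> = measure_pmf.prob (Game2 p m A t \<kappa>) {True} - 1 / 2"

definition non_negligible :: "(nat \<Rightarrow> real) \<Rightarrow> bool" where
  "non_negligible f \<longleftrightarrow> (\<exists>c::nat. \<exists>\<^sub>F \<kappa> in sequentially. f \<kappa> \<ge> 1 / real \<kappa> ^ c)"

end

theory Submission
  imports Defs "HOL-Real_Asymp.Real_Asymp"
begin

text \<open>
  After the substitutions \<open>\<alpha> = \<beta> a\<close>, \<open>r = \<beta> r'\<close> and \<open>\<beta>\<^sup>(\<^sup>i\<^sup>) = c\<^sub>i \<beta>\<close> with public \<open>c\<^sub>i\<close>, every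
  group element that the adversary ever sees is the value of a polynomial whose coefficients are known, plus, in
  \<open>G\<^sub>1\<close>, a known multiple of \<open>m\<^sub>b + \<beta> a s\<close>. The adversary only sees encodings, hence only which of
  these polynomials take equal values. Distinct polynomials collide at the random point with
  negligible probability (Schwartz-Zippel), and a string that was never handed out encodes an element
  with negligible probability. The coincidences that remain are identities, and these do not depend on \<open>b\<close>,
  because \<open>\<beta> a s\<close> is not in the span of the products of two \<open>G\<^sub>0\<close> elements: there is a linear functional,
  a signed sum of evaluations, that vanishes on these products but not on \<open>\<beta> a s\<close>. For every key it
  evaluates at shares with \<open>s = 1\<close> which are 0 at the leaves whose attributes belong to the key; they exist since
  the attribute set of the key does not satisfy the policy.

  Accordingly, given all encodings revealed so far, \<open>b\<close> is uniform up to the collisions. An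
  induction on the running time, for an arbitrary symbolic state, bounds the probability of a
  correct guess by \<open>1/2\<close> plus the sum of the error probabilities.
\<close>

section \<open>Random exponents as indeterminates\<close>

text \<open>The game fixes both encodings before the run, whereas the argument needs them revealed
  string by string. So the real game is kept and conditioned: a symbolic state lists the strings
  handed out so far with their polynomials, and exponents, bit and encodings are averaged over
  everything consistent with this list. In each state the reply to a query becomes a fixed word, and
  the machine goes on from a larger state. Polynomials are functions on integer assignments, with
  degree and support defined semantically. An identity is then a congruence modulo p at all points
  and can be refuted by evaluation; this is why the separating functional is a sum of evaluations.
  The bit belongs to the state from the start although the challenger draws it late; until the
  challenge its coefficient is 0 everywhere. A single query can create many indeterminates and
  strings, but only in proportion to the length of its word. Hence all errors are charged to the
  symbols the machine writes.\<close>

text \<open>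
  The secret exponents are rewritten as \<open>\<alpha> = \<beta> a\<close> and \<open>r = \<beta> r'\<close>, so that the division by \<open>\<beta>\<close>
  in \<open>KeyGen\<close> disappears. The indeterminates are \<open>\<beta>\<close>, \<open>a\<close>, \<open>s\<close>, the hash values, \<open>r'\<close> and
  \<open>r\<^sub>j\<close> of the \<open>k\<close>-th key, and the coefficient of \<open>X\<^sup>j\<close> in the polynomial of the node with
  index \<open>i\<close>.
\<close>

datatype var =
    VBeta | VA | VS | VHash "bool list" | VR nat | VRJ nat "bool list" | VCoef nat nat

type_synonym fn = "(var \<Rightarrow> int) \<Rightarrow> int"

definition samp :: "nat \<Rightarrow> var \<Rightarrow> int pmf" where
  "samp p v = (if v = VBeta then sample_Zp_unit p else sample_Zp p)"

text \<open>Sampling on top of a given assignment lets each query draw only its own fresh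
  indeterminates.\<close>

definition sample_on :: "nat \<Rightarrow> (var \<Rightarrow> int) \<Rightarrow> var set \<Rightarrow> (var \<Rightarrow> int) pmf" where
  "sample_on p x A = map_pmf (\<lambda>y v. if v \<in> A then y v else x v) (Pi_pmf A 0 (samp p))"

lemma sample_on_empty [simp]: "sample_on p x {} = return_pmf x"
  by (simp add: sample_on_def)

lemma sample_on_Un:
  assumes "finite A" "finite B" "A \<inter> B = {}"
  shows "sample_on p x (A \<union> B) = bind_pmf (sample_on p x A) (\<lambda>x1. sample_on p x1 B)"
  unfolding sample_on_def Pi_pmf_union[OF assms] pair_pmf_def map_pmf_def bind_assoc_pmf bind_return_pmf
  using assms(3) by (intro bind_pmf_cong refl) (auto simp: fun_eq_iff)

lemma sample_on_singleton: "sample_on p x {v} = map_pmf (\<lambda>y. x(v := y)) (samp p v)"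
  by (simp add: sample_on_def Pi_pmf_singleton pmf.map_comp o_def fun_upd_def if_distrib cong: if_cong)

lemma sample_on_insert:
  assumes "finite A" "v \<notin> A"
  shows "sample_on p x (insert v A) = bind_pmf (samp p v) (\<lambda>y. sample_on p (x(v := y)) A)"
  using sample_on_Un[of "{v}" A p x] assms
  by (simp add: sample_on_singleton map_pmf_def bind_assoc_pmf bind_return_pmf)

lemma set_sample_on:
  assumes "finite A" "y \<in> set_pmf (sample_on p x A)"
  shows "\<And>v. v \<in> A \<Longrightarrow> y v \<in> set_pmf (samp p v)" "\<And>v. v \<notin> A \<Longrightarrow> y v = x v"
  using assms by (auto simp: sample_on_def set_Pi_pmf PiE_dflt_def)

lemma set_samp:
  assumes "p \<ge> 2"
  shows "set_pmf (samp p v) = (if v = VBeta then {1..<int p} else Zp p)"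
  using assms by (auto simp: samp_def sample_Zp_def sample_Zp_unit_def)

section \<open>Roots modulo a prime and the Schwartz-Zippel bound\<close>

lemma finite_Zp_Collect [simp]: "finite {y. 0 \<le> y \<and> y < int p \<and> Q y}"
  by (rule finite_subset[of _ "Zp p"]) auto

text \<open>A root a is split off over the integers, q = (X - a) r + q(a). As p divides q(a), every
  other root modulo p is a root of r. The non-root y0 is inherited by r and stands for "q is not the
  zero function modulo p".\<close>

lemma card_roots_mod_prime:
  fixes q :: "int poly"
  assumes "prime p" "\<not> int p dvd poly q y0"
  shows "card {y \<in> Zp p. int p dvd poly q y} \<le> degree q"
  using assms(2)
proof (induction "degree q" arbitrary: q)
  case 0
  then obtain c where "q = [:c:]" by (metis degree_eq_zeroE)
  with 0 have "{y \<in> Zp p. int p dvd poly q y} = {}" by auto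
  then show ?case by (metis card.empty le0)
next
  case (Suc d)
  show ?case
  proof (cases "{y \<in> Zp p. int p dvd poly q y} = {}")
    case True
    then show ?thesis by (metis card.empty le0)
  next
    case False
    then obtain a where a: "a \<in> Zp p" "int p dvd poly q a" by auto
    define r where "r = synthetic_div q a"
    have q: "poly q y = (y - a) * poly r y + poly q a" for y
      using arg_cong[OF synthetic_div_correct'[of a q], of "\<lambda>s. poly s y"]
      by (simp add: r_def algebra_simps)
    have deg: "d = degree r" using Suc by (simp add: r_def degree_synthetic_div)
    have "\<not> int p dvd poly r y0" using Suc.prems q[of y0] a by (metis dvd_add dvd_mult)
    then have IH: "card {y \<in> Zp p. int p dvd poly r y} \<le> d" using Suc.hyps(1)[OF deg] deg by simp
    have "{y \<in> Zp p. int p dvd poly q y} \<subseteq> insert a {y \<in> Zp p. int p dvd poly r y}"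
    proof
      fix y assume y: "y \<in> {y \<in> Zp p. int p dvd poly q y}"
      then have "int p dvd (y - a) * poly r y" using q[of y] a(2)
        by (metis dvd_add_left_iff mem_Collect_eq)
      then have "int p dvd y - a \<or> int p dvd poly r y"
        using assms(1) by (simp add: prime_dvd_mult_iff)
      moreover have "int p dvd y - a \<Longrightarrow> y = a"
      proof -
        assume "int p dvd y - a"
        then have "y mod int p = a mod int p" by (simp add: mod_eq_dvd_iff)
        with y a show "y = a" by simp
      qed
      ultimately show "y \<in> insert a {y \<in> Zp p. int p dvd poly r y}" using y by auto
    qed
    then have "card {y \<in> Zp p. int p dvd poly q y} \<le> card (insert a {y \<in> Zp p. int p dvd poly r y})"
      by (intro card_mono) auto
    also have "\<dots> \<le> Suc d" using IH by (simp add: card_insert_if)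
    finally show ?thesis using Suc.hyps by simp
  qed
qed

text \<open>The degree in each indeterminate separately. It fits the proof of Schwartz-Zippel one
  indeterminate at a time, at the price of a factor equal to the number of indeterminates.\<close>

definition pdeg :: "nat \<Rightarrow> fn \<Rightarrow> bool" where
  "pdeg d f \<longleftrightarrow> (\<forall>v x. \<exists>q. degree q \<le> d \<and> (\<forall>y. f (x(v := y)) = poly q y))"

definition dep :: "var set \<Rightarrow> fn \<Rightarrow> bool" where
  "dep V f \<longleftrightarrow> (\<forall>x x'. (\<forall>v\<in>V. x v = x' v) \<longrightarrow> f x = f x')"

lemma pdeg_const [simp]: "pdeg d (\<lambda>x. c)"
  unfolding pdeg_def by (intro allI exI[of _ "[:c:]"]) auto

lemma pdeg_mono: "pdeg d f \<Longrightarrow> d \<le> d' \<Longrightarrow> pdeg d' f"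
  unfolding pdeg_def by (meson order_trans)

lemma pdeg_var: "d \<ge> 1 \<Longrightarrow> pdeg d (\<lambda>x. x v)"
  unfolding pdeg_def
proof (intro allI)
  fix v' and x :: "var \<Rightarrow> int"
  assume "d \<ge> 1"
  then show "\<exists>q. degree q \<le> d \<and> (\<forall>y. (x(v' := y)) v = poly q y)"
    by (intro exI[of _ "if v = v' then [:0, 1:] else [:x v:]"]) auto
qed

lemma pdeg_add: "pdeg d f \<Longrightarrow> pdeg d g \<Longrightarrow> pdeg d (\<lambda>x. f x + g x)"
  unfolding pdeg_def
proof (intro allI)
  fix v x
  assume "\<forall>v x. \<exists>q. degree q \<le> d \<and> (\<forall>y. f (x(v := y)) = poly q y)"
    "\<forall>v x. \<exists>q. degree q \<le> d \<and> (\<forall>y. g (x(v := y)) = poly q y)"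
  then obtain q r where "degree q \<le> d" "\<forall>y. f (x(v := y)) = poly q y"
    "degree r \<le> d" "\<forall>y. g (x(v := y)) = poly r y" by meson
  then show "\<exists>q. degree q \<le> d \<and> (\<forall>y. f (x(v := y)) + g (x(v := y)) = poly q y)"
    by (intro exI[of _ "q + r"]) (auto intro: degree_add_le)
qed

lemma pdeg_mult: "pdeg d f \<Longrightarrow> pdeg e g \<Longrightarrow> pdeg (d + e) (\<lambda>x. f x * g x)"
  unfolding pdeg_def
proof (intro allI)
  fix v x
  assume "\<forall>v x. \<exists>q. degree q \<le> d \<and> (\<forall>y. f (x(v := y)) = poly q y)"
    "\<forall>v x. \<exists>q. degree q \<le> e \<and> (\<forall>y. g (x(v := y)) = poly q y)"
  then obtain q r where "degree q \<le> d" "\<forall>y. f (x(v := y)) = poly q y"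
    "degree r \<le> e" "\<forall>y. g (x(v := y)) = poly r y" by meson
  then show "\<exists>q. degree q \<le> d + e \<and> (\<forall>y. f (x(v := y)) * g (x(v := y)) = poly q y)"
    by (intro exI[of _ "q * r"]) (auto intro: order_trans[OF degree_mult_le])
qed

lemma pdeg_cmult: "pdeg d f \<Longrightarrow> pdeg d (\<lambda>x. c * f x)"
  using pdeg_mult[of 0 "\<lambda>x. c" d f] by simp

lemma pdeg_diff: "pdeg d f \<Longrightarrow> pdeg d g \<Longrightarrow> pdeg d (\<lambda>x. f x - g x)"
  using pdeg_add[of d f "\<lambda>x. (-1) * g x"] pdeg_cmult[of d g "-1"] by simp

lemma pdeg_sum: "(\<And>i. i \<in> I \<Longrightarrow> pdeg d (f i)) \<Longrightarrow> pdeg d (\<lambda>x. \<Sum>i\<in>I. f i x)"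
  by (induction I rule: infinite_finite_induct) (auto intro: pdeg_add)

lemma depD: "dep V f \<Longrightarrow> (\<And>v. v \<in> V \<Longrightarrow> x v = x' v) \<Longrightarrow> f x = f x'"
  unfolding dep_def by blast

lemma dep_mono: "dep V f \<Longrightarrow> V \<subseteq> V' \<Longrightarrow> dep V' f"
  unfolding dep_def by blast

lemma dep_intros:
  "dep V (\<lambda>x. c)" "v \<in> V \<Longrightarrow> dep V (\<lambda>x. x v)"
  "dep V f \<Longrightarrow> dep V g \<Longrightarrow> dep V (\<lambda>x. f x + g x)"
  "dep V f \<Longrightarrow> dep V g \<Longrightarrow> dep V (\<lambda>x. f x - g x)"
  "dep V f \<Longrightarrow> dep V g \<Longrightarrow> dep V (\<lambda>x. f x * g x)"
  unfolding dep_def by auto metis+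

text \<open>The denominator p - 1 serves both distributions, since \<beta> ranges over the p - 1
  units only.\<close>

lemma prob_samp_root:
  assumes p: "prime p" and q: "degree q \<le> d" and y0: "\<not> int p dvd poly q y0"
  shows "emeasure (samp p v) {y. int p dvd poly q y} \<le> ennreal (real d / real (p - 1))"
proof -
  have p2: "p \<ge> 2" using p by (rule prime_ge_2_nat)
  define X where "X = (if v = VBeta then {1..<int p} else Zp p)"
  have X: "finite X" "X \<noteq> {}" "X \<subseteq> Zp p" "p - 1 \<le> card X"
    using p2 by (auto simp: X_def)
  have samp: "samp p v = pmf_of_set X"
    by (auto simp: samp_def X_def sample_Zp_def sample_Zp_unit_def)
  have "card (X \<inter> {y. int p dvd poly q y}) \<le> card {y \<in> Zp p. int p dvd poly q y}"
    using X by (intro card_mono) auto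
  also have "\<dots> \<le> d" using card_roots_mod_prime[OF p y0] q by simp
  finally have "real (card (X \<inter> {y. int p dvd poly q y})) / real (card X) \<le> real d / real (p - 1)"
    using X p2 by (intro frac_le) auto
  then show ?thesis
    using X by (simp add: samp emeasure_pmf_of_set ennreal_leI)
qed

text \<open>On the line through the non-root x0 in direction v, f is a univariate polynomial that is
  nonzero modulo p somewhere, so few values y are bad. For any other y the point x0(v := y) is a
  non-root for the remaining indeterminates. Outside V the points x and x0 agree because f may read
  values that are not sampled.\<close>

lemma schwartz_zippel:
  assumes p: "prime p" and "finite V" and f: "pdeg d f" and "\<not> int p dvd f x0"
    and "\<And>v. v \<notin> V \<Longrightarrow> x v = x0 v"
  shows "emeasure (sample_on p x V) {x. int p dvd f x} \<le> ennreal (real (card V) * (real d / real (p - 1)))"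
  using assms(2,4,5)
proof (induction V arbitrary: x x0 rule: finite_induct)
  case empty
  then have "x = x0" by auto
  with empty show ?case by (simp add: indicator_def)
next
  case (insert v V)
  define e where "e = real d / real (p - 1)"
  have e: "e \<ge> 0" by (simp add: e_def)
  obtain q where q: "degree q \<le> d" "\<And>y. f (x0(v := y)) = poly q y"
    using f unfolding pdeg_def by meson
  have y0: "\<not> int p dvd poly q (x0 v)" using insert.prems(1) q(2)[of "x0 v"] by simp
  let ?B = "{x. int p dvd f x}"
  have "emeasure (sample_on p x (insert v V)) ?B =
      (\<integral>\<^sup>+y. emeasure (sample_on p (x(v := y)) V) ?B \<partial>samp p v)"
    using insert.hyps by (simp add: sample_on_insert emeasure_bind_pmf)
  also have "\<dots> \<le> (\<integral>\<^sup>+y. indicator {y. int p dvd poly q y} y + ennreal (real (card V) * e) \<partial>samp p v)"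
  proof (intro nn_integral_mono)
    fix y
    show "emeasure (sample_on p (x(v := y)) V) ?B
        \<le> indicator {y. int p dvd poly q y} y + ennreal (real (card V) * e)"
    proof (cases "int p dvd poly q y")
      case True
      have "emeasure (sample_on p (x(v := y)) V) ?B \<le> 1" by (rule measure_pmf.emeasure_le_1)
      also have "\<dots> \<le> 1 + ennreal (real (card V) * e)" by simp
      finally show ?thesis using True by (simp add: indicator_def)
    next
      case False
      have "emeasure (sample_on p (x(v := y)) V) ?B \<le> ennreal (real (card V) * e)"
        unfolding e_def
      proof (rule insert.IH)
        show "\<not> int p dvd f (x0(v := y))" using False q(2) by simp
        show "(x(v := y)) u = (x0(v := y)) u" if "u \<notin> V" for u
          using insert.prems(2)[of u] that by simp
      qed
      then show ?thesis using False by (simp add: indicator_def)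
    qed
  qed
  also have "\<dots> = emeasure (samp p v) {y. int p dvd poly q y} + ennreal (real (card V) * e)"
    by (simp add: nn_integral_add)
  also have "\<dots> \<le> ennreal e + ennreal (real (card V) * e)"
    using prob_samp_root[OF p q(1) y0] by (intro add_right_mono) (simp add: e_def)
  also have "\<dots> = ennreal (real (card (insert v V)) * e)"
    using insert.hyps e by (simp add: ennreal_plus[symmetric] algebra_simps del: ennreal_plus)
  finally show ?case by (simp add: e_def)
qed

section \<open>Shares and attribute sets that do not satisfy the policy\<close>

text \<open>The shares as linear forms in the value at the root and the coefficients. Nothing is
  reduced modulo p, which keeps them polynomial; \<open>lshares_mod_cong\<close> makes up for the
  reductions.\<close>

fun lshares :: "policy \<Rightarrow> fn \<Rightarrow> (attribute \<times> fn) list" where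
  "lshares (Leaf i a) v = [(a, v)]"
| "lshares (Gate i k ts) v = concat (map (\<lambda>t. lshares t
     (\<lambda>x. v x + (\<Sum>j=1..<k. x (VCoef i j) * int (index t) ^ j))) ts)"

fun coefs :: "policy \<Rightarrow> var set" where
  "coefs (Leaf i a) = {}"
| "coefs (Gate i k ts) = VCoef i ` {1..<k} \<union> (\<Union>t\<in>set ts. coefs t)"

lemma map_fst_lshares: "map fst (lshares P v) = leaves P"
  by (induction P v rule: lshares.induct) (simp_all add: map_concat o_def cong: map_cong)

text \<open>A share is the initial value plus one correction for each gate on the path to its
  leaf.\<close>

lemma lshares_induct:
  assumes "(a, l) \<in> set (lshares P v)" "Q v"
    and "\<And>w i k n. Q w \<Longrightarrow> VCoef i ` {1..<k} \<subseteq> coefs P \<Longrightarrow>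
           Q (\<lambda>x. w x + (\<Sum>j=1..<k. x (VCoef i j) * int n ^ j))"
  shows "Q l"
  using assms
proof (induction P v rule: lshares.induct)
  case (2 i k ts v)
  then obtain t where t: "t \<in> set ts"
    "(a, l) \<in> set (lshares t (\<lambda>x. v x + (\<Sum>j=1..<k. x (VCoef i j) * int (index t) ^ j)))"
    by auto
  show ?case
  proof (rule 2(1)[OF t])
    show "Q (\<lambda>x. v x + (\<Sum>j=1..<k. x (VCoef i j) * int (index t) ^ j))"
      by (rule 2(4)[OF 2(3)]) auto
    show "Q (\<lambda>x. w x + (\<Sum>j=1..<k'. x (VCoef i' j) * int n ^ j))"
      if "Q w" "VCoef i' ` {1..<k'} \<subseteq> coefs t" for w i' k' n
      by (rule 2(4)[OF that(1)]) (use that(2) t(1) in auto)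
  qed
qed auto

lemma index_in_indices: "index t \<in> set (indices t)"
  by (cases t) auto

text \<open>The polynomial is w times the product of the factors 1 - X/n for n in J; the inverses of
  n modulo p exist because 0 < n < p.\<close>

lemma vanishing_polynomial:
  fixes J :: "nat set"
  assumes p: "prime p" and J: "finite J" "J \<subseteq> {1..<p}"
  shows "\<exists>q :: int poly. poly q 0 = w \<and> degree q \<le> card J \<and> (\<forall>n\<in>J. int p dvd poly q (int n))"
  using J
proof (induction J rule: finite_induct)
  case empty
  show ?case by (intro exI[of _ "[:w:]"]) auto
next
  case (insert n J)
  then obtain q :: "int poly" where q: "poly q 0 = w" "degree q \<le> card J"
    "\<forall>n\<in>J. int p dvd poly q (int n)" by auto
  have "\<not> p dvd n" using insert.prems by (auto dest: dvd_imp_le)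
  then have "coprime p n" using p by (rule prime_imp_coprime[rotated])
  then have "coprime (int n) (int p)" by (simp add: coprime_commute)
  then obtain u where u: "[int n * u = 1] (mod int p)" by (metis cong_solve_coprime_int)
  then have "int p dvd 1 - int n * u" by (metis cong_iff_dvd_diff cong_sym)
  moreover have "degree (q * [:1, -u:]) \<le> Suc (card J)"
  proof -
    have "degree (q * [:1, -u:]) \<le> degree q + degree [:1, -u:]" by (rule degree_mult_le)
    also have "\<dots> \<le> card J + 1" using q(2) by (intro add_mono) auto
    finally show ?thesis by simp
  qed
  moreover have "poly (q * [:1, -u:]) z = poly q z * (1 - z * u)" for z
    by (simp add: algebra_simps)
  ultimately show ?case
    using insert.hyps q
    by (intro exI[of _ "q * [:1, -u:]"]) (auto simp del: mult_pCons_right)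
qed

text \<open>
  With the coefficients \<open>\<kappa>\<close> and \<open>q\<^sub>P(0) = w\<close>, the shares of all leaves with an attribute
  in \<open>\<gamma>\<close> vanish.
\<close>

definition kills :: "nat \<Rightarrow> attribute set \<Rightarrow> policy \<Rightarrow> int \<Rightarrow> (nat \<Rightarrow> nat \<Rightarrow> int) \<Rightarrow> bool" where
  "kills p \<gamma> P w \<kappa> \<longleftrightarrow> (\<forall>x v. (\<forall>i\<in>set (indices P). \<forall>j. x (VCoef i j) = \<kappa> i j) \<longrightarrow>
     [v x = w] (mod int p) \<longrightarrow> (\<forall>a l. (a, l) \<in> set (lshares P v) \<longrightarrow> a \<in> \<gamma> \<longrightarrow> int p dvd l x))"

lemma killsD:
  assumes "kills p \<gamma> P w \<kappa>" "\<forall>i\<in>set (indices P). \<forall>j. x (VCoef i j) = \<kappa> i j"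
    "[v x = w] (mod int p)" "(a, l) \<in> set (lshares P v)" "a \<in> \<gamma>"
  shows "int p dvd l x"
  using assms(1)[unfolded kills_def, rule_format, OF assms(2)[rule_format] assms(3-5)] .

lemma kills_cong:
  "(\<And>i j. i \<in> set (indices P) \<Longrightarrow> \<kappa> i j = \<kappa>' i j) \<Longrightarrow> kills p \<gamma> P w \<kappa> \<Longrightarrow> kills p \<gamma> P w \<kappa>'"
  unfolding kills_def by force

text \<open>Sibling subtrees have disjoint sets of indices, so coefficients chosen for each of them
  separately can be merged.\<close>

lemma kills_forest:
  assumes "\<And>t. t \<in> set ts \<Longrightarrow> \<exists>\<kappa>. kills p \<gamma> t (w t) \<kappa>" "distinct (concat (map indices ts))"
  shows "\<exists>\<kappa>. \<forall>t\<in>set ts. kills p \<gamma> t (w t) \<kappa>"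
  using assms
proof (induction ts)
  case (Cons t ts)
  from Cons.prems(1)[of t] obtain \<kappa>1 where k1: "kills p \<gamma> t (w t) \<kappa>1" by auto
  have "\<exists>\<kappa>. \<forall>t\<in>set ts. kills p \<gamma> t (w t) \<kappa>"
    by (rule Cons.IH) (use Cons.prems in auto)
  then obtain \<kappa>2 where k2: "\<forall>t\<in>set ts. kills p \<gamma> t (w t) \<kappa>2" by blast
  note k = k1 k2
  define \<kappa> where "\<kappa> = (\<lambda>i. if i \<in> set (indices t) then \<kappa>1 i else \<kappa>2 i)"
  have "kills p \<gamma> t (w t) \<kappa>" by (rule kills_cong[OF _ k(1)]) (simp add: \<kappa>_def)
  moreover have "kills p \<gamma> t' (w t') \<kappa>" if "t' \<in> set ts" for t'
    by (rule kills_cong[OF _ k(2)[rule_format, OF that]])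
       (use Cons.prems(2) that in \<open>auto simp: \<kappa>_def\<close>)
  ultimately show ?case by auto
qed auto

text \<open>The disjunction is the induction invariant: a subtree satisfied by \<gamma> must receive
  0, any other may receive anything. An unsatisfied gate has at most k - 1 satisfied children, so a
  polynomial of degree at most k - 1 can vanish at all their indices and still take the value w at
  0. A satisfied gate passes on 0 by the zero polynomial.\<close>

lemma exists_kills:
  assumes p: "prime p"
  shows "distinct (indices P) \<Longrightarrow> set (indices P) \<subseteq> {1..<p} \<Longrightarrow> thresholds_ok P \<Longrightarrow>
    \<not> satisfies \<gamma> P \<or> int p dvd w \<Longrightarrow> \<exists>\<kappa>. kills p \<gamma> P w \<kappa>"
proof (induction P arbitrary: w rule: indices.induct)
  case (1 i a)
  have "kills p \<gamma> (Leaf i a) w (\<lambda>_ _. 0)"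
    using 1 by (auto simp: kills_def cong_dvd_iff)
  then show ?case by blast
next
  case (2 i k ts)
  define J where "J = index ` {t \<in> set ts. satisfies \<gamma> t}"
  have k: "1 \<le> k" using 2 by simp
  have J: "finite J" "J \<subseteq> {1..<p}"
    using 2(3) index_in_indices by (fastforce simp: J_def)+
  have Jk: "card J \<le> k - 1" if "\<not> satisfies \<gamma> (Gate i k ts)"
  proof -
    have "card J \<le> card (set (filter (satisfies \<gamma>) ts))" by (simp add: J_def card_image_le)
    also have "\<dots> \<le> length (filter (satisfies \<gamma>) ts)" by (rule card_length)
    finally show ?thesis using that by simp
  qed
  have "\<exists>q :: int poly. [poly q 0 = w] (mod int p) \<and> degree q \<le> k - 1 \<and>
      (\<forall>t\<in>set ts. \<not> satisfies \<gamma> t \<or> int p dvd poly q (int (index t)))"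
  proof (cases "satisfies \<gamma> (Gate i k ts)")
    case True
    then have "[0 = w] (mod int p)" using 2(5) by (metis cong_0_iff cong_sym)
    then show ?thesis by (intro exI[of _ 0]) auto
  next
    case False
    obtain q :: "int poly" where q: "poly q 0 = w" "degree q \<le> card J"
      "\<And>n. n \<in> J \<Longrightarrow> int p dvd poly q (int n)"
      using vanishing_polynomial[OF p J, of w] by blast
    have "int p dvd poly q (int (index t))" if "t \<in> set ts" "satisfies \<gamma> t" for t
      using q(3) that by (auto simp: J_def)
    then show ?thesis
      using q(1,2) Jk[OF False] by (intro exI[of _ q]) auto
  qed
  then obtain q :: "int poly" where q: "[poly q 0 = w] (mod int p)" "degree q \<le> k - 1"
    "\<And>t. t \<in> set ts \<Longrightarrow> \<not> satisfies \<gamma> t \<or> int p dvd poly q (int (index t))" by blast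
  have "\<exists>\<kappa>. \<forall>t\<in>set ts. kills p \<gamma> t (poly q (int (index t))) \<kappa>"
  proof (rule kills_forest)
    fix t assume t: "t \<in> set ts"
    show "\<exists>\<kappa>. kills p \<gamma> t (poly q (int (index t))) \<kappa>"
    proof (rule 2(1)[OF t _ _ _ q(3)[OF t]])
      show "distinct (indices t)" using 2(2) t by (auto simp: distinct_concat_iff)
      show "set (indices t) \<subseteq> {1..<p}" using 2(3) t by auto
      show "thresholds_ok t" using 2(4) t by auto
    qed
  qed (use 2(2) in auto)
  then obtain \<kappa> where \<kappa>: "\<And>t. t \<in> set ts \<Longrightarrow> kills p \<gamma> t (poly q (int (index t))) \<kappa>" by blast
  define \<kappa>' where "\<kappa>' = \<kappa>(i := coeff q)"
  have "kills p \<gamma> (Gate i k ts) w \<kappa>'"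
    unfolding kills_def
  proof (intro allI impI)
    fix x v a l
    assume x: "\<forall>i\<in>set (indices (Gate i k ts)). \<forall>j. x (VCoef i j) = \<kappa>' i j"
      and v: "[v x = w] (mod int p)" and l: "(a, l) \<in> set (lshares (Gate i k ts) v)" and a: "a \<in> \<gamma>"
    from l obtain t where t: "t \<in> set ts"
      "(a, l) \<in> set (lshares t (\<lambda>x. v x + (\<Sum>j=1..<k. x (VCoef i j) * int (index t) ^ j)))"
      by auto
    have "kills p \<gamma> t (poly q (int (index t))) \<kappa>'"
      by (rule kills_cong[OF _ \<kappa>[OF t(1)]]) (use 2(2) t(1) in \<open>auto simp: \<kappa>'_def\<close>)
    moreover have "\<forall>i\<in>set (indices t). \<forall>j. x (VCoef i j) = \<kappa>' i j"
      using x t(1) by auto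
    moreover have "[v x + (\<Sum>j=1..<k. x (VCoef i j) * int (index t) ^ j) = poly q (int (index t))] (mod int p)"
    proof -
      have "poly q (int (index t)) = (\<Sum>j<k. coeff q j * int (index t) ^ j)"
        unfolding poly_altdef using q(2) k
        by (intro sum.mono_neutral_left) (auto simp: coeff_eq_0)
      also have "\<dots> = coeff q 0 + (\<Sum>j=1..<k. coeff q j * int (index t) ^ j)"
        using k by (simp add: lessThan_atLeast0 sum.atLeast_Suc_lessThan)
      also have "coeff q 0 = poly q 0" by (simp add: poly_0_coeff_0)
      finally have "poly q (int (index t)) = poly q 0 + (\<Sum>j=1..<k. x (VCoef i j) * int (index t) ^ j)"
        using x by (simp add: \<kappa>'_def)
      then show ?thesis by (simp only: cong_add[OF cong_trans[OF v cong_sym[OF q(1)]] cong_refl])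
    qed
    ultimately show "int p dvd l x"
      using t(2) a by (rule killsD)
  qed
  then show ?case by blast
qed

section \<open>The elements known to the adversary\<close>

text \<open>
  A string with the entry \<open>(c, f)\<close> in \<open>known\<close> (\<open>True\<close> marks \<open>G\<^sub>1\<close>) encodes
  \<open>c (m\<^sub>b + \<beta> a s) + f\<close>, where \<open>m\<^sub>b\<close> is given by \<open>msg\<close>; version \<open>i\<close> of \<open>\<beta>\<close> is \<open>cs i * \<beta>\<close>.
  Since the ratios of the \<open>\<beta>\<close>s are revealed, the numbers \<open>cs i\<close> are public. A key of which only the
  field \<open>D\<close> has been revealed is recorded in \<open>kattrs\<close> as a key without attributes.
\<close>

record sym =
  vars :: "var set"
  known :: "bool \<times> enc \<Rightarrow> (int \<times> fn) option"
  msg :: "bool \<Rightarrow> fn"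
  nkeys :: nat
  kattrs :: "nat \<Rightarrow> attribute set"
  pol :: "policy option"
  ver :: nat
  cs :: "nat \<Rightarrow> int"
  queried :: "attribute set set"

text \<open>
  The flags are the degrees of a handle in the variables of the keys, in those of the ciphertext,
  and in \<open>\<beta>\<close> and the hash values.
\<close>

inductive handle :: "sym \<Rightarrow> bool \<Rightarrow> bool \<Rightarrow> bool \<Rightarrow> fn \<Rightarrow> bool" for S where
  h_one: "handle S False False False (\<lambda>x. 1)"
| h_beta: "VBeta \<in> vars S \<Longrightarrow> handle S False False True (\<lambda>x. x VBeta)"
| h_hash: "VHash a \<in> vars S \<Longrightarrow> handle S False False True (\<lambda>x. x (VHash a))"
| h_D: "k < nkeys S \<Longrightarrow> VA \<in> vars S \<Longrightarrow> VR k \<in> vars S \<Longrightarrow> handle S True False False (\<lambda>x. x VA + x (VR k))"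
| h_Dj: "k < nkeys S \<Longrightarrow> j \<in> kattrs S k \<Longrightarrow> {VBeta, VR k, VHash j, VRJ k j} \<subseteq> vars S \<Longrightarrow>
    handle S True False True (\<lambda>x. x VBeta * x (VR k) + x (VHash j) * x (VRJ k j))"
| h_Dj': "k < nkeys S \<Longrightarrow> j \<in> kattrs S k \<Longrightarrow> VRJ k j \<in> vars S \<Longrightarrow>
    handle S True False False (\<lambda>x. x (VRJ k j))"
| h_C: "pol S = Some P \<Longrightarrow> {VBeta, VS} \<subseteq> vars S \<Longrightarrow> handle S False True True (\<lambda>x. x VBeta * x VS)"
| h_Cy: "pol S = Some P \<Longrightarrow> insert VS (coefs P) \<subseteq> vars S \<Longrightarrow>
    (a, l) \<in> set (lshares P (\<lambda>x. x VS)) \<Longrightarrow> handle S False True False l"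
| h_Cy': "pol S = Some P \<Longrightarrow> insert (VHash a) (insert VS (coefs P)) \<subseteq> vars S \<Longrightarrow>
    (a, l) \<in> set (lshares P (\<lambda>x. x VS)) \<Longrightarrow> handle S False True True (\<lambda>x. x (VHash a) * l x)"

inductive span0 :: "sym \<Rightarrow> fn \<Rightarrow> bool" for S where
  span0_handle: "handle S e1 e2 e3 f \<Longrightarrow> span0 S f"
| span0_add: "span0 S f \<Longrightarrow> span0 S g \<Longrightarrow> span0 S (\<lambda>x. f x + g x)"
| span0_scale: "span0 S f \<Longrightarrow> span0 S (\<lambda>x. c * f x)"

text \<open>The generator \<beta> a is the exponent of the component l of the encryption key, which
  is handed out directly and not obtained by pairing.\<close>

inductive span1 :: "sym \<Rightarrow> fn \<Rightarrow> bool" for S where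
  span1_prod: "handle S e1 e2 e3 f \<Longrightarrow> handle S d1 d2 d3 g \<Longrightarrow> span1 S (\<lambda>x. f x * g x)"
| span1_l: "{VBeta, VA} \<subseteq> vars S \<Longrightarrow> span1 S (\<lambda>x. x VBeta * x VA)"
| span1_add: "span1 S f \<Longrightarrow> span1 S g \<Longrightarrow> span1 S (\<lambda>x. f x + g x)"
| span1_scale: "span1 S f \<Longrightarrow> span1 S (\<lambda>x. c * f x)"

section \<open>Closure, degree and support of the spans\<close>

lemma span0_span1: "span0 S f \<Longrightarrow> span1 S f"
proof (induction rule: span0.induct)
  case (span0_handle e1 e2 e3 f)
  from span1_prod[OF h_one this] show ?case by simp
qed (auto intro: span1.intros)

lemma span0_mult:
  assumes "span0 S f" "span0 S g"
  shows "span1 S (\<lambda>x. f x * g x)"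
  using assms(1)
proof (induction rule: span0.induct)
  case (span0_handle e1 e2 e3 f)
  from assms(2) show ?case
  proof (induction rule: span0.induct)
    case (span0_handle d1 d2 d3 g)
    then show ?case using \<open>handle S e1 e2 e3 f\<close> by (rule span1_prod[rotated])
  next
    case (span0_add g h)
    from span1_add[OF span0_add.IH] show ?case by (simp add: algebra_simps)
  next
    case (span0_scale g c)
    from span1_scale[OF span0_scale.IH, of c] show ?case by (simp add: algebra_simps)
  qed
next
  case (span0_add g h)
  from span1_add[OF span0_add.IH] show ?case by (simp add: algebra_simps)
next
  case (span0_scale g c)
  from span1_scale[OF span0_scale.IH, of c] show ?case by (simp add: algebra_simps)
qed

lemma span1_zero: "span1 S (\<lambda>x. 0)"
  using span1_scale[OF span0_span1[OF span0_handle[OF h_one]], where c = 0] by simp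

lemma span1_diff: "span1 S f \<Longrightarrow> span1 S g \<Longrightarrow> span1 S (\<lambda>x. f x - g x)"
  using span1_add[of S f "\<lambda>x. (-1) * g x"] span1_scale[of S g "-1"] by simp

lemma pdeg_mult2: "pdeg 1 f \<Longrightarrow> pdeg 1 g \<Longrightarrow> pdeg 2 (\<lambda>x. f x * g x)"
  using pdeg_mult[of 1 f 1 g] by (simp add: numeral_2_eq_2)

lemma lshares_pdeg:
  assumes "(a, l) \<in> set (lshares P (\<lambda>x. x VS))"
  shows "pdeg 1 l"
proof (rule lshares_induct[where Q = "pdeg 1", OF assms])
  show "pdeg 1 (\<lambda>x. w x + (\<Sum>j = 1..<k. x (VCoef i j) * int n ^ j))" if "pdeg 1 w" for w i k n
  proof (intro pdeg_add that pdeg_sum)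
    show "pdeg 1 (\<lambda>x. x (VCoef i j) * int n ^ j)" for j
      using pdeg_cmult[OF pdeg_var[of 1 "VCoef i j"], of "int n ^ j"] by (simp add: mult.commute)
  qed
qed (simp add: pdeg_var)

lemma handle_pdeg: "handle S e1 e2 e3 f \<Longrightarrow> pdeg 2 f"
proof (induction rule: handle.induct)
  case (h_Cy P a l)
  show ?case by (rule pdeg_mono[OF lshares_pdeg[OF h_Cy(3)]]) simp
next
  case (h_Cy' P a l)
  show ?case by (intro pdeg_mult2 pdeg_var lshares_pdeg[OF h_Cy'(3)]) simp
next
  case (h_Dj k j)
  show ?case by (intro pdeg_mult2 pdeg_add pdeg_var) simp_all
next
  case h_C
  show ?case by (intro pdeg_mult2 pdeg_var) simp_all
next
  case h_D
  show ?case by (intro pdeg_add pdeg_var) simp_all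
qed (simp_all add: pdeg_var)

lemma span1_pdeg: "span1 S f \<Longrightarrow> pdeg 4 f"
proof (induction rule: span1.induct)
  case (span1_prod e1 e2 e3 f d1 d2 d3 g)
  then show ?case using pdeg_mult[OF handle_pdeg handle_pdeg] by fastforce
next
  case span1_l
  show ?case using pdeg_mult[of 1 "\<lambda>x. x VBeta" 3 "\<lambda>x. x VA"] by (simp add: pdeg_var)
qed (auto intro: pdeg_add pdeg_cmult)

lemma dep_sum: "(\<And>i. i \<in> I \<Longrightarrow> dep V (f i)) \<Longrightarrow> dep V (\<lambda>x. \<Sum>i\<in>I. f i x)"
  by (induction I rule: infinite_finite_induct) (auto intro: dep_intros)

lemma lshares_dep:
  assumes "(a, l) \<in> set (lshares P v)" "dep V v" "coefs P \<subseteq> V"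
  shows "dep V l"
proof (rule lshares_induct[where Q = "dep V", OF assms(1,2)])
  show "dep V (\<lambda>x. w x + (\<Sum>j = 1..<k. x (VCoef i j) * int n ^ j))"
    if "dep V w" "VCoef i ` {1..<k} \<subseteq> coefs P" for w i k n
  proof (rule dep_intros(3)[OF that(1) dep_sum])
    show "dep V (\<lambda>x. x (VCoef i j) * int n ^ j)" if "j \<in> {1..<k}" for j
    proof -
      have "VCoef i j \<in> VCoef i ` {1..<k}" using that by (rule imageI)
      then have "VCoef i j \<in> V" using assms(3) \<open>VCoef i ` {1..<k} \<subseteq> coefs P\<close> by blast
      then show ?thesis by (intro dep_intros)
    qed
  qed
qed

lemma handle_dep: "handle S e1 e2 e3 f \<Longrightarrow> dep (vars S) f"
proof (induction rule: handle.induct)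
  case (h_Cy P a l)
  show ?case by (rule lshares_dep[OF h_Cy(3)]) (use h_Cy(2) in \<open>auto intro: dep_intros\<close>)
next
  case (h_Cy' P a l)
  have "dep (vars S) l"
    by (rule lshares_dep[OF h_Cy'(3)]) (use h_Cy'(2) in \<open>auto intro: dep_intros\<close>)
  then show ?case using h_Cy'(2) by (intro dep_intros) auto
qed (auto intro!: dep_intros)

lemma span1_dep: "span1 S f \<Longrightarrow> dep (vars S) f"
  by (induction rule: span1.induct) (auto intro: dep_intros handle_dep)

text \<open>The order in which symbolic states grow. The spans are monotone in it, so
  representations recorded earlier stay valid.\<close>

definition extends :: "sym \<Rightarrow> sym \<Rightarrow> bool" where
  "extends S S' \<longleftrightarrow> vars S \<subseteq> vars S' \<and> nkeys S \<le> nkeys S' \<and>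
     (\<forall>k<nkeys S. kattrs S' k = kattrs S k) \<and> (pol S = None \<or> pol S' = pol S)"

lemma handle_extends: "handle S e1 e2 e3 f \<Longrightarrow> extends S S' \<Longrightarrow> handle S' e1 e2 e3 f"
  by (induction rule: handle.induct) (auto intro!: handle.intros simp: extends_def)

lemma span0_extends: "span0 S f \<Longrightarrow> extends S S' \<Longrightarrow> span0 S' f"
  by (induction rule: span0.induct) (auto intro: span0.intros handle_extends)

lemma span1_extends: "span1 S f \<Longrightarrow> extends S S' \<Longrightarrow> span1 S' f"
proof (induction rule: span1.induct)
  case (span1_prod e1 e2 e3 f d1 d2 d3 g)
  then show ?case by (metis handle_extends span1.span1_prod)
qed (auto intro: span1.intros simp: extends_def)

section \<open>A functional that separates the challenge from everything known\<close>

definition scale :: "int \<Rightarrow> int \<Rightarrow> int \<Rightarrow> (var \<Rightarrow> int) \<Rightarrow> var \<Rightarrow> int" where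
  "scale s1 s2 s3 x v = (case v of
     VBeta \<Rightarrow> s3 * x v | VHash a \<Rightarrow> s3 * x v
   | VA \<Rightarrow> s1 * x v | VR k \<Rightarrow> s1 * x v | VRJ k j \<Rightarrow> s1 * x v
   | VS \<Rightarrow> s2 * x v | VCoef i j \<Rightarrow> s2 * x v)"

text \<open>
  The sum over the signs keeps, up to the factor 8, only the products of degree \<open>(1, 1, 1)\<close>, the degree
  of \<open>\<beta> a s\<close>; so only handles of complementary degrees have to be considered.
\<close>

definition odd_part :: "fn \<Rightarrow> fn" where
  "odd_part f x = (\<Sum>s1\<in>{1,-1}. \<Sum>s2\<in>{1,-1}. \<Sum>s3\<in>{1,-1}. s1 * s2 * s3 * f (scale s1 s2 s3 x))"

definition homog :: "bool \<Rightarrow> bool \<Rightarrow> bool \<Rightarrow> fn \<Rightarrow> bool" where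
  "homog e1 e2 e3 f \<longleftrightarrow> (\<forall>s1 s2 s3 x. f (scale s1 s2 s3 x) =
     (if e1 then s1 else 1) * (if e2 then s2 else 1) * (if e3 then s3 else 1) * f x)"

text \<open>If both factors have the same degree in one of the three groups of indeterminates, the
  product is unchanged by the sign of that group, and the weights cancel. Otherwise all eight
  summands are equal.\<close>

lemma odd_part_mult:
  assumes "homog e1 e2 e3 f" "homog d1 d2 d3 g"
  shows "odd_part (\<lambda>x. f x * g x) x =
    (if (e1 \<noteq> d1) \<and> (e2 \<noteq> d2) \<and> (e3 \<noteq> d3) then 8 * (f x * g x) else 0)"
  using assms
  by (cases e1; cases e2; cases e3; cases d1; cases d2; cases d3)
     (simp_all add: odd_part_def homog_def algebra_simps)

lemma odd_part_add: "odd_part (\<lambda>x. f x + g x) = (\<lambda>x. odd_part f x + odd_part g x)"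
  by (simp add: odd_part_def algebra_simps fun_eq_iff)

lemma odd_part_scale: "odd_part (\<lambda>x. c * f x) = (\<lambda>x. c * odd_part f x)"
  by (simp add: odd_part_def algebra_simps fun_eq_iff)

lemma lshares_homog:
  assumes "(a, l) \<in> set (lshares P (\<lambda>x. x VS))"
  shows "homog False True False l"
proof (rule lshares_induct[where Q = "homog False True False", OF assms])
  show "homog False True False (\<lambda>x. w x + (\<Sum>j = 1..<k. x (VCoef i j) * int n ^ j))"
    if "homog False True False w" for w i k n
    using that by (simp add: homog_def scale_def sum_distrib_left algebra_simps)
qed (simp add: homog_def scale_def)

lemma handle_homog: "handle S e1 e2 e3 f \<Longrightarrow> homog e1 e2 e3 f"
proof (induction rule: handle.induct)
  case (h_Cy P a l)
  show ?case by (rule lshares_homog[OF h_Cy(3)])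
next
  case (h_Cy' P a l)
  then show ?case using lshares_homog[OF h_Cy'(3)] by (simp add: homog_def scale_def)
qed (simp_all add: homog_def scale_def algebra_simps)

text \<open>
  Evaluation at the first point isolates \<open>\<beta> a s\<close>, but does not vanish on the product
  \<open>\<beta> s (a + r'\<^sub>k)\<close>; subtracting the value at the second point corrects this, since there \<open>s = 1\<close>.
  Then \<open>(\<beta> r'\<^sub>k + t\<^sub>j r\<^sub>k\<^sub>j) q\<^sub>y(0)\<close> has to be balanced by the third kind of points, where
  \<open>t\<^sub>j r\<^sub>k\<^sub>j q\<^sub>y(0)\<close> is harmless for \<open>att(y) = j\<close> because the shares of these leaves are 0.
\<close>

definition point_target :: "var \<Rightarrow> int" where
  "point_target v = (case v of VBeta \<Rightarrow> 1 | VA \<Rightarrow> 1 | VS \<Rightarrow> 1 | _ \<Rightarrow> 0)"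

definition point_key :: "(nat \<Rightarrow> nat \<Rightarrow> nat \<Rightarrow> int) \<Rightarrow> nat \<Rightarrow> var \<Rightarrow> int" where
  "point_key \<kappa> k v = (case v of VBeta \<Rightarrow> 1 | VS \<Rightarrow> 1 | VR k' \<Rightarrow> of_bool (k' = k) | VCoef i j \<Rightarrow> \<kappa> k i j | _ \<Rightarrow> 0)"

definition point_attr :: "(nat \<Rightarrow> nat \<Rightarrow> nat \<Rightarrow> int) \<Rightarrow> nat \<Rightarrow> bool list \<Rightarrow> var \<Rightarrow> int" where
  "point_attr \<kappa> k j v = (case v of VS \<Rightarrow> 1 | VHash a \<Rightarrow> of_bool (a = j)
     | VRJ k' j' \<Rightarrow> of_bool (k' = k \<and> j' = j) | VCoef i l \<Rightarrow> \<kappa> k i l | _ \<Rightarrow> 0)"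

definition functional :: "sym \<Rightarrow> (nat \<Rightarrow> nat \<Rightarrow> nat \<Rightarrow> int) \<Rightarrow> fn \<Rightarrow> int" where
  "functional S \<kappa> f = f point_target - (\<Sum>k<nkeys S. f (point_key \<kappa> k))
     + (\<Sum>k<nkeys S. \<Sum>j\<in>kattrs S k. f (point_attr \<kappa> k j))"

lemma functional_add: "functional S \<kappa> (\<lambda>x. f x + g x) = functional S \<kappa> f + functional S \<kappa> g"
  by (simp add: functional_def sum.distrib)

lemma functional_scale: "functional S \<kappa> (\<lambda>x. c * f x) = c * functional S \<kappa> f"
  by (simp add: functional_def sum_distrib_left algebra_simps)

lemma functional_cong_0: "(\<And>x. int p dvd f x) \<Longrightarrow> int p dvd functional S \<kappa> f"
  unfolding functional_def by (intro dvd_add dvd_diff dvd_sum) auto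

context
  fixes p :: nat and S :: sym and P :: policy and \<kappa> :: "nat \<Rightarrow> nat \<Rightarrow> nat \<Rightarrow> int"
  assumes P: "pol S = Some P"
    and kills: "\<And>k. k < nkeys S \<Longrightarrow> kills p (kattrs S k) P 1 (\<kappa> k)"
    and fin: "\<And>k. k < nkeys S \<Longrightarrow> finite (kattrs S k)"
begin

lemma share_points:
  assumes "(a, l) \<in> set (lshares P (\<lambda>x. x VS))" "k < nkeys S"
  shows "l (point_attr \<kappa> k j) = l (point_key \<kappa> k)"
    and "a \<in> kattrs S k \<Longrightarrow> int p dvd l (point_key \<kappa> k)"
proof -
  have "dep (insert VS (coefs P)) l"
    by (rule lshares_dep[OF assms(1)]) (auto intro: dep_intros)
  then have "dep (insert VS (range (\<lambda>(i, j). VCoef i j))) l"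
  proof (rule dep_mono)
    have "coefs P \<subseteq> range (\<lambda>(i, j). VCoef i j)" by (induction P rule: coefs.induct) auto
    then show "insert VS (coefs P) \<subseteq> insert VS (range (\<lambda>(i, j). VCoef i j))" by blast
  qed
  then show "l (point_attr \<kappa> k j) = l (point_key \<kappa> k)"
    by (rule depD) (auto simp: point_attr_def point_key_def)
  show "int p dvd l (point_key \<kappa> k)" if "a \<in> kattrs S k"
    by (rule killsD[OF kills[OF assms(2)] _ _ assms(1) that]) (auto simp: point_key_def)
qed

text \<open>\<open>D\<close> times \<open>C\<close> balances between the target point and the point
  of its key, \<open>D_j\<close> times \<open>C_y\<close> between the point of the key and that of
  the attribute j. \<open>D'_j\<close> times \<open>C'_y\<close> survives only at the point of
  attribute j and only for att(y) = j, where the share is 0 modulo p. The remaining products,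
  \<open>D\<close> times \<open>C'_y\<close> and \<open>D'_j\<close> times \<open>C\<close>, vanish
  at every point.\<close>

lemma functional_complementary:
  assumes "handle S True e2 e3 f" "handle S False (\<not> e2) (\<not> e3) g"
  shows "int p dvd functional S \<kappa> (\<lambda>x. f x * g x)"
  using assms(1)
proof cases
  case (h_D k)
  from assms(2) h_D(1,2) show ?thesis
  proof cases
    case h_C
    with h_D show ?thesis
      by (simp add: functional_def point_target_def point_key_def point_attr_def of_bool_def)
  next
    case h_Cy'
    with h_D show ?thesis
      by (simp add: functional_def point_target_def point_key_def point_attr_def)
  qed simp_all
next
  case (h_Dj k j)
  \<comment> \<open>The complementary degree leaves only \<open>C_y\<close> as the other
    factor.\<close>
  from assms(2) h_Dj(1,2) obtain a where g: "(a, g) \<in> set (lshares P (\<lambda>x. x VS))"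
    by cases (use P in auto)
  note l = share_points(1)[OF g]
  have "(\<Sum>k'<nkeys S. \<Sum>j'\<in>kattrs S k'. f (point_attr \<kappa> k' j') * g (point_attr \<kappa> k' j'))
      = (\<Sum>k'<nkeys S. \<Sum>j'\<in>kattrs S k'. of_bool (j = j' \<and> k = k') * g (point_key \<kappa> k'))"
    using l by (intro sum.cong refl) (auto simp: h_Dj point_attr_def)
  also have "\<dots> = (\<Sum>k'<nkeys S. of_bool (k = k') * g (point_key \<kappa> k'))"
  proof (intro sum.cong refl)
    fix k' assume k': "k' \<in> {..<nkeys S}"
    show "(\<Sum>j'\<in>kattrs S k'. of_bool (j = j' \<and> k = k') * g (point_key \<kappa> k')) =
        of_bool (k = k') * g (point_key \<kappa> k')"
    proof (cases "k = k'")
      case True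
      have "(\<Sum>j'\<in>kattrs S k. of_bool (j = j') * g (point_key \<kappa> k)) =
          (\<Sum>j'\<in>kattrs S k. if j = j' then g (point_key \<kappa> k) else 0)"
        by (intro sum.cong) auto
      then show ?thesis using h_Dj k' fin[of k'] True by simp
    qed simp
  qed
  finally show ?thesis
    by (simp add: functional_def h_Dj point_target_def point_key_def of_bool_def eq_commute)
next
  case (h_Dj' k j)
  from assms(2) h_Dj'(1,2) show ?thesis
  proof cases
    case h_C
    with h_Dj' show ?thesis
      by (simp add: functional_def point_target_def point_key_def point_attr_def)
  next
    case (h_Cy' P' a l)
    with P have l: "(a, l) \<in> set (lshares P (\<lambda>x. x VS))" by simp
    have "int p dvd (\<Sum>k<nkeys S. \<Sum>j\<in>kattrs S k. f (point_attr \<kappa> k j) * g (point_attr \<kappa> k j))"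
    proof (intro dvd_sum)
      fix k' j' assume kj: "k' \<in> {..<nkeys S}" "j' \<in> kattrs S k'"
      then show "int p dvd f (point_attr \<kappa> k' j') * g (point_attr \<kappa> k' j')"
        using share_points[OF l, of k'] by (auto simp: h_Dj' h_Cy' point_attr_def)
    qed
    then show ?thesis
      by (simp add: functional_def h_Dj' h_Cy' point_target_def point_key_def)
  qed simp_all
qed simp_all

lemma functional_span1:
  assumes "span1 S f"
  shows "int p dvd functional S \<kappa> (odd_part f)"
  using assms
proof (induction rule: span1.induct)
  case (span1_prod e1 e2 e3 f d1 d2 d3 g)
  note odd = odd_part_mult[OF span1_prod[THEN handle_homog]]
  show ?case
  proof (cases "(e1 \<noteq> d1) \<and> (e2 \<noteq> d2) \<and> (e3 \<noteq> d3)")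
    case False
    then have "odd_part (\<lambda>x. f x * g x) = (\<lambda>x. 0)" using odd by (auto simp: fun_eq_iff)
    then show ?thesis by (simp add: functional_cong_0)
  next
    case True
    then have "odd_part (\<lambda>x. f x * g x) = (\<lambda>x. 8 * (f x * g x))" using odd by (auto simp: fun_eq_iff)
    moreover have "int p dvd functional S \<kappa> (\<lambda>x. f x * g x)"
    proof (cases e1)
      case e1: True
      have d: "d2 = (\<not> e2)" "d3 = (\<not> e3)" "\<not> d1" using True e1 by auto
      show ?thesis using functional_complementary[of e2 e3 f g] span1_prod e1 d by simp
    next
      case e1: False
      have d: "e2 = (\<not> d2)" "e3 = (\<not> d3)" "d1" using True e1 by auto
      show ?thesis
        using functional_complementary[of d2 d3 g f] span1_prod e1 d by (simp add: mult.commute)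
    qed
    ultimately show ?thesis by (simp add: functional_scale)
  qed
next
  case span1_l
  \<comment> \<open>The product contains no indeterminate of the ciphertext, so the summation over
    the second sign cancels it.\<close>
  have "odd_part (\<lambda>x. x VBeta * x VA) = (\<lambda>x. 0)" by (simp add: odd_part_def scale_def fun_eq_iff)
  then show ?case by (simp add: functional_cong_0)
next
  case (span1_add f g)
  then show ?case by (simp add: odd_part_add functional_add)
next
  case (span1_scale f c)
  then show ?case by (simp add: odd_part_scale functional_scale)
qed

text \<open>The functional maps the span part to 0 modulo p and the target to 8 c, since a is
  nonzero only at the first point. The factor 8 is invertible because p is odd.\<close>

lemma target_not_in_span1:
  assumes p: "prime p" "odd p" and f: "span1 S f"
    and "\<And>x. int p dvd c * (x VBeta * x VA * x VS) + f x"
  shows "int p dvd c"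
proof -
  define h :: fn where "h = (\<lambda>x. c * (x VBeta * x VA * x VS))"
  have "int p dvd functional S \<kappa> (odd_part (\<lambda>x. h x + f x))"
    unfolding odd_part_def using assms(4)
    by (intro functional_cong_0 dvd_sum dvd_mult) (simp add: h_def)
  then have "int p dvd functional S \<kappa> (odd_part h)"
    using functional_span1[OF f] by (simp add: odd_part_add functional_add dvd_add_left_iff)
  also have "odd_part h = (\<lambda>x. 8 * h x)"
    by (simp add: odd_part_def h_def scale_def fun_eq_iff)
  also have "functional S \<kappa> (\<lambda>x. 8 * h x) = 8 * c"
    by (simp add: functional_def h_def point_target_def point_key_def point_attr_def)
  finally have "int p dvd 2 ^ 3 * c" by simp
  moreover have "\<not> int p dvd 2 ^ 3"
  proof
    assume "int p dvd 2 ^ 3"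
    then have "int p dvd int 2" using p(1) prime_dvd_power[of "int p" 2 3] by simp
    then have "p dvd 2" by (simp only: int_dvd_int_iff)
    then have "p \<le> 2" by (rule dvd_imp_le) simp
    with p prime_ge_2_nat[of p] show False by (cases "p = 2") auto
  qed
  ultimately show ?thesis using p(1) by (simp add: prime_dvd_mult_iff)
qed

end

section \<open>The real game, conditioned on a symbolic state\<close>

definition comb :: "sym \<Rightarrow> bool \<Rightarrow> int \<times> fn \<Rightarrow> fn" where
  "comb S b r x = fst r * (msg S b x + x VBeta * x VA * x VS) + snd r x"

text \<open>The zero coefficient before the challenge is what allows the bit to be drawn afresh when
  the challenge is issued.\<close>

definition rep_ok :: "sym \<Rightarrow> bool \<Rightarrow> int \<times> fn \<Rightarrow> bool" where
  "rep_ok S i r \<longleftrightarrow>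
     (if i then span1 S (snd r) \<and> (pol S = None \<longrightarrow> fst r = 0) else fst r = 0 \<and> span0 S (snd r))"

lemma nn_integral_pmf_commute:
  "(\<integral>\<^sup>+x. \<integral>\<^sup>+y. f x y \<partial>measure_pmf B \<partial>measure_pmf A) =
   (\<integral>\<^sup>+y. \<integral>\<^sup>+x. f x y \<partial>measure_pmf A \<partial>measure_pmf B)"
  using nn_integral_pair_pmf'[of A B "\<lambda>(x, y). f x y"] nn_integral_pair_pmf'[of B A "\<lambda>(y, x). f x y"]
  by (simp add: pair_commute_pmf[of A B] case_prod_unfold)

locale generic_group =
  fixes p m N :: nat
  assumes prime: "prime p" and N_less: "N < p" and p_odd: "odd p" and m_large: "p ^ 3 < 2 ^ m"
begin

lemma p_ge_2: "p \<ge> 2"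
  using prime by (rule prime_ge_2_nat)

abbreviation prior :: "sym \<Rightarrow> (var \<Rightarrow> int) pmf" where
  "prior S \<equiv> sample_on p (\<lambda>_. 0) (vars S)"

definition val :: "sym \<Rightarrow> (var \<Rightarrow> int) \<Rightarrow> bool \<Rightarrow> int \<times> fn \<Rightarrow> int" where
  "val S x b r = comb S b r x mod int p"

text \<open>Both bits are required: elements that share one name must coincide whatever b
  is.\<close>

definition eqv :: "sym \<Rightarrow> int \<times> fn \<Rightarrow> int \<times> fn \<Rightarrow> bool" where
  "eqv S r r' \<longleftrightarrow> (\<forall>x b. val S x b r = val S x b r')"

definition compat :: "sym \<Rightarrow> (var \<Rightarrow> int) \<Rightarrow> bool \<Rightarrow> (bool \<Rightarrow> int \<Rightarrow> enc) set" where
  "compat S x b = {\<psi>. (\<forall>i. \<psi> i \<in> encodings p m) \<and>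
     (\<forall>i e r. known S (i, e) = Some r \<longrightarrow> \<psi> i (val S x b r) = e)}"

definition world :: "sym \<Rightarrow> ((var \<Rightarrow> int) \<times> bool \<times> (bool \<Rightarrow> int \<Rightarrow> enc)) option pmf" where
  "world S = do {
     x \<leftarrow> prior S;
     b \<leftarrow> bernoulli_pmf (1 / 2);
     if compat S x b = {} then return_pmf None
     else map_pmf (\<lambda>\<psi>. Some (x, b, \<psi>)) (pmf_of_set (compat S x b)) }"

text \<open>
  \<open>compat\<close> is empty if two known elements collide. Such exponents contribute 0 to \<open>R\<close>, which is therefore an
  expectation over a subprobability; thus conditioning on the absence of collisions never requires a
  renormalization.
\<close>

definition R :: "sym \<Rightarrow> ((var \<Rightarrow> int) \<Rightarrow> bool \<Rightarrow> (bool \<Rightarrow> int \<Rightarrow> enc) \<Rightarrow> ennreal) \<Rightarrow> ennreal" where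
  "R S F = (\<integral>\<^sup>+w. (case w of None \<Rightarrow> 0 | Some (x, b, \<psi>) \<Rightarrow> F x b \<psi>) \<partial>world S)"

definition inner where
  "inner S F x b = (if compat S x b = {} then 0 else \<integral>\<^sup>+\<psi>. F x b \<psi> \<partial>pmf_of_set (compat S x b) :: ennreal)"

definition unused :: "sym \<Rightarrow> bool \<Rightarrow> enc set" where
  "unused S i = {e. length e = m \<and> known S (i, e) = None}"

definition pol_ok :: "sym \<Rightarrow> bool" where
  "pol_ok S \<longleftrightarrow> (case pol S of
     None \<Rightarrow> VS \<notin> vars S \<and> (\<forall>i j. VCoef i j \<notin> vars S)
   | Some P \<Rightarrow> wf_policy P \<and> length (indices P) < p \<and>
       VS \<in> vars S \<and> coefs P \<subseteq> vars S \<and> VHash ` set (leaves P) \<subseteq> vars S \<and>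
       (\<forall>k<nkeys S. \<not> satisfies (kattrs S k) P))"

definition wf_sym :: "sym \<Rightarrow> bool" where
  "wf_sym S \<longleftrightarrow> finite (vars S) \<and> finite (dom (known S)) \<and> VBeta \<in> vars S \<and> VA \<in> vars S \<and>
     (\<forall>k. VR k \<in> vars S \<longrightarrow> k < nkeys S) \<and> (\<forall>k j. VRJ k j \<in> vars S \<longrightarrow> k < nkeys S) \<and>
     (\<forall>k<nkeys S. VR k \<in> vars S) \<and> (\<forall>k<nkeys S. finite (kattrs S k)) \<and>
     (\<forall>k<nkeys S. \<forall>j\<in>kattrs S k. VHash j \<in> vars S) \<and>
     (\<forall>k<nkeys S. \<forall>j\<in>kattrs S k. VRJ k j \<in> vars S) \<and>
     (\<forall>i e r. known S (i, e) = Some r \<longrightarrow> rep_ok S i r) \<and> (\<forall>b. span1 S (msg S b)) \<and>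
     (\<forall>k<nkeys S. kattrs S k = {} \<or> kattrs S k \<in> queried S) \<and>
     (\<forall>i. \<not> int p dvd cs S i) \<and> pol_ok S"

section \<open>Expectation over the worlds consistent with a symbolic state\<close>

lemma R_eq: "R S F = (\<integral>\<^sup>+x. \<integral>\<^sup>+b. inner S F x b \<partial>bernoulli_pmf (1 / 2) \<partial>prior S)"
  unfolding R_def world_def nn_integral_bind_pmf inner_def
  by (intro nn_integral_cong) (auto)

lemma compatD:
  assumes "\<psi> \<in> compat S x b"
  shows "\<psi> i \<in> encodings p m" "known S (i, e) = Some r \<Longrightarrow> \<psi> i (val S x b r) = e"
  using assms unfolding compat_def by blast+

lemma finite_encodings: "finite (encodings p m)"
proof -
  have "finite {bs :: bool list. length bs = m}"
    using finite_lists_length_eq[of "UNIV :: bool set" m] by simp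
  then have "finite (Zp p \<rightarrow>\<^sub>E {bs :: bool list. length bs = m})"
    by (intro finite_PiE) auto
  then show ?thesis by (rule rev_finite_subset) (auto simp: encodings_def)
qed

lemma finite_compat: "finite (compat S x b)"
proof -
  have "finite (UNIV \<rightarrow>\<^sub>E encodings p m :: (bool \<Rightarrow> int \<Rightarrow> enc) set)"
    by (intro finite_PiE finite_encodings) auto
  then show ?thesis by (rule rev_finite_subset) (auto simp: compat_def PiE_def)
qed

lemma finite_unused: "finite (unused S i)"
proof -
  have "finite {bs :: bool list. length bs = m}"
    using finite_lists_length_eq[of "UNIV :: bool set" m] by simp
  then show ?thesis by (rule rev_finite_subset) (auto simp: unused_def)
qed

text \<open>The bound p (p - 1) is weak but convenient: a union over p values then costs p / (p (p -
  1)) = 1 / (p - 1).\<close>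

lemma card_unused:
  assumes "wf_sym S" "card (dom (known S)) \<le> N"
  shows "p * (p - 1) \<le> card (unused S i)"
proof -
  have fin: "finite {bs :: bool list. length bs = m}"
    using finite_lists_length_eq[of "UNIV :: bool set" m] by simp
  have c: "card {bs :: bool list. length bs = m} = 2 ^ m"
    using card_lists_length_eq[of "UNIV :: bool set" m] by simp
  have fk: "finite (dom (known S))" using assms(1) unfolding wf_sym_def by blast
  have "{bs. length bs = m} - snd ` dom (known S) \<subseteq> unused S i"
    unfolding unused_def by (force simp: image_iff)
  then have "card ({bs. length bs = m} - snd ` dom (known S)) \<le> card (unused S i)"
    by (intro card_mono finite_unused)
  moreover have "2 ^ m - card (snd ` dom (known S)) \<le> card ({bs. length bs = m} - snd ` dom (known S))"
    using diff_card_le_card_Diff[of "snd ` dom (known S)" "{bs. length bs = m}"] fk c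
    by simp
  moreover have "card (snd ` dom (known S)) \<le> N"
    using assms(2) card_image_le[OF fk, of snd] by simp
  moreover have "p * (p - 1) + p \<le> p ^ 3"
  proof -
    have "p * (p - 1) + p = p * p * 1" using p_ge_2 by (simp add: algebra_simps)
    also have "\<dots> \<le> p * p * p" using p_ge_2 by (intro mult_left_mono) auto
    finally show ?thesis by (simp add: power3_eq_cube)
  qed
  ultimately show ?thesis using m_large N_less by linarith
qed

lemma unused_nonempty:
  assumes "wf_sym S" "card (dom (known S)) \<le> N"
  shows "unused S i \<noteq> {}"
  using card_unused[OF assms, of i] p_ge_2 by fastforce

lemma R_mono:
  assumes "\<And>x b \<psi>. x \<in> set_pmf (prior S) \<Longrightarrow> \<psi> \<in> compat S x b \<Longrightarrow> F x b \<psi> \<le> G x b \<psi>"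
  shows "R S F \<le> R S G"
  unfolding R_eq
proof (intro nn_integral_mono_AE AE_pmfI)
  fix x b assume "x \<in> set_pmf (prior S)"
  then show "inner S F x b \<le> inner S G x b"
    unfolding inner_def using assms set_pmf_of_set[OF _ finite_compat, of S x b]
    by (cases "compat S x b = {}") (auto intro!: nn_integral_mono_AE AE_pmfI)
qed

lemma R_cong:
  assumes "\<And>x b \<psi>. x \<in> set_pmf (prior S) \<Longrightarrow> \<psi> \<in> compat S x b \<Longrightarrow> F x b \<psi> = G x b \<psi>"
  shows "R S F = R S G"
  using assms by (intro antisym R_mono) auto

lemma R_const_le: "R S (\<lambda>_ _ _. c) \<le> c"
proof -
  have "R S (\<lambda>_ _ _. c) \<le> (\<integral>\<^sup>+w. c \<partial>world S)"
    unfolding R_def by (intro nn_integral_mono) (auto split: option.splits)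
  then show ?thesis by simp
qed

lemma R_add: "R S (\<lambda>x b \<psi>. F x b \<psi> + G x b \<psi>) = R S F + R S G"
  unfolding R_def
  by (subst nn_integral_add[symmetric]) (auto intro!: nn_integral_cong split: option.splits)

lemma R_integral: "R S (\<lambda>x b \<psi>. \<integral>\<^sup>+y. F y x b \<psi> \<partial>measure_pmf M) = (\<integral>\<^sup>+y. R S (F y) \<partial>measure_pmf M)"
  unfolding R_def
  by (subst nn_integral_pmf_commute[symmetric]) (auto intro!: nn_integral_cong split: option.splits)

text \<open>
  Exchanging two unused strings is a symmetry of the compatible encodings, so the encoding of a new
  element is uniform among the unused strings.
\<close>

lemma compat_split:
  assumes "wf_sym S" "card (dom (known S)) \<le> N" "z \<in> Zp p"
    and new: "\<And>e r. known S (i, e) = Some r \<Longrightarrow> val S x b r \<noteq> z"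
    and ne: "compat S x b \<noteq> {}"
  shows "pmf_of_set (compat S x b) =
      do { e \<leftarrow> pmf_of_set (unused S i); pmf_of_set {\<psi> \<in> compat S x b. \<psi> i z = e} }"
    and "\<And>e. e \<in> unused S i \<Longrightarrow> {\<psi> \<in> compat S x b. \<psi> i z = e} \<noteq> {}"
proof -
  let ?C = "\<lambda>e. {\<psi> \<in> compat S x b. \<psi> i z = e}"
  have fin: "finite (?C e)" for e using finite_compat by simp
  have val: "val S x b r \<in> Zp p" for r using p_ge_2 by (simp add: val_def)
  have union: "compat S x b = (\<Union>e\<in>unused S i. ?C e)"
  proof (intro equalityI subsetI)
    fix \<psi> assume \<psi>: "\<psi> \<in> compat S x b"
    then have enc: "\<psi> i \<in> encodings p m" by (simp add: compat_def)
    have "known S (i, \<psi> i z) = None"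
    proof (rule ccontr)
      assume "known S (i, \<psi> i z) \<noteq> None"
      then obtain r where r: "known S (i, \<psi> i z) = Some r" by auto
      with \<psi> have "\<psi> i (val S x b r) = \<psi> i z" using compatD(2) by blast
      with enc val[of r] assms(3) have "val S x b r = z"
        by (auto simp: encodings_def inj_on_def)
      with new[OF r] show False by simp
    qed
    moreover have "length (\<psi> i z) = m" using enc assms(3) by (auto simp: encodings_def)
    ultimately show "\<psi> \<in> (\<Union>e\<in>unused S i. ?C e)" using \<psi> by (auto simp: unused_def)
  qed auto
  have le: "card (?C e) \<le> card (?C e')" if e: "e \<in> unused S i" and e': "e' \<in> unused S i" for e e'
  proof (rule card_inj_on_le)
    let ?t = "Transposition.transpose e e'"
    let ?g = "\<lambda>\<psi>. \<psi>(i := restrict (?t \<circ> \<psi> i) (Zp p))"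
    show "inj_on ?g (?C e)"
    proof (rule inj_onI)
      fix \<psi> \<psi>' assume a: "\<psi> \<in> ?C e" "\<psi>' \<in> ?C e" "?g \<psi> = ?g \<psi>'"
      have "\<psi> i = \<psi>' i"
      proof (rule PiE_ext)
        show "\<psi> i \<in> Zp p \<rightarrow>\<^sub>E {bs. length bs = m}" "\<psi>' i \<in> Zp p \<rightarrow>\<^sub>E {bs. length bs = m}"
          using a by (auto simp: compat_def encodings_def)
        fix y assume "y \<in> Zp p"
        then have "?t (\<psi> i y) = ?t (\<psi>' i y)"
          using fun_cong[OF fun_cong[OF a(3), of i], of y] by simp
        then show "\<psi> i y = \<psi>' i y" by (metis transpose_involutory)
      qed
      moreover have "\<psi> j = \<psi>' j" if "j \<noteq> i" for j
        using fun_cong[OF a(3), of j] that by simp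
      ultimately have "\<psi> j = \<psi>' j" for j by (cases "j = i") simp_all
      then show "\<psi> = \<psi>'" by (rule HOL.ext)
    qed
    show "?g ` ?C e \<subseteq> ?C e'"
    proof (intro image_subsetI CollectI conjI)
      fix \<psi> assume \<psi>: "\<psi> \<in> ?C e"
      have len: "length e = m" "length e' = m" using e e' by (auto simp: unused_def)
      show "?g \<psi> i z = e'" using \<psi> assms(3) by simp
      show "?g \<psi> \<in> compat S x b"
        unfolding compat_def
      proof (intro CollectI conjI allI impI)
        fix j
        show "?g \<psi> j \<in> encodings p m"
        proof (cases "j = i")
          case True
          have \<psi>i: "\<psi> i \<in> encodings p m" using \<psi> by (auto simp: compat_def)
          have "restrict (?t \<circ> \<psi> i) (Zp p) \<in> Zp p \<rightarrow>\<^sub>E {bs. length bs = m}"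
            using \<psi>i len by (auto simp: encodings_def Transposition.transpose_def)
          moreover have "inj_on (restrict (?t \<circ> \<psi> i) (Zp p)) (Zp p)"
            using \<psi>i unfolding inj_on_restrict_eq encodings_def
            by (intro comp_inj_on) auto
          ultimately show ?thesis using True by (simp add: encodings_def)
        next
          case False
          then show ?thesis using \<psi> by (auto simp: compat_def)
        qed
      next
        fix j e1 r assume k: "known S (j, e1) = Some r"
        then have "\<psi> j (val S x b r) = e1" using \<psi> compatD(2) by blast
        moreover have "e1 \<noteq> e" "e1 \<noteq> e'" if "j = i" using k e e' that by (auto simp: unused_def)
        ultimately show "?g \<psi> j (val S x b r) = e1" using val[of r] by auto
      qed
    qed
  qed (rule fin)
  have eq: "card (?C e) = card (?C e')" if "e \<in> unused S i" "e' \<in> unused S i" for e e'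
    using le that by (intro antisym) auto
  from ne union obtain e0 where e0: "e0 \<in> unused S i" "?C e0 \<noteq> {}" by blast
  show ne': "?C e \<noteq> {}" if "e \<in> unused S i" for e
  proof -
    have "card (?C e0) \<noteq> 0" using e0(2) fin[of e0] by (simp only: card_eq_0_iff) simp
    then have "card (?C e) \<noteq> 0" using eq[OF that e0(1)] by simp
    then show ?thesis by (metis card.empty)
  qed
  have "pmf_of_set (\<Union>e\<in>unused S i. ?C e) = do { e \<leftarrow> pmf_of_set (unused S i); pmf_of_set (?C e) }"
  proof (rule pmf_of_set_UN)
    show "finite (\<Union>e\<in>unused S i. ?C e)" using finite_compat union by metis
    show "unused S i \<noteq> {}" by (rule unused_nonempty[OF assms(1,2)])
    show "card (?C e) = card (?C e0)" if "e \<in> unused S i" for e using eq[OF that e0(1)] .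
    show "disjoint_family_on ?C (unused S i)" by (auto simp: disjoint_family_on_def)
  qed (rule ne')
  with union show "pmf_of_set (compat S x b) =
      do { e \<leftarrow> pmf_of_set (unused S i); pmf_of_set (?C e) }" by metis
qed

lemma inner_split:
  assumes "wf_sym S" "card (dom (known S)) \<le> N" "z \<in> Zp p"
    and "\<And>e r. known S (i, e) = Some r \<Longrightarrow> val S x b r \<noteq> z"
    and "compat S x b \<noteq> {}"
  shows "inner S F x b =
    (\<integral>\<^sup>+e. \<integral>\<^sup>+\<psi>. F x b \<psi> \<partial>pmf_of_set {\<psi> \<in> compat S x b. \<psi> i z = e} \<partial>pmf_of_set (unused S i))"
  using assms(5) compat_split(1)[OF assms]
  by (simp only: inner_def if_False nn_integral_bind_pmf)

lemma card_unused_inverse: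
  assumes "wf_sym S" "card (dom (known S)) \<le> N"
  shows "real p / real (card (unused S i)) \<le> 1 / real (p - 1)"
proof -
  have "real p / real (card (unused S i)) \<le> real p / real (p * (p - 1))"
  proof (rule divide_left_mono)
    have "0 < p * (p - 1)" using p_ge_2 by simp
    moreover from this have "0 < card (unused S i)" using card_unused[OF assms, of i] by linarith
    ultimately show "0 < real (card (unused S i)) * real (p * (p - 1))"
      by (intro mult_pos_pos) (simp_all only: of_nat_0_less_iff)
    show "real (p * (p - 1)) \<le> real (card (unused S i))"
      using card_unused[OF assms, of i] by (simp only: of_nat_le_iff)
  qed simp
  then show ?thesis using p_ge_2 by simp
qed

lemma lookup:
  assumes "wf_sym S" "card (dom (known S)) \<le> N" and w: "known S (i, w) = None"
    and F: "\<And>x b \<psi>. F x b \<psi> \<le> indicator {\<psi>. valid p (\<psi> i) w} \<psi> + G x b \<psi>"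
  shows "R S F \<le> R S G + ennreal (1 / real (p - 1))"
proof -
  let ?q = "1 / real (card (unused S i))"
  have "R S F \<le> R S (\<lambda>x b \<psi>. indicator {\<psi>. valid p (\<psi> i) w} \<psi> + G x b \<psi>)"
    using F by (intro R_mono)
  also have "\<dots> = R S (\<lambda>x b \<psi>. indicator {\<psi>. valid p (\<psi> i) w} \<psi>) + R S G"
    by (rule R_add)
  also have "R S (\<lambda>x b \<psi>. indicator {\<psi>. valid p (\<psi> i) w} \<psi>) \<le>
      (\<integral>\<^sup>+x. \<integral>\<^sup>+b. ennreal (1 / real (p - 1)) \<partial>bernoulli_pmf (1 / 2) \<partial>prior S)"
    unfolding R_eq
  proof (intro nn_integral_mono)
    fix x b
    show "inner S (\<lambda>x b \<psi>. indicator {\<psi>. valid p (\<psi> i) w} \<psi>) x b \<le> ennreal (1 / real (p - 1))"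
    proof (cases "compat S x b = {}")
      case False
      have single: "emeasure (pmf_of_set (compat S x b)) {\<psi>. \<psi> i z = w} \<le> ennreal ?q"
        if z: "z \<in> Zp p" for z
      proof (cases "\<exists>e r. known S (i, e) = Some r \<and> val S x b r = z")
        case True
        then obtain e r where er: "known S (i, e) = Some r" "val S x b r = z" by blast
        have "\<psi> i z = e" if "\<psi> \<in> compat S x b" for \<psi>
          using compatD(2)[OF that er(1)] er(2) by simp
        moreover have "e \<noteq> w" using er w by auto
        ultimately have "compat S x b \<inter> {\<psi>. \<psi> i z = w} = {}" by blast
        then show ?thesis using False by (simp add: emeasure_pmf_of_set finite_compat)
      next
        case new: False
        let ?F = "\<lambda>(x :: var \<Rightarrow> int) (b :: bool) (\<psi> :: bool \<Rightarrow> int \<Rightarrow> enc). indicator {\<psi>. \<psi> i z = w} \<psi> :: ennreal"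
        have "emeasure (pmf_of_set (compat S x b)) {\<psi>. \<psi> i z = w} = inner S ?F x b"
          using False by (simp add: inner_def)
        also have "\<dots> = (\<integral>\<^sup>+e. \<integral>\<^sup>+\<psi>. ?F x b \<psi> \<partial>pmf_of_set {\<psi> \<in> compat S x b. \<psi> i z = e} \<partial>pmf_of_set (unused S i))"
          by (rule inner_split[OF assms(1,2) z _ False]) (use new in blast)
        also have "\<dots> \<le> (\<integral>\<^sup>+e. indicator {w} e \<partial>pmf_of_set (unused S i))"
        proof (intro nn_integral_mono_AE AE_pmfI)
          fix e assume "e \<in> set_pmf (pmf_of_set (unused S i))"
          then have e: "e \<in> unused S i"
            using unused_nonempty[OF assms(1,2)] finite_unused by simp
          have ne: "{\<psi> \<in> compat S x b. \<psi> i z = e} \<noteq> {}"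
            by (rule compat_split(2)[OF assms(1,2) z _ False e]) (use new in blast)
          have "(\<integral>\<^sup>+\<psi>. ?F x b \<psi> \<partial>pmf_of_set {\<psi> \<in> compat S x b. \<psi> i z = e}) \<le>
            (\<integral>\<^sup>+\<psi>. indicator {w} e \<partial>pmf_of_set {\<psi> \<in> compat S x b. \<psi> i z = e})"
            using ne finite_compat[of S x b]
            by (intro nn_integral_mono_AE AE_pmfI) (auto simp: indicator_def)
          then show "(\<integral>\<^sup>+\<psi>. ?F x b \<psi> \<partial>pmf_of_set {\<psi> \<in> compat S x b. \<psi> i z = e}) \<le> indicator {w} e"
            by simp
        qed
        also have "\<dots> = emeasure (pmf_of_set (unused S i)) {w}" by simp
        also have "\<dots> = ennreal (real (card (unused S i \<inter> {w})) / real (card (unused S i)))"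
          by (simp add: emeasure_pmf_of_set unused_nonempty[OF assms(1,2)] finite_unused)
        also have "\<dots> \<le> ennreal ?q"
          by (intro ennreal_leI divide_right_mono) (auto simp: Int_insert_right card_insert_if)
        finally show ?thesis .
      qed
      have "inner S (\<lambda>x b \<psi>. indicator {\<psi>. valid p (\<psi> i) w} \<psi>) x b =
          emeasure (pmf_of_set (compat S x b)) (\<Union>z\<in>Zp p. {\<psi>. \<psi> i z = w})"
      proof -
        have "{\<psi>. valid p (\<psi> i) w} = (\<Union>z\<in>Zp p. {\<psi>. \<psi> i z = w})"
          by (auto simp: valid_def)
        then show ?thesis using False by (simp add: inner_def)
      qed
      also have "\<dots> \<le> (\<Sum>z\<in>Zp p. emeasure (pmf_of_set (compat S x b)) {\<psi>. \<psi> i z = w})"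
        by (intro emeasure_subadditive_finite) auto
      also have "\<dots> \<le> (\<Sum>z\<in>Zp p. ennreal ?q)" by (intro sum_mono single)
      also have "\<dots> = ennreal (real p * ?q)"
        by (simp add: ennreal_of_nat_eq_real_of_nat ennreal_mult[symmetric])
      also have "\<dots> \<le> ennreal (1 / real (p - 1))"
        using card_unused_inverse[OF assms(1,2), of i] by (intro ennreal_leI) simp
      finally show ?thesis .
    qed (simp add: inner_def)
  qed
  also have "\<dots> = ennreal (1 / real (p - 1))" by simp
  finally show ?thesis by (simp add: add.commute)
qed

lemma wf_SomeD:
  assumes "wf_sym S" "pol S = Some P"
  shows "wf_policy P" "length (indices P) < p" "VS \<in> vars S" "coefs P \<subseteq> vars S"
    "VHash ` set (leaves P) \<subseteq> vars S" "\<And>k. k < nkeys S \<Longrightarrow> \<not> satisfies (kattrs S k) P"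
proof -
  have "pol_ok S" using assms(1) unfolding wf_sym_def by blast
  then show "wf_policy P" "length (indices P) < p" "VS \<in> vars S" "coefs P \<subseteq> vars S"
    "VHash ` set (leaves P) \<subseteq> vars S" "\<And>k. k < nkeys S \<Longrightarrow> \<not> satisfies (kattrs S k) P"
    using assms(2) by (simp_all add: pol_ok_def)
qed

lemma wf_NoneD:
  assumes "wf_sym S" "pol S = None"
  shows "VS \<notin> vars S" "VCoef i j \<notin> vars S"
proof -
  have "pol_ok S" using assms(1) unfolding wf_sym_def by blast
  then show "VS \<notin> vars S" "VCoef i j \<notin> vars S" using assms(2) by (simp_all add: pol_ok_def)
qed

lemma wfD:
  assumes "wf_sym S"
  shows "finite (vars S)" "finite (dom (known S))" "VBeta \<in> vars S" "VA \<in> vars S"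
    "VR k \<in> vars S \<Longrightarrow> k < nkeys S" "VRJ k j \<in> vars S \<Longrightarrow> k < nkeys S"
    "k < nkeys S \<Longrightarrow> VR k \<in> vars S" "k < nkeys S \<Longrightarrow> finite (kattrs S k)"
    "k < nkeys S \<Longrightarrow> j \<in> kattrs S k \<Longrightarrow> VHash j \<in> vars S"
    "k < nkeys S \<Longrightarrow> j \<in> kattrs S k \<Longrightarrow> VRJ k j \<in> vars S"
    "known S (i, e) = Some r \<Longrightarrow> rep_ok S i r" "span1 S (msg S b)"
    "k < nkeys S \<Longrightarrow> kattrs S k = {} \<or> kattrs S k \<in> queried S" "\<not> int p dvd cs S n"
    "pol_ok S"
  using assms unfolding wf_sym_def by metis+

lemma wfI:
  assumes "finite (vars S)" "finite (dom (known S))" "VBeta \<in> vars S" "VA \<in> vars S"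
    "\<And>k. VR k \<in> vars S \<Longrightarrow> k < nkeys S" "\<And>k j. VRJ k j \<in> vars S \<Longrightarrow> k < nkeys S"
    "\<And>k. k < nkeys S \<Longrightarrow> VR k \<in> vars S" "\<And>k. k < nkeys S \<Longrightarrow> finite (kattrs S k)"
    "\<And>k j. k < nkeys S \<Longrightarrow> j \<in> kattrs S k \<Longrightarrow> VHash j \<in> vars S"
    "\<And>k j. k < nkeys S \<Longrightarrow> j \<in> kattrs S k \<Longrightarrow> VRJ k j \<in> vars S"
    "\<And>i e r. known S (i, e) = Some r \<Longrightarrow> rep_ok S i r" "\<And>b. span1 S (msg S b)"
    "\<And>k. k < nkeys S \<Longrightarrow> kattrs S k = {} \<or> kattrs S k \<in> queried S" "\<And>n. \<not> int p dvd cs S n"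
    "pol_ok S"
  shows "wf_sym S"
  unfolding wf_sym_def by (intro conjI allI impI ballI) (rule assms; assumption)+

section \<open>Collisions of inequivalent representations\<close>

lemma exists_kills_all:
  assumes "wf_sym S" "pol S = Some P"
  shows "\<exists>\<kappa>. \<forall>k<nkeys S. kills p (kattrs S k) P 1 (\<kappa> k)"
proof -
  have "\<exists>\<kappa>. kills p (kattrs S k) P 1 \<kappa>" if "k < nkeys S" for k
  proof (rule exists_kills[OF prime])
    note P = wf_SomeD[OF assms]
    show "distinct (indices P)" "thresholds_ok P" using P(1) by (simp_all add: wf_policy_def)
    show "\<not> satisfies (kattrs S k) P \<or> int p dvd 1" using P(6)[OF that] by simp
    have "set (indices P) \<subseteq> {1..length (indices P)}" using P(1) by (simp add: wf_policy_def)
    also have "\<dots> \<subseteq> {1..<p}" using P(2) by auto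
    finally show "set (indices P) \<subseteq> {1..<p}" .
  qed
  then have "\<forall>k\<in>{..<nkeys S}. \<exists>\<kappa>. kills p (kattrs S k) P 1 \<kappa>" by blast
  from bchoice[OF this] show ?thesis by auto
qed

lemma comb_pdeg:
  assumes "wf_sym S" "rep_ok S i r"
  shows "pdeg 4 (comb S b r)"
proof -
  have t: "pdeg 4 (\<lambda>x. x VBeta * x VA * x VS)"
    using pdeg_mult[OF pdeg_mult[OF pdeg_var[of 1] pdeg_var[of 1]] pdeg_var[of 2]]
    by (simp add: eval_nat_numeral)
  have "pdeg 4 (msg S b)" by (rule span1_pdeg[OF wfD(12)[OF assms(1)]])
  moreover have "pdeg 4 (snd r)"
    using assms(2) span1_pdeg span0_span1 by (auto simp: rep_ok_def split: if_splits)
  ultimately show ?thesis unfolding comb_def by (intro pdeg_add pdeg_cmult t)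
qed

lemma comb_dep:
  assumes "wf_sym S" "rep_ok S i r"
  shows "dep (vars S) (comb S b r)"
proof -
  have f: "dep (vars S) (snd r)"
    using assms(2) span1_dep span0_span1 by (auto simp: rep_ok_def split: if_splits)
  have m: "dep (vars S) (msg S b)" by (rule span1_dep[OF wfD(12)[OF assms(1)]])
  show ?thesis
  proof (cases "fst r = 0")
    case True
    then show ?thesis using f by (simp add: comb_def[abs_def])
  next
    case False
    then have "pol S \<noteq> None" using assms(2) by (auto simp: rep_ok_def split: if_splits)
    then obtain P where "pol S = Some P" by auto
    then have "{VS, VBeta, VA} \<subseteq> vars S" using wfD(3,4)[OF assms(1)] wf_SomeD(3)[OF assms(1)] by simp
    then have t: "dep (vars S) (\<lambda>x. x VBeta * x VA * x VS)" by (intro dep_intros) auto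
    show ?thesis unfolding comb_def[abs_def]
      by (rule dep_intros(3)[OF dep_intros(5)[OF dep_intros(1) dep_intros(3)[OF m t]] f])
  qed
qed

text \<open>Here the bit is hidden. If r and r' agreed identically for one b, their difference would
  express a multiple of \<beta> a s by the span. So the coefficients agree modulo p, the message
  drops out of the difference, and r and r' agree for the other bit as well, contrary to
  inequivalence.\<close>

lemma comb_neq:
  assumes "wf_sym S" "rep_ok S i r" "rep_ok S i r'" "\<not> eqv S r r'"
  shows "\<exists>x. \<not> int p dvd comb S b r x - comb S b r' x"
proof (rule ccontr)
  assume "\<not> ?thesis"
  then have H: "int p dvd comb S b r x - comb S b r' x" for x by blast
  have c: "int p dvd fst r - fst r'"
  proof (cases "fst r = fst r'")
    case False
    then have "pol S \<noteq> None" "i" using assms by (auto simp: rep_ok_def split: if_splits)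
    then obtain P where P: "pol S = Some P" by auto
    obtain \<kappa> where \<kappa>: "\<And>k. k < nkeys S \<Longrightarrow> kills p (kattrs S k) P 1 (\<kappa> k)"
      using exists_kills_all[OF assms(1) P] by blast
    show ?thesis
    proof (rule target_not_in_span1[OF P \<kappa> _ prime p_odd])
      show "span1 S (\<lambda>x. (fst r - fst r') * msg S b x + (snd r x - snd r' x))"
        using assms(2,3) \<open>i\<close> wfD(12)[OF assms(1)]
        by (intro span1_add span1_scale span1_diff) (simp_all add: rep_ok_def)
      show "int p dvd (fst r - fst r') * (x VBeta * x VA * x VS) +
          ((fst r - fst r') * msg S b x + (snd r x - snd r' x))" for x
        using H[of x] by (simp add: comb_def algebra_simps)
      show "finite (kattrs S k)" if "k < nkeys S" for k using wfD(8)[OF assms(1) that] .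
    qed
  qed simp
  have "int p dvd comb S b' r x - comb S b' r' x" for b' x
  proof -
    have "comb S b' r x - comb S b' r' x =
        (comb S b r x - comb S b r' x) + (fst r - fst r') * (msg S b' x - msg S b x)"
      by (simp add: comb_def algebra_simps)
    then show ?thesis using H[of x] c by simp
  qed
  then have "eqv S r r'" by (auto simp: eqv_def val_def mod_eq_dvd_iff)
  with assms(4) show False by simp
qed

lemma prob_collision:
  assumes "wf_sym S" "rep_ok S i r" "rep_ok S i r'" "\<not> eqv S r r'"
  shows "emeasure (prior S) {x. val S x b r = val S x b r'} \<le>
    ennreal (real (card (vars S)) * (4 / real (p - 1)))"
proof -
  obtain y where y: "\<not> int p dvd comb S b r y - comb S b r' y"
    using comb_neq[OF assms] by blast
  \<comment> \<open>The prior assigns 0 outside \<open>vars S\<close>, and the witness has to agree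
    with it there.\<close>
  define x0 where "x0 = (\<lambda>v. if v \<in> vars S then y v else 0)"
  have "comb S b r x0 = comb S b r y" "comb S b r' x0 = comb S b r' y"
    by (rule depD[OF comb_dep[OF assms(1)]]; use assms x0_def in auto)+
  with y have x0: "\<not> int p dvd comb S b r x0 - comb S b r' x0" by simp
  have "emeasure (prior S) {x. int p dvd comb S b r x - comb S b r' x} \<le>
      ennreal (real (card (vars S)) * (real 4 / real (p - 1)))"
  proof (rule schwartz_zippel[where ?x0.0 = x0, OF prime])
    show "pdeg 4 (\<lambda>x. comb S b r x - comb S b r' x)"
      using assms by (intro pdeg_diff comb_pdeg)
    show "finite (vars S)" by (rule wfD(1)[OF assms(1)])
    show "\<not> int p dvd comb S b r x0 - comb S b r' x0" by (rule x0)
  qed (simp add: x0_def)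
  then show ?thesis by (simp add: val_def mod_eq_dvd_iff)
qed

section \<open>Extending the table of known strings\<close>

lemma handle_known [simp]: "handle (S\<lparr>known := kn\<rparr>) = handle S"
proof (intro HOL.ext iffI)
  fix e1 e2 e3 f
  have e: "extends (S\<lparr>known := kn\<rparr>) S" "extends S (S\<lparr>known := kn\<rparr>)" by (auto simp: extends_def)
  show "handle S e1 e2 e3 f" if "handle (S\<lparr>known := kn\<rparr>) e1 e2 e3 f"
    using handle_extends[OF that e(1)] .
  show "handle (S\<lparr>known := kn\<rparr>) e1 e2 e3 f" if "handle S e1 e2 e3 f"
    using handle_extends[OF that e(2)] .
qed

lemma span_known [simp]: "span0 (S\<lparr>known := kn\<rparr>) = span0 S" "span1 (S\<lparr>known := kn\<rparr>) = span1 S"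
proof -
  have e: "extends (S\<lparr>known := kn\<rparr>) S" "extends S (S\<lparr>known := kn\<rparr>)" by (auto simp: extends_def)
  then show "span0 (S\<lparr>known := kn\<rparr>) = span0 S" "span1 (S\<lparr>known := kn\<rparr>) = span1 S"
    using span0_extends span1_extends by (blast intro!: HOL.ext)+
qed

lemma rep_ok_known [simp]: "rep_ok (S\<lparr>known := kn\<rparr>) = rep_ok S"
  by (simp add: rep_ok_def fun_eq_iff)

lemma val_known [simp]: "val (S\<lparr>known := kn\<rparr>) = val S"
  by (simp add: val_def comb_def fun_eq_iff)

lemma eqv_known [simp]: "eqv (S\<lparr>known := kn\<rparr>) = eqv S"
  by (simp add: eqv_def fun_eq_iff)

lemma wf_known:
  assumes "wf_sym S" "finite (dom kn)" "\<And>i e r. kn (i, e) = Some r \<Longrightarrow> rep_ok S i r"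
  shows "wf_sym (S\<lparr>known := kn\<rparr>)"
proof (rule wfI)
  show "pol_ok (S\<lparr>known := kn\<rparr>)"
    using wfD(15)[OF assms(1)] by (cases "pol S") (simp_all add: pol_ok_def)
qed (simp_all, (rule assms(2,3) wfD[OF assms(1)]; assumption)+)

lemma compat_add_known:
  assumes "known S (i, e) = None"
  shows "compat (S\<lparr>known := (known S)((i, e) \<mapsto> r)\<rparr>) x b = {\<psi> \<in> compat S x b. \<psi> i (val S x b r) = e}"
proof (intro equalityI subsetI)
  fix \<psi> assume \<psi>: "\<psi> \<in> compat (S\<lparr>known := (known S)((i, e) \<mapsto> r)\<rparr>) x b"
  have "\<psi> j (val S x b r') = e'" if "known S (j, e') = Some r'" for j e' r'
    using compatD(2)[OF \<psi>, of j e' r'] that assms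
    by (cases "j = i \<and> e' = e") auto
  moreover have "\<psi> i (val S x b r) = e" using compatD(2)[OF \<psi>, of i e r] by simp
  ultimately show "\<psi> \<in> {\<psi> \<in> compat S x b. \<psi> i (val S x b r) = e}"
    using compatD(1)[OF \<psi>] by (simp add: compat_def)
next
  fix \<psi> assume "\<psi> \<in> {\<psi> \<in> compat S x b. \<psi> i (val S x b r) = e}"
  then show "\<psi> \<in> compat (S\<lparr>known := (known S)((i, e) \<mapsto> r)\<rparr>) x b"
    by (auto simp: compat_def)
qed

lemma reveal_new:
  assumes "wf_sym S" "card (dom (known S)) \<le> N" "card (vars S) \<le> N" "rep_ok S i r"
    and new: "\<And>e r'. known S (i, e) = Some r' \<Longrightarrow> \<not> eqv S r' r"
    and F: "\<And>x b \<psi>. F x b \<psi> \<le> 1"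
  shows "R S F \<le> ennreal (real N * real N * (4 / real (p - 1))) +
    (\<integral>\<^sup>+e. R (S\<lparr>known := (known S)((i, e) \<mapsto> r)\<rparr>) F \<partial>pmf_of_set (unused S i))"
proof -
  let ?S = "\<lambda>e. S\<lparr>known := (known S)((i, e) \<mapsto> r)\<rparr>"
  define K where "K = {r'. \<exists>e. known S (i, e) = Some r'}"
  have "K \<subseteq> (\<lambda>k. the (known S k)) ` dom (known S)" by (force simp: K_def)
  moreover have fin: "finite (dom (known S))" by (rule wfD(2)[OF assms(1)])
  ultimately have K: "finite K" "card K \<le> N"
    using assms(2) by (auto intro: finite_subset order_trans[OF surj_card_le])
  let ?col = "\<lambda>x b. indicator (\<Union>r'\<in>K. {x. val S x b r' = val S x b r}) x :: ennreal"
  have step: "inner S F x b \<le> ?col x b + (\<integral>\<^sup>+e. inner (?S e) F x b \<partial>pmf_of_set (unused S i))" for x b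
  proof (cases "compat S x b = {} \<or> (\<exists>r'\<in>K. val S x b r' = val S x b r)")
    case True
    have "inner S F x b \<le> 1"
    proof (cases "compat S x b = {}")
      case False
      then have "inner S F x b \<le> (\<integral>\<^sup>+\<psi>. 1 \<partial>pmf_of_set (compat S x b))"
        unfolding inner_def using F by (auto intro: nn_integral_mono simp del: nn_integral_const)
      then show ?thesis by simp
    qed (simp add: inner_def)
    moreover have "inner S F x b = 0" if "compat S x b = {}" using that by (simp add: inner_def)
    ultimately show ?thesis using True by (auto simp: indicator_def intro: order_trans)
  next
    case False
    have z: "val S x b r \<in> Zp p" using p_ge_2 by (simp add: val_def)
    have n: "\<And>e r'. known S (i, e) = Some r' \<Longrightarrow> val S x b r' \<noteq> val S x b r"
      using False by (auto simp: K_def)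
    have "inner S F x b = (\<integral>\<^sup>+e. \<integral>\<^sup>+\<psi>. F x b \<psi>
        \<partial>pmf_of_set {\<psi> \<in> compat S x b. \<psi> i (val S x b r) = e} \<partial>pmf_of_set (unused S i))"
      by (rule inner_split[OF assms(1,2) z n]) (use False in auto)
    also have "\<dots> = (\<integral>\<^sup>+e. inner (?S e) F x b \<partial>pmf_of_set (unused S i))"
    proof (intro nn_integral_cong_AE AE_pmfI)
      fix e assume "e \<in> set_pmf (pmf_of_set (unused S i))"
      then have e: "e \<in> unused S i"
        using unused_nonempty[OF assms(1,2)] finite_unused by simp
      then have "known S (i, e) = None" by (simp add: unused_def)
      moreover have "{\<psi> \<in> compat S x b. \<psi> i (val S x b r) = e} \<noteq> {}"
        by (rule compat_split(2)[OF assms(1,2) z n _ e]) (use False in auto)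
      ultimately show "(\<integral>\<^sup>+\<psi>. F x b \<psi> \<partial>pmf_of_set {\<psi> \<in> compat S x b. \<psi> i (val S x b r) = e})
          = inner (?S e) F x b"
        by (simp only: inner_def compat_add_known if_False)
    qed
    finally show ?thesis by simp
  qed
  have col: "(\<integral>\<^sup>+x. ?col x b \<partial>prior S) \<le> ennreal (real N * real N * (4 / real (p - 1)))" for b
  proof -
    have "(\<integral>\<^sup>+x. ?col x b \<partial>prior S) =
        emeasure (prior S) (\<Union>r'\<in>K. {x. val S x b r' = val S x b r})"
      by simp
    also have "\<dots> \<le> (\<Sum>r'\<in>K. emeasure (prior S) {x. val S x b r' = val S x b r})"
      using K(1) by (intro emeasure_subadditive_finite) auto
    also have "\<dots> \<le> (\<Sum>r'\<in>K. ennreal (real N * (4 / real (p - 1))))"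
    proof (intro sum_mono)
      fix r' assume "r' \<in> K"
      then obtain e where e: "known S (i, e) = Some r'" by (auto simp: K_def)
      then have "rep_ok S i r'" using wfD(11)[OF assms(1)] by blast
      then have "emeasure (prior S) {x. val S x b r' = val S x b r} \<le>
          ennreal (real (card (vars S)) * (4 / real (p - 1)))"
        using new[OF e] assms(1,4) by (intro prob_collision)
      also have "\<dots> \<le> ennreal (real N * (4 / real (p - 1)))"
        using assms(3) by (intro ennreal_leI mult_right_mono) auto
      finally show "emeasure (prior S) {x. val S x b r' = val S x b r} \<le> \<dots>" .
    qed
    also have "\<dots> = ennreal (real (card K) * (real N * (4 / real (p - 1))))"
      by (simp add: ennreal_of_nat_eq_real_of_nat ennreal_mult[symmetric])
    also have "\<dots> \<le> ennreal (real N * (real N * (4 / real (p - 1))))"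
      using K(2) by (intro ennreal_leI mult_right_mono) auto
    finally show ?thesis by (simp only: mult.assoc)
  qed
  have "R S F \<le> (\<integral>\<^sup>+x. \<integral>\<^sup>+b. ?col x b + (\<integral>\<^sup>+e. inner (?S e) F x b \<partial>pmf_of_set (unused S i))
      \<partial>bernoulli_pmf (1 / 2) \<partial>prior S)"
    unfolding R_eq by (intro nn_integral_mono step)
  also have "\<dots> = (\<integral>\<^sup>+b. \<integral>\<^sup>+x. ?col x b \<partial>prior S \<partial>bernoulli_pmf (1 / 2)) +
      (\<integral>\<^sup>+x. \<integral>\<^sup>+b. (\<integral>\<^sup>+e. inner (?S e) F x b \<partial>pmf_of_set (unused S i))
      \<partial>bernoulli_pmf (1 / 2) \<partial>prior S)"
    by (subst nn_integral_pmf_commute) (simp add: nn_integral_add del: nn_integral_bernoulli_pmf)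
  also have "\<dots> \<le> (\<integral>\<^sup>+b. ennreal (real N * real N * (4 / real (p - 1))) \<partial>bernoulli_pmf (1 / 2)) +
      (\<integral>\<^sup>+e. R (?S e) F \<partial>pmf_of_set (unused S i))"
  proof (rule add_mono)
    show "(\<integral>\<^sup>+b. \<integral>\<^sup>+x. ?col x b \<partial>prior S \<partial>bernoulli_pmf (1 / 2)) \<le>
      (\<integral>\<^sup>+b. ennreal (real N * real N * (4 / real (p - 1))) \<partial>bernoulli_pmf (1 / 2))"
      by (intro nn_integral_mono col)
    show "(\<integral>\<^sup>+x. \<integral>\<^sup>+b. (\<integral>\<^sup>+e. inner (?S e) F x b \<partial>pmf_of_set (unused S i))
      \<partial>bernoulli_pmf (1 / 2) \<partial>prior S) \<le> (\<integral>\<^sup>+e. R (?S e) F \<partial>pmf_of_set (unused S i))"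
      unfolding R_eq
      by (subst (2) nn_integral_pmf_commute, subst nn_integral_pmf_commute)
         (simp del: nn_integral_bernoulli_pmf)
  qed
  finally show ?thesis by simp
qed

end

section \<open>The algorithms as functions of uniform exponents\<close>

text \<open>The lazily sampled oracle is a partial view of the assignment; V tells which hash values
  have been drawn.\<close>

definition table :: "var set \<Rightarrow> (var \<Rightarrow> int) \<Rightarrow> hash_table" where
  "table V x = (\<lambda>a. if VHash a \<in> V then Some (x (VHash a)) else None)"

lemma table_cong: "(\<And>a. VHash a \<in> V \<Longrightarrow> x (VHash a) = y (VHash a)) \<Longrightarrow> table V x = table V y"
  by (auto simp: table_def)

text \<open>For a repeated query the set of sampled indeterminates is empty, so both branches of the
  oracle become one sampling step.\<close>

lemma hash_conv:
  "hash p a (table V x) =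
     map_pmf (\<lambda>x'. (x' (VHash a), table (insert (VHash a) V) x')) (sample_on p x ({VHash a} - V))"
proof (cases "VHash a \<in> V")
  case True
  then show ?thesis by (simp add: hash_def table_def insert_absorb)
next
  case False
  have "(table V x)(a \<mapsto> y) = table (insert (VHash a) V) (x(VHash a := y))" for y
    by (auto simp: table_def fun_eq_iff)
  then show ?thesis using False
    by (simp add: hash_def table_def[of V] sample_on_singleton samp_def map_pmf_def
        bind_assoc_pmf bind_return_pmf Diff_triv)
qed

lemma sample_on_off: "finite A \<Longrightarrow> y \<in> set_pmf (sample_on p x A) \<Longrightarrow> v \<notin> A \<Longrightarrow> y v = x v"
  using set_sample_on(2) by blast

text \<open>The draws of the recursion concern pairwise different indeterminates, so no later draw
  overwrites an earlier value and all can be made at once.\<close>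

lemma keygen_attrs_conv:
  assumes "distinct js" "\<And>j. VRJ k j \<notin> V"
  shows "keygen_attrs p r js (table V x) =
    map_pmf (\<lambda>x'. (map (\<lambda>j. (j, (r + x' (VHash j) * x' (VRJ k j)) mod int p, x' (VRJ k j))) js,
               table (V \<union> VHash ` set js) x'))
      (sample_on p x (VRJ k ` set js \<union> (VHash ` set js - V)))"
  using assms
proof (induction js arbitrary: V x)
  case Nil
  then show ?case by simp
next
  case (Cons j js)
  let ?V = "insert (VHash j) V"
  let ?A = "VRJ k ` set js \<union> (VHash ` set js - ?V)"
  let ?g = "\<lambda>j x'. (j, (r + x' (VHash j) * x' (VRJ k j)) mod int p, x' (VRJ k j))"
  have V: "VRJ k i \<notin> ?V" for i using Cons.prems by simp
  have A: "VRJ k ` set (j # js) \<union> (VHash ` set (j # js) - V) = {VRJ k j} \<union> (({VHash j} - V) \<union> ?A)"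
    by auto
  have disj: "{VRJ k j} \<inter> (({VHash j} - V) \<union> ?A) = {}" "({VHash j} - V) \<inter> ?A = {}"
    using Cons.prems by auto
  have S: "sample_on p x (VRJ k ` set (j # js) \<union> (VHash ` set (j # js) - V)) =
    do { x1 \<leftarrow> sample_on p x {VRJ k j}; x2 \<leftarrow> sample_on p x1 ({VHash j} - V); sample_on p x2 ?A }"
    unfolding A using disj by (subst sample_on_Un, simp_all, subst sample_on_Un, simp_all)
  have "keygen_attrs p r (j # js) (table V x) =
    do { y \<leftarrow> samp p (VRJ k j);
      (h, tab) \<leftarrow> hash p j (table V (x(VRJ k j := y)));
      (ds, tab) \<leftarrow> keygen_attrs p r js tab;
      return_pmf ((j, (r + h * y) mod int p, y) # ds, tab) }"
  proof -
    have "table V (x(VRJ k j := y)) = table V x" for y by (intro table_cong) auto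
    then show ?thesis by (simp add: samp_def)
  qed
  also have "\<dots> = do { y \<leftarrow> samp p (VRJ k j); x2 \<leftarrow> sample_on p (x(VRJ k j := y)) ({VHash j} - V);
      x3 \<leftarrow> sample_on p x2 ?A;
      return_pmf ((j, (r + x2 (VHash j) * y) mod int p, y) # map (\<lambda>j. ?g j x3) js,
        table (?V \<union> VHash ` set js) x3) }"
    unfolding hash_conv using Cons V
    by (simp add: map_pmf_def bind_assoc_pmf bind_return_pmf)
  also have "\<dots> = do { y \<leftarrow> samp p (VRJ k j); x2 \<leftarrow> sample_on p (x(VRJ k j := y)) ({VHash j} - V);
      x3 \<leftarrow> sample_on p x2 ?A;
      return_pmf (map (\<lambda>j. ?g j x3) (j # js), table (V \<union> VHash ` set (j # js)) x3) }"
  proof (intro bind_pmf_cong refl)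
    fix y x2 x3
    assume x2: "x2 \<in> set_pmf (sample_on p (x(VRJ k j := y)) ({VHash j} - V))"
      and x3: "x3 \<in> set_pmf (sample_on p x2 ?A)"
    have "x3 (VHash j) = x2 (VHash j)" by (rule sample_on_off[OF _ x3]) auto
    moreover have "x3 (VRJ k j) = x2 (VRJ k j)" using Cons.prems by (intro sample_on_off[OF _ x3]) auto
    moreover have "x2 (VRJ k j) = y" using sample_on_off[OF _ x2, of "VRJ k j"] by auto
    ultimately show "return_pmf ((j, (r + x2 (VHash j) * y) mod int p, y) # map (\<lambda>j. ?g j x3) js,
        table (?V \<union> VHash ` set js) x3) = return_pmf (map (\<lambda>j. ?g j x3) (j # js),
        table (V \<union> VHash ` set (j # js)) x3)" by simp
  qed
  also have "\<dots> = map_pmf (\<lambda>x'. (map (\<lambda>j. ?g j x') (j # js), table (V \<union> VHash ` set (j # js)) x'))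
      (sample_on p x (VRJ k ` set (j # js) \<union> (VHash ` set (j # js) - V)))"
    unfolding S sample_on_singleton by (simp add: map_pmf_def bind_assoc_pmf bind_return_pmf)
  finally show ?case .
qed

lemma encrypt_leaves_conv:
  "encrypt_leaves p g ys (table V x) =
    map_pmf (\<lambda>x'. (map (\<lambda>(a, q). (g * q mod int p, x' (VHash a) * q mod int p)) ys,
               table (V \<union> VHash ` fst ` set ys) x'))
      (sample_on p x (VHash ` fst ` set ys - V))"
proof (induction ys arbitrary: V x)
  case Nil
  then show ?case by simp
next
  case (Cons y ys)
  obtain a q where y: "y = (a, q)" by (cases y)
  let ?V = "insert (VHash a) V"
  \<comment> \<open>Several leaves may carry the same attribute; its hash value is drawn only at the
    first of them.\<close>
  let ?A = "VHash ` fst ` set ys - ?V"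
  let ?g = "\<lambda>x' (a, q). (g * q mod int p, x' (VHash a) * q mod int p)"
  have S: "sample_on p x (VHash ` fst ` set (y # ys) - V) =
      do { x1 \<leftarrow> sample_on p x ({VHash a} - V); sample_on p x1 ?A }"
  proof -
    have "VHash ` fst ` set (y # ys) - V = ({VHash a} - V) \<union> ?A" using y by auto
    then show ?thesis by (simp only:) (subst sample_on_Un, auto)
  qed
  have "encrypt_leaves p g (y # ys) (table V x) =
    do { x1 \<leftarrow> sample_on p x ({VHash a} - V); x2 \<leftarrow> sample_on p x1 ?A;
      return_pmf ((g * q mod int p, x1 (VHash a) * q mod int p) # map (?g x2) ys,
        table (?V \<union> VHash ` fst ` set ys) x2) }"
    unfolding y encrypt_leaves.simps hash_conv using Cons
    by (simp add: map_pmf_def bind_assoc_pmf bind_return_pmf)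
  also have "\<dots> = do { x1 \<leftarrow> sample_on p x ({VHash a} - V); x2 \<leftarrow> sample_on p x1 ?A;
      return_pmf (map (?g x2) (y # ys), table (V \<union> VHash ` fst ` set (y # ys)) x2) }"
  proof (intro bind_pmf_cong refl)
    fix x1 x2 assume x2: "x2 \<in> set_pmf (sample_on p x1 ?A)"
    have "x2 (VHash a) = x1 (VHash a)" by (rule sample_on_off[OF _ x2]) auto
    then show "return_pmf ((g * q mod int p, x1 (VHash a) * q mod int p) # map (?g x2) ys,
        table (?V \<union> VHash ` fst ` set ys) x2) =
        return_pmf (map (?g x2) (y # ys), table (V \<union> VHash ` fst ` set (y # ys)) x2)"
      by (simp add: y)
  qed
  also have "\<dots> = map_pmf (\<lambda>x'. (map (?g x') (y # ys), table (V \<union> VHash ` fst ` set (y # ys)) x'))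
      (sample_on p x (VHash ` fst ` set (y # ys) - V))"
    unfolding S by (simp add: map_pmf_def bind_assoc_pmf bind_return_pmf)
  finally show ?case .
qed

section \<open>Secret sharing as linear forms in uniform coefficients\<close>

definition eval_shares :: "nat \<Rightarrow> policy \<Rightarrow> int \<Rightarrow> (var \<Rightarrow> int) \<Rightarrow> int list" where
  "eval_shares p P v x = map (\<lambda>(a, l). l x mod int p) (lshares P (\<lambda>_. v))"

text \<open>Reconciles \<open>share\<close>, which reduces the value passed to every child modulo p,
  with the unreduced symbolic shares.\<close>

lemma lshares_mod_cong:
  "[v x = v' x] (mod int p) \<Longrightarrow>
     map (\<lambda>(a, l). l x mod int p) (lshares P v) = map (\<lambda>(a, l). l x mod int p) (lshares P v')"
proof (induction P v arbitrary: v' rule: lshares.induct)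
  case (1 i a v)
  then show ?case by (simp add: cong_def)
next
  case (2 i k ts v)
  let ?h = "\<lambda>v t x. v x + (\<Sum>j=1..<k. x (VCoef i j) * int (index t) ^ j)"
  have "map (\<lambda>(a, l). l x mod int p) (lshares t (?h v t)) =
      map (\<lambda>(a, l). l x mod int p) (lshares t (?h v' t))" if "t \<in> set ts" for t
    by (rule 2(1)[OF that]) (intro cong_add 2(2) cong_refl)
  then show ?case by (simp add: map_concat o_def cong: map_cong)
qed

lemma finite_coefs: "finite (coefs P)"
  by (induction P rule: coefs.induct) auto

lemma coefs_indices: "v \<in> coefs P \<Longrightarrow> \<exists>i j. v = VCoef i j \<and> i \<in> set (indices P)"
proof (induction P rule: coefs.induct)
  case (2 i k ts)
  show ?case
  proof (cases "v \<in> VCoef i ` {1..<k}")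
    case False
    with 2 obtain t where "t \<in> set ts" "v \<in> coefs t" by auto
    with 2(1)[of t] show ?thesis by auto
  qed auto
qed simp

lemma eval_shares_cong:
  assumes "\<And>v. v \<in> coefs P \<Longrightarrow> x v = y v"
  shows "eval_shares p P v x = eval_shares p P v y"
proof -
  have l: "l x = l y" if "(a, l) \<in> set (lshares P (\<lambda>_. v))" for a l
    by (rule depD[OF lshares_dep[OF that, of "coefs P"]]) (auto intro: dep_intros assms)
  have "(case z of (a, l) \<Rightarrow> l x mod int p) = (case z of (a, l) \<Rightarrow> l y mod int p)"
    if "z \<in> set (lshares P (\<lambda>_. v))" for z
    using that l[of "fst z" "snd z"] by (simp add: case_prod_unfold)
  then show ?thesis unfolding eval_shares_def by (intro map_cong refl)
qed

definition gate_poly :: "nat \<Rightarrow> nat \<Rightarrow> int \<Rightarrow> (var \<Rightarrow> int) \<Rightarrow> int poly" where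
  "gate_poly i k v x = Poly (v # map (\<lambda>j. x (VCoef i j)) [1..<k])"

lemma coeff_gate_poly:
  "coeff (gate_poly i k v x) j = (if j = 0 then v else if j < k then x (VCoef i j) else 0)"
  by (cases j) (auto simp: gate_poly_def nth_default_def)

lemma poly_gate_poly:
  "poly (gate_poly i k v x) z = v + (\<Sum>j=1..<k. x (VCoef i j) * z ^ j)"
proof -
  \<comment> \<open>The maximum takes care of k = 0, where the constant term v is still
    present.\<close>
  have "poly (gate_poly i k v x) z = (\<Sum>j<max 1 k. coeff (gate_poly i k v x) j * z ^ j)"
    unfolding poly_altdef
  proof (rule sum.mono_neutral_left)
    show "{..degree (gate_poly i k v x)} \<subseteq> {..<max 1 k}"
    proof -
      have "degree (gate_poly i k v x) < max 1 k"
        by (rule le_less_trans[OF degree_le[of "max 1 k - 1"]]) (auto simp: coeff_gate_poly)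
      then show ?thesis by auto
    qed
  qed (auto simp: coeff_eq_0)
  also have "\<dots> = v + (\<Sum>j=1..<max 1 k. coeff (gate_poly i k v x) j * z ^ j)"
    by (simp add: lessThan_atLeast0 sum.atLeast_Suc_lessThan coeff_gate_poly)
  also have "(\<Sum>j=1..<max 1 k. coeff (gate_poly i k v x) j * z ^ j) = (\<Sum>j=1..<k. x (VCoef i j) * z ^ j)"
    by (intro sum.cong) (auto simp: coeff_gate_poly)
  finally show ?thesis .
qed

text \<open>The constant coefficient is fixed to v and the coefficients of degree 1 to k - 1 are
  free coordinates of the admissible polynomials, so a uniform polynomial amounts to independent
  uniform coefficients.\<close>

lemma sample_poly_conv:
  assumes "p \<ge> 2" "v \<in> Zp p" "1 \<le> k"
  shows "sample_poly p (k - 1) v = map_pmf (gate_poly i k v) (sample_on p x (VCoef i ` {1..<k}))"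
proof -
  define A where "A = VCoef i ` {1..<k}"
  let ?D = "PiE_dflt A 0 (\<lambda>_. Zp p)"
  let ?Q = "{q. degree q \<le> k - 1 \<and> poly q 0 = v \<and> (\<forall>i. coeff q i \<in> Zp p)}"
  have A: "finite A" by (simp add: A_def)
  have "Pi_pmf A 0 (samp p) = Pi_pmf A 0 (\<lambda>_. pmf_of_set (Zp p))"
    by (intro Pi_pmf_cong) (auto simp: A_def samp_def sample_Zp_def)
  also have "\<dots> = pmf_of_set ?D" using assms A by (intro Pi_pmf_of_set) auto
  finally have Pi: "Pi_pmf A 0 (samp p) = pmf_of_set ?D" .
  have bij: "bij_betw (gate_poly i k v) ?D ?Q"
  proof (rule bij_betwI[where g = "\<lambda>q u. if u \<in> A then (case u of VCoef i j \<Rightarrow> coeff q j | _ \<Rightarrow> 0) else 0"])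
    show "gate_poly i k v \<in> ?D \<rightarrow> ?Q"
    proof (intro funcsetI CollectI conjI allI)
      fix y assume y: "y \<in> ?D"
      show "degree (gate_poly i k v y) \<le> k - 1"
        by (rule degree_le) (auto simp: coeff_gate_poly)
      show "poly (gate_poly i k v y) 0 = v" by (simp add: poly_0_coeff_0 coeff_gate_poly)
      show "coeff (gate_poly i k v y) j \<in> Zp p" for j
        using y assms by (auto simp: coeff_gate_poly PiE_dflt_def A_def)
    qed
    show "(\<lambda>q u. if u \<in> A then (case u of VCoef i j \<Rightarrow> coeff q j | _ \<Rightarrow> 0) else 0) \<in> ?Q \<rightarrow> ?D"
      by (auto simp: PiE_dflt_def A_def)
    show "(\<lambda>u. if u \<in> A then (case u of VCoef i' j \<Rightarrow> coeff (gate_poly i k v y) j | _ \<Rightarrow> 0) else 0) = y"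
      if "y \<in> ?D" for y
      using that by (auto simp: PiE_dflt_def A_def coeff_gate_poly fun_eq_iff)
    show "gate_poly i k v (\<lambda>u. if u \<in> A then (case u of VCoef i j \<Rightarrow> coeff q j | _ \<Rightarrow> 0) else 0) = q"
      if q: "q \<in> ?Q" for q
    proof (rule poly_eqI)
      fix j
      have "coeff q j = 0" if "j \<ge> k" using q that assms(3) by (intro coeff_eq_0) auto
      then show "coeff (gate_poly i k v (\<lambda>u. if u \<in> A then (case u of VCoef i j \<Rightarrow> coeff q j | _ \<Rightarrow> 0) else 0)) j = coeff q j"
        using q by (auto simp: coeff_gate_poly A_def poly_0_coeff_0)
    qed
  qed
  have "map_pmf (gate_poly i k v) (sample_on p x A) = map_pmf (gate_poly i k v) (Pi_pmf A 0 (samp p))"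
    unfolding sample_on_def pmf.map_comp
    by (intro map_pmf_cong refl poly_eqI) (auto simp: coeff_gate_poly A_def)
  also have "\<dots> = pmf_of_set ?Q"
    unfolding Pi
  proof (rule map_pmf_of_set_bij_betw[OF bij])
    show "?D \<noteq> {}" using assms by (auto simp: PiE_dflt_def intro!: exI[of _ "\<lambda>_. 0"])
    show "finite ?D" using A by (intro finite_PiE_dflt) auto
  qed
  finally show ?thesis by (simp add: sample_poly_def A_def)
qed

text \<open>Distinct indices give every gate its own coefficients, so the draws of the recursion are
  independent and merge into a single one.\<close>

lemma share_conv:
  "p \<ge> 2 \<Longrightarrow> distinct (indices P) \<Longrightarrow> thresholds_ok P \<Longrightarrow> v \<in> Zp p \<Longrightarrow>
     share p P v = map_pmf (eval_shares p P v) (sample_on p x (coefs P))"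
  "p \<ge> 2 \<Longrightarrow> distinct (concat (map indices ts)) \<Longrightarrow> \<forall>t\<in>set ts. thresholds_ok t \<Longrightarrow>
     share_list p q ts = map_pmf
       (\<lambda>x'. concat (map (\<lambda>t. eval_shares p t (poly q (int (index t)) mod int p) x') ts))
       (sample_on p x (\<Union>t\<in>set ts. coefs t))"
proof (induction p P v and p q ts arbitrary: x and x rule: share_share_list.induct)
  case (1 p i a v)
  then show ?case by (simp add: eval_shares_def)
next
  case (2 p i k ts v)
  let ?C = "VCoef i ` {1..<k}" and ?U = "\<Union>t\<in>set ts. coefs t"
  let ?e = "\<lambda>x1 x2. concat (map (\<lambda>t. eval_shares p t (poly (gate_poly i k v x1) (int (index t)) mod int p) x2) ts)"
  have off: "VCoef i j \<notin> ?U" for j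
  proof
    assume "VCoef i j \<in> ?U"
    then obtain t where "t \<in> set ts" "i \<in> set (indices t)" using coefs_indices by blast
    then show False using 2 by auto
  qed
  have "share p (Gate i k ts) v =
      do { x1 \<leftarrow> sample_on p x ?C; share_list p (gate_poly i k v x1) ts }"
    using 2 sample_poly_conv[of p v k i x] by (simp add: map_pmf_def bind_assoc_pmf bind_return_pmf)
  also have "\<dots> = do { x1 \<leftarrow> sample_on p x ?C; x2 \<leftarrow> sample_on p x1 ?U; return_pmf (?e x1 x2) }"
  proof (intro bind_pmf_cong refl)
    fix x1 assume x1: "x1 \<in> set_pmf (sample_on p x ?C)"
    have "gate_poly i k v x1 \<in> set_pmf (sample_poly p (k - 1) v)"
      using x1 2 sample_poly_conv[of p v k i x] by simp
    then have "share_list p (gate_poly i k v x1) ts = map_pmf (?e x1) (sample_on p x1 ?U)"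
      by (rule 2(1)) (use 2 in auto)
    then show "share_list p (gate_poly i k v x1) ts = do { x2 \<leftarrow> sample_on p x1 ?U; return_pmf (?e x1 x2) }"
      by (simp add: map_pmf_def)
  qed
  also have "\<dots> = do { x1 \<leftarrow> sample_on p x ?C; x2 \<leftarrow> sample_on p x1 ?U;
      return_pmf (eval_shares p (Gate i k ts) v x2) }"
  proof (intro bind_pmf_cong refl arg_cong[where f = return_pmf])
    fix x1 x2 assume x2: "x2 \<in> set_pmf (sample_on p x1 ?U)"
    have x12: "x2 (VCoef i j) = x1 (VCoef i j)" for j
      by (rule sample_on_off[OF _ x2 off]) (simp add: finite_coefs)
    have "eval_shares p t (poly (gate_poly i k v x1) (int (index t)) mod int p) x2 =
        map (\<lambda>(a, l). l x2 mod int p) (lshares t (\<lambda>x. v + (\<Sum>j=1..<k. x (VCoef i j) * int (index t) ^ j)))" for t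
      unfolding eval_shares_def by (rule lshares_mod_cong) (simp add: poly_gate_poly x12)
    then show "?e x1 x2 = eval_shares p (Gate i k ts) v x2"
      by (simp add: eval_shares_def map_concat o_def)
  qed
  also have "\<dots> = map_pmf (eval_shares p (Gate i k ts) v) (sample_on p x (?C \<union> ?U))"
    using off by (subst sample_on_Un) (auto simp: finite_coefs map_pmf_def bind_assoc_pmf)
  finally show ?case by simp
next
  case (3 p q)
  then show ?case by simp
next
  case (4 p q t ts)
  let ?U = "\<Union>t\<in>set ts. coefs t"
  let ?v = "\<lambda>t. poly q (int (index t)) mod int p"
  let ?e = "\<lambda>x'. concat (map (\<lambda>t. eval_shares p t (?v t) x') ts)"
  have disj: "coefs t \<inter> ?U = {}"
  proof (rule ccontr)
    assume "coefs t \<inter> ?U \<noteq> {}"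
    then obtain u t' where u: "u \<in> coefs t" "u \<in> coefs t'" "t' \<in> set ts" by blast
    then obtain i where "i \<in> set (indices t)" "i \<in> set (indices t')"
      using coefs_indices[OF u(1)] coefs_indices[OF u(2)] by auto
    then show False using 4(4) u(3) by auto
  qed
  have "share_list p q (t # ts) = do { x1 \<leftarrow> sample_on p x (coefs t); ys \<leftarrow> share_list p q ts;
      return_pmf (eval_shares p t (?v t) x1 @ ys) }"
  proof -
    have "share p t (?v t) = map_pmf (eval_shares p t (?v t)) (sample_on p x (coefs t))"
      by (rule 4(1)) (use 4 in auto)
    then show ?thesis by (simp add: map_pmf_def bind_assoc_pmf bind_return_pmf)
  qed
  also have "\<dots> = do { x1 \<leftarrow> sample_on p x (coefs t); x2 \<leftarrow> sample_on p x1 ?U;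
      return_pmf (eval_shares p t (?v t) x1 @ ?e x2) }"
  proof (intro bind_pmf_cong refl)
    fix x1
    obtain xs where "xs \<in> set_pmf (share p t (?v t))" using set_pmf_not_empty[of "share p t (?v t)"] by blast
    then have "share_list p q ts = map_pmf ?e (sample_on p x1 ?U)"
      by (rule 4(2)) (use 4 in auto)
    then show "do { ys \<leftarrow> share_list p q ts; return_pmf (eval_shares p t (?v t) x1 @ ys) } =
      do { x2 \<leftarrow> sample_on p x1 ?U; return_pmf (eval_shares p t (?v t) x1 @ ?e x2) }"
      by (simp add: map_pmf_def bind_assoc_pmf bind_return_pmf)
  qed
  also have "\<dots> = do { x1 \<leftarrow> sample_on p x (coefs t); x2 \<leftarrow> sample_on p x1 ?U;
      return_pmf (eval_shares p t (?v t) x2 @ ?e x2) }"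
  proof (intro bind_pmf_cong refl arg_cong[where f = return_pmf] arg_cong[where f = "\<lambda>xs. xs @ _"])
    fix x1 x2 assume x2: "x2 \<in> set_pmf (sample_on p x1 ?U)"
    show "eval_shares p t (?v t) x1 = eval_shares p t (?v t) x2"
    proof (rule eval_shares_cong)
      fix u assume "u \<in> coefs t"
      then have "u \<notin> ?U" using disj by blast
      then show "x1 u = x2 u" using sample_on_off[OF _ x2, of u] by (simp add: finite_coefs)
    qed
  qed
  also have "\<dots> = map_pmf (\<lambda>x'. eval_shares p t (?v t) x' @ ?e x') (sample_on p x (coefs t \<union> ?U))"
    using disj by (subst sample_on_Un) (auto simp: finite_coefs map_pmf_def bind_assoc_pmf)
  finally show ?case by simp
qed

section \<open>Key generation and encryption after the substitutions\<close>

definition eval_key ::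
  "nat \<Rightarrow> int \<Rightarrow> nat \<Rightarrow> nat \<Rightarrow> attribute list \<Rightarrow> (var \<Rightarrow> int) \<Rightarrow> int dec_key" where
  "eval_key p c n k \<gamma> x = DecKey (modular_inverse (int p) c * (x VA + x (VR k)) mod int p) n
     (map (\<lambda>j. (j, (x VBeta * x (VR k) + x (VHash j) * x (VRJ k j)) mod int p, x (VRJ k j))) \<gamma>)"

context
  fixes p :: nat
  assumes p: "prime p"
begin

lemma coprime_if_not_dvd: "\<not> int p dvd c \<Longrightarrow> coprime c (int p)"
  using p prime_imp_coprime[of "int p" c] by (simp add: coprime_commute)

lemma modular_inverse_cong: "\<not> int p dvd c \<Longrightarrow> [c * modular_inverse (int p) c = 1] (mod int p)"
  by (intro cong_modular_inverse1 coprime_if_not_dvd)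

lemma div_Zp_eqI:
  assumes "\<not> int p dvd y" "[y * z = x] (mod int p)"
  shows "div_Zp p x y = z mod int p"
proof -
  have "[x * modular_inverse (int p) y = (y * z) * modular_inverse (int p) y] (mod int p)"
    by (intro cong_mult cong_sym[OF assms(2)] cong_refl)
  also have "(y * z) * modular_inverse (int p) y = z * (y * modular_inverse (int p) y)"
    by (simp add: mult_ac)
  also have "[\<dots> = z * 1] (mod int p)"
    by (intro cong_mult cong_refl modular_inverse_cong assms(1))
  finally show ?thesis by (simp add: div_Zp_def cong_def)
qed

lemma not_dvd_unit: "b \<in> {1..<int p} \<Longrightarrow> \<not> int p dvd b"
  using zdvd_not_zless by auto

lemma not_dvd_mult: "\<not> int p dvd c \<Longrightarrow> b \<in> {1..<int p} \<Longrightarrow> \<not> int p dvd c * b mod int p"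
  using not_dvd_unit[of b] p by (simp add: dvd_mod_iff prime_dvd_mult_iff)

text \<open>\<beta> cancels: a quotient of two versions of \<beta>, hence every update quantity,
  depends on the public factors only.\<close>

lemma div_Zp_ratio:
  assumes "\<not> int p dvd c'" "b \<in> {1..<int p}"
  shows "div_Zp p (c * b mod int p) (c' * b mod int p) = c * modular_inverse (int p) c' mod int p"
proof (rule div_Zp_eqI)
  show "\<not> int p dvd c' * b mod int p" by (rule not_dvd_mult[OF assms])
  have "[c' * b mod int p * (c * modular_inverse (int p) c') = c' * b * (c * modular_inverse (int p) c')] (mod int p)"
    by (intro cong_mult cong_refl) (simp add: cong_def)
  also have "c' * b * (c * modular_inverse (int p) c') = (c' * modular_inverse (int p) c') * (c * b)"
    by (simp add: mult_ac)
  also have "[\<dots> = 1 * (c * b)] (mod int p)"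
    by (intro cong_mult cong_refl modular_inverse_cong assms)
  finally show "[c' * b mod int p * (c * modular_inverse (int p) c') = c * b mod int p] (mod int p)"
    by (simp add: cong_def)
qed

text \<open>Justifies \<alpha> = \<beta> a and r = \<beta> r': multiplication by a unit permutes the
  residues.\<close>

lemma sample_Zp_mult:
  assumes "b \<in> {1..<int p}"
  shows "map_pmf (\<lambda>r. b * r mod int p) (sample_Zp p) = sample_Zp p"
  unfolding sample_Zp_def
proof (rule map_pmf_of_set_bij_betw)
  have p2: "p \<ge> 2" using p by (rule prime_ge_2_nat)
  have inj: "inj_on (\<lambda>r. b * r mod int p) (Zp p)"
  proof (rule inj_onI)
    fix r r' assume r: "r \<in> Zp p" "r' \<in> Zp p" "b * r mod int p = b * r' mod int p"
    then have "int p dvd b * (r - r')" by (simp add: mod_eq_dvd_iff right_diff_distrib)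
    then have "int p dvd r - r'" using not_dvd_unit[OF assms] p by (simp add: prime_dvd_mult_iff)
    then have "r mod int p = r' mod int p" by (simp add: mod_eq_dvd_iff)
    then show "r = r'" using r by simp
  qed
  moreover have "(\<lambda>r. b * r mod int p) ` Zp p = Zp p"
    using p2 by (intro endo_inj_surj inj) auto
  ultimately show "bij_betw (\<lambda>r. b * r mod int p) (Zp p) (Zp p)" by (simp add: bij_betw_def)
  show "Zp p \<noteq> {}" "finite (Zp p)" using p2 by auto
qed

text \<open>Justifies writing the next version of \<beta> as a uniform public unit times the fixed
  indeterminate \<beta>.\<close>

lemma sample_Zp_unit_mult:
  assumes "b \<in> {1..<int p}"
  shows "map_pmf (\<lambda>r. b * r mod int p) (sample_Zp_unit p) = sample_Zp_unit p"
  unfolding sample_Zp_unit_def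
  using prime_ge_2_nat[OF p] bij_betw_int_remainders_mult[OF coprime_if_not_dvd[OF not_dvd_unit[OF assms]]]
  by (intro map_pmf_of_set_bij_betw) auto

text \<open>With r = \<beta> r' the exponent of \<open>D\<close> becomes (a + r') / c, where 1 / c
  is a public scalar. The remaining components keep the product \<beta> r'.\<close>

lemma KeyGen_conv:
  fixes x :: "var \<Rightarrow> int" and V :: "var set"
  assumes "distinct \<gamma>" "\<And>j. VRJ k j \<notin> V" "x VBeta \<in> {1..<int p}" "\<not> int p dvd c"
  defines "A \<equiv> insert (VR k) (VRJ k ` set \<gamma> \<union> (VHash ` set \<gamma> - V))"
  shows "KeyGen p (MasterKey (c * x VBeta mod int p) (x VBeta * x VA mod int p) n) \<gamma> (table V x) =
    map_pmf (\<lambda>x'. (eval_key p c n k \<gamma> x',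
        table (V \<union> VHash ` set \<gamma>) x')) (sample_on p x A)"
proof -
  let ?B = "VRJ k ` set \<gamma> \<union> (VHash ` set \<gamma> - V)"
  let ?g = "\<lambda>x'. (eval_key p c n k \<gamma> x',
        table (V \<union> VHash ` set \<gamma>) x')"
  have D: "div_Zp p (x VBeta * x VA mod int p + x VBeta * r mod int p) (c * x VBeta mod int p) =
      modular_inverse (int p) c * (x VA + r) mod int p" for r
  proof -
    have "div_Zp p (x VBeta * x VA mod int p + x VBeta * r mod int p) (c * x VBeta mod int p) =
      div_Zp p ((x VA + r) * x VBeta mod int p) (c * x VBeta mod int p)"
    proof -
      have "(x VBeta * x VA mod int p + x VBeta * r mod int p) mod int p = ((x VA + r) * x VBeta mod int p) mod int p"
        by (simp add: mod_simps algebra_simps)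
      then show ?thesis unfolding div_Zp_def by (rule mod_mult_cong[OF _ refl])
    qed
    then show ?thesis by (simp only: div_Zp_ratio[OF assms(4,3)]) (simp add: mult.commute)
  qed
  have "KeyGen p (MasterKey (c * x VBeta mod int p) (x VBeta * x VA mod int p) n) \<gamma> (table V x) =
    do { r \<leftarrow> map_pmf (\<lambda>r. x VBeta * r mod int p) (sample_Zp p);
      (ds, tab) \<leftarrow> keygen_attrs p r \<gamma> (table V x);
      return_pmf (DecKey (div_Zp p (x VBeta * x VA mod int p + r) (c * x VBeta mod int p)) n ds, tab) }"
    by (simp add: KeyGen_def sample_Zp_mult[OF assms(3)])
  also have "\<dots> = do { r \<leftarrow> samp p (VR k);
      (ds, tab) \<leftarrow> keygen_attrs p (x VBeta * r mod int p) \<gamma> (table V (x(VR k := r)));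
      return_pmf (DecKey (modular_inverse (int p) c * (x VA + r) mod int p) n ds, tab) }"
  proof -
    have "table V (x(VR k := r)) = table V x" for r by (rule table_cong) simp
    then show ?thesis by (simp add: bind_map_pmf D samp_def)
  qed
  also have "\<dots> = do { r \<leftarrow> samp p (VR k); x' \<leftarrow> sample_on p (x(VR k := r)) ?B;
      return_pmf (DecKey (modular_inverse (int p) c * (x VA + r) mod int p) n
        (map (\<lambda>j. (j, (x VBeta * r mod int p + x' (VHash j) * x' (VRJ k j)) mod int p, x' (VRJ k j))) \<gamma>),
        table (V \<union> VHash ` set \<gamma>) x') }"
    unfolding keygen_attrs_conv[OF assms(1,2)]
    by (simp add: map_pmf_def bind_assoc_pmf bind_return_pmf)
  also have "\<dots> = do { r \<leftarrow> samp p (VR k); x' \<leftarrow> sample_on p (x(VR k := r)) ?B; return_pmf (?g x') }"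
  proof (intro bind_pmf_cong refl arg_cong[where f = return_pmf])
    fix r x' assume x': "x' \<in> set_pmf (sample_on p (x(VR k := r)) ?B)"
    have "x' VBeta = x VBeta" "x' VA = x VA" "x' (VR k) = r"
      using sample_on_off[OF _ x', of VBeta] sample_on_off[OF _ x', of VA] sample_on_off[OF _ x', of "VR k"]
      by auto
    then show "(DecKey (modular_inverse (int p) c * (x VA + r) mod int p) n
        (map (\<lambda>j. (j, (x VBeta * r mod int p + x' (VHash j) * x' (VRJ k j)) mod int p, x' (VRJ k j))) \<gamma>),
        table (V \<union> VHash ` set \<gamma>) x') = ?g x'"
      by (simp add: eval_key_def mod_simps)
  qed
  also have "\<dots> = map_pmf ?g (sample_on p x A)"
    unfolding A_def by (subst sample_on_insert) (auto simp: map_pmf_def bind_assoc_pmf)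
  finally show ?thesis .
qed

lemma Encrypt_conv:
  fixes x :: "var \<Rightarrow> int" and V :: "var set"
  assumes "wf_policy P"
  defines "A \<equiv> insert VS (coefs P \<union> (VHash ` set (leaves P) - V))"
  shows "Encrypt p M P (EncKey 1 (c * x VBeta mod int p) (x VBeta * x VA mod int p) n) (table V x) =
    map_pmf (\<lambda>x'. (Ciphertext P ((M + x' VBeta * x' VA * x' VS) mod int p) (c * (x' VBeta * x' VS) mod int p) n
        (map (\<lambda>(a, l). (l x' mod int p, x' (VHash a) * l x' mod int p)) (lshares P (\<lambda>x. x VS))),
        table (V \<union> VHash ` set (leaves P)) x')) (sample_on p x A)"
proof -
  have P: "distinct (indices P)" "thresholds_ok P" using assms(1) by (auto simp: wf_policy_def)
  have p2: "p \<ge> 2" using p by (rule prime_ge_2_nat)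
  let ?H = "VHash ` set (leaves P) - V"
  let ?g = "\<lambda>x'. (Ciphertext P ((M + x' VBeta * x' VA * x' VS) mod int p) (c * (x' VBeta * x' VS) mod int p) n
        (map (\<lambda>(a, l). (l x' mod int p, x' (VHash a) * l x' mod int p)) (lshares P (\<lambda>x. x VS))),
        table (V \<union> VHash ` set (leaves P)) x')"
  let ?h = "\<lambda>s x2 x3. (Ciphertext P ((M + (x VBeta * x VA mod int p) * s) mod int p) ((c * x VBeta mod int p) * s mod int p) n
        (map (\<lambda>(a, q). (1 * q mod int p, x3 (VHash a) * q mod int p)) (zip (leaves P) (eval_shares p P s x2))),
        table (V \<union> VHash ` set (leaves P)) x3)"
  have fst: "fst ` set (zip (leaves P) (eval_shares p P s x2)) = set (leaves P)" for s x2
  proof -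
    have "length (leaves P) = length (eval_shares p P s x2)"
      by (simp add: eval_shares_def flip: map_fst_lshares[of P "\<lambda>_. s"])
    then show ?thesis by (simp flip: set_map)
  qed
  have "Encrypt p M P (EncKey 1 (c * x VBeta mod int p) (x VBeta * x VA mod int p) n) (table V x) =
    do { s \<leftarrow> samp p VS; x2 \<leftarrow> sample_on p (x(VS := s)) (coefs P);
      (cs, tab) \<leftarrow> encrypt_leaves p 1 (zip (leaves P) (eval_shares p P s x2)) (table V x2);
      return_pmf (Ciphertext P ((M + (x VBeta * x VA mod int p) * s) mod int p) ((c * x VBeta mod int p) * s mod int p) n cs, tab) }"
  proof -
    have "share p P s = map_pmf (eval_shares p P s) (sample_on p (x(VS := s)) (coefs P))"
      if "s \<in> set_pmf (samp p VS)" for s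
      using that set_samp[OF p2, of VS] by (intro share_conv(1) p2 P) auto
    moreover have "table V x2 = table V x" if x2: "x2 \<in> set_pmf (sample_on p (x(VS := s)) (coefs P))" for s x2
    proof (rule table_cong)
      fix a
      have "VHash a \<notin> coefs P" using coefs_indices[of "VHash a" P] by blast
      then show "x2 (VHash a) = x (VHash a)" using sample_on_off[OF finite_coefs x2] by simp
    qed
    ultimately show ?thesis
      by (auto simp: Encrypt_def samp_def map_pmf_def bind_assoc_pmf bind_return_pmf intro!: bind_pmf_cong)
  qed
  also have "\<dots> = do { s \<leftarrow> samp p VS; x2 \<leftarrow> sample_on p (x(VS := s)) (coefs P); x3 \<leftarrow> sample_on p x2 ?H;
      return_pmf (?h s x2 x3) }"
    unfolding encrypt_leaves_conv fst by (simp add: map_pmf_def bind_assoc_pmf bind_return_pmf)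
  also have "\<dots> = do { s \<leftarrow> samp p VS; x2 \<leftarrow> sample_on p (x(VS := s)) (coefs P); x3 \<leftarrow> sample_on p x2 ?H;
      return_pmf (?g x3) }"
  proof (intro bind_pmf_cong refl arg_cong[where f = return_pmf])
    fix s x2 x3
    assume x2: "x2 \<in> set_pmf (sample_on p (x(VS := s)) (coefs P))" and x3: "x3 \<in> set_pmf (sample_on p x2 ?H)"
    have off: "x3 v = (x(VS := s)) v" if "v \<in> {VBeta, VA, VS}" for v
    proof -
      have "v \<notin> coefs P" "v \<notin> ?H" using coefs_indices[of v P] that by auto
      then show ?thesis using sample_on_off[OF finite_coefs x2] sample_on_off[OF _ x3] by auto
    qed
    have "eval_shares p P s x2 = eval_shares p P s x3"
    proof (rule eval_shares_cong)
      fix v assume "v \<in> coefs P"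
      then have "v \<notin> ?H" using coefs_indices[of v P] by auto
      then show "x2 v = x3 v" using sample_on_off[OF _ x3] by auto
    qed
    also have "\<dots> = map (\<lambda>(a, l). l x3 mod int p) (lshares P (\<lambda>x. x VS))"
      unfolding eval_shares_def by (rule lshares_mod_cong) (use off[of VS] in simp)
    finally have "zip (leaves P) (eval_shares p P s x2) = map (\<lambda>(a, l). (a, l x3 mod int p)) (lshares P (\<lambda>x. x VS))"
      by (simp add: zip_map_map zip_same_conv_map case_prod_unfold flip: map_fst_lshares[of P "\<lambda>x. x VS"])
    moreover have "(M + (x VBeta * x VA mod int p) * s) mod int p = (M + x VBeta * x VA * s) mod int p"
      by (metis mod_add_right_eq mod_mult_left_eq)
    ultimately show "?h s x2 x3 = ?g x3"
      using off[of VBeta] off[of VA] off[of VS]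
      by (simp add: case_prod_unfold mod_simps mult.assoc)
  qed
  also have "\<dots> = map_pmf ?g (sample_on p x A)"
  proof -
    have "coefs P \<inter> ?H = {}" "VS \<notin> coefs P" using coefs_indices[of _ P] by blast+
    then show ?thesis unfolding A_def
      by (subst sample_on_insert, simp add: finite_coefs, blast)
         (subst sample_on_Un, auto simp: finite_coefs map_pmf_def bind_assoc_pmf)
  qed
  finally show ?thesis .
qed

end

lemma rep_ok_extends: "rep_ok S i r \<Longrightarrow> extends S S' \<Longrightarrow> rep_ok S' i r"
  by (auto simp: rep_ok_def extends_def span0_extends span1_extends split: if_splits)

context generic_group
begin

section \<open>A single query\<close>

text \<open>The price of one elementary event: a new string is revealed (N collisions of probability
  at most 4 N / (p - 1) each), or an unknown string is submitted (1 / (p - 1)).\<close>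

definition delta :: real where
  "delta = (4 * real N * real N + 1) / real (p - 1)"

lemma delta_nonneg: "delta \<ge> 0"
  by (simp add: delta_def)

lemma le_delta: "real N * real N * (4 / real (p - 1)) \<le> delta" "1 / real (p - 1) \<le> delta"
  by (auto simp: delta_def divide_right_mono mult.commute)

text \<open>The elements of \<open>rs\<close> are named one after the other. An element equivalent
  to a known one has a name already and costs nothing; any other is named by
  \<open>reveal_new\<close> at the price \<open>delta\<close>. As the names are random, the last
  hypothesis has to cover all tables that may result.\<close>

lemma cover:
  assumes "wf_sym S" "\<And>i r. (i, r) \<in> set rs \<Longrightarrow> rep_ok S i r"
    and "card (dom (known S)) + length rs \<le> N" "card (vars S) \<le> N"
    and F: "\<And>x b \<psi>. F x b \<psi> \<le> 1"
    and "\<And>kn. wf_sym (S\<lparr>known := kn\<rparr>) \<Longrightarrow> known S \<subseteq>\<^sub>m kn \<Longrightarrow>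
      card (dom kn) \<le> card (dom (known S)) + length rs \<Longrightarrow>
      (\<And>i r. (i, r) \<in> set rs \<Longrightarrow> \<exists>e r'. kn (i, e) = Some r' \<and> eqv S r' r) \<Longrightarrow>
      R (S\<lparr>known := kn\<rparr>) F \<le> B"
  shows "R S F \<le> B + ennreal (real (length rs) * delta)"
  using assms(1-4,6)
proof (induction rs arbitrary: S)
  case Nil
  have "R (S\<lparr>known := known S\<rparr>) F \<le> B" by (rule Nil.prems(5)) (use Nil.prems(1) in auto)
  then show ?case by simp
next
  case (Cons ir rs)
  obtain i r where ir: "ir = (i, r)" by (cases ir)
  show ?case
  proof (cases "\<exists>e r'. known S (i, e) = Some r' \<and> eqv S r' r")
    case True
    have "R S F \<le> B + ennreal (real (length rs) * delta)"
    proof (rule Cons.IH)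
      fix kn
      assume kn: "wf_sym (S\<lparr>known := kn\<rparr>)" "known S \<subseteq>\<^sub>m kn"
        "card (dom kn) \<le> card (dom (known S)) + length rs"
        "\<And>i r. (i, r) \<in> set rs \<Longrightarrow> \<exists>e r'. kn (i, e) = Some r' \<and> eqv S r' r"
      from True obtain e r' where e: "known S (i, e) = Some r'" "eqv S r' r" by blast
      then have "kn (i, e) = Some r'" using kn(2) by (metis domI map_le_def)
      show "R (S\<lparr>known := kn\<rparr>) F \<le> B"
      proof (rule Cons.prems(5)[OF kn(1,2)])
        show "card (dom kn) \<le> card (dom (known S)) + length (ir # rs)" using kn(3) by simp
        fix j q assume jq: "(j, q) \<in> set (ir # rs)"
        show "\<exists>e r'. kn (j, e) = Some r' \<and> eqv S r' q"
        proof (cases "(j, q) = (i, r)")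
          case True
          then show ?thesis using \<open>kn (i, e) = Some r'\<close> e(2) by blast
        qed (use jq ir kn(4)[of j q] in auto)
      qed
    qed (use Cons.prems in auto)
    also have "\<dots> \<le> B + ennreal (real (length (ir # rs)) * delta)"
      using delta_nonneg by (intro add_left_mono ennreal_leI mult_right_mono) auto
    finally show ?thesis .
  next
    case False
    let ?S = "\<lambda>e. S\<lparr>known := (known S)((i, e) \<mapsto> r)\<rparr>"
    have r: "rep_ok S i r" using Cons.prems(2) by (simp add: ir)
    have fin: "finite (dom (known S))" by (rule wfD(2)[OF Cons.prems(1)])
    have N: "card (dom (known S)) \<le> N" using Cons.prems(3) by simp
    have step: "R (?S e) F \<le> B + ennreal (real (length rs) * delta)" if e: "e \<in> unused S i" for e
    proof (rule Cons.IH)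
      have new: "known S (i, e) = None" using e by (simp add: unused_def)
      show wfe: "wf_sym (?S e)"
        using r fin wfD(11)[OF Cons.prems(1)]
        by (intro wf_known[OF Cons.prems(1)]) (auto split: if_splits)
      show "rep_ok (?S e) i r" if "(i, r) \<in> set rs" for i r using Cons.prems(2) that by simp
      have dom: "card (dom (known (?S e))) \<le> card (dom (known S)) + 1"
        using fin by (simp add: card_insert_if)
      then show "card (dom (known (?S e))) + length rs \<le> N" using Cons.prems(3) by simp
      show "card (vars (?S e)) \<le> N" using Cons.prems(4) by simp
      fix kn
      assume kn: "wf_sym (?S e\<lparr>known := kn\<rparr>)" "known (?S e) \<subseteq>\<^sub>m kn"
        "card (dom kn) \<le> card (dom (known (?S e))) + length rs"
        "\<And>i r. (i, r) \<in> set rs \<Longrightarrow> \<exists>e' r'. kn (i, e') = Some r' \<and> eqv (?S e) r' r"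
      have "R (S\<lparr>known := kn\<rparr>) F \<le> B"
      proof (rule Cons.prems(5))
        show "wf_sym (S\<lparr>known := kn\<rparr>)" using kn(1) by simp
        show "known S \<subseteq>\<^sub>m kn"
          unfolding map_le_def
        proof
          fix k assume k: "k \<in> dom (known S)"
          then have "k \<noteq> (i, e)" using new by auto
          moreover have "k \<in> dom (known (?S e))" using k by simp
          ultimately have "known (?S e) k = kn k" using kn(2) unfolding map_le_def by blast
          then show "known S k = kn k" using \<open>k \<noteq> (i, e)\<close> by simp
        qed
        show "card (dom kn) \<le> card (dom (known S)) + length (ir # rs)" using kn(3) dom by simp
        have "kn (i, e) = Some r" using kn(2) by (auto simp: map_le_def)
        moreover have "eqv S r r" by (simp add: eqv_def)
        ultimately have named: "\<exists>e r'. kn (i, e) = Some r' \<and> eqv S r' r" by blast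
        fix j q assume jq: "(j, q) \<in> set (ir # rs)"
        show "\<exists>e r'. kn (j, e) = Some r' \<and> eqv S r' q"
        proof (cases "(j, q) = (i, r)")
          case True
          then show ?thesis using named by blast
        qed (use jq ir kn(4)[of j q] in auto)
      qed
      then show "R (?S e\<lparr>known := kn\<rparr>) F \<le> B" by simp
    qed
    have "R S F \<le> ennreal (real N * real N * (4 / real (p - 1))) + (\<integral>\<^sup>+e. R (?S e) F \<partial>pmf_of_set (unused S i))"
      using False by (intro reveal_new Cons.prems N r F) auto
    also have "\<dots> \<le> ennreal delta + (\<integral>\<^sup>+e. B + ennreal (real (length rs) * delta) \<partial>pmf_of_set (unused S i))"
      using unused_nonempty[OF Cons.prems(1) N] finite_unused
      by (intro add_mono ennreal_leI le_delta nn_integral_mono_AE AE_pmfI step) auto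
    also have "\<dots> = B + (ennreal delta + ennreal (real (length rs) * delta))"
      by (simp add: add_ac)
    also have "ennreal delta + ennreal (real (length rs) * delta) = ennreal (real (length (ir # rs)) * delta)"
      using delta_nonneg by (simp add: algebra_simps flip: ennreal_plus)
    finally show ?thesis .
  qed
qed

section \<open>Postponed sampling of the exponents and of the bit\<close>

lemma R_state_cong:
  assumes "vars S = vars S'" "known S = known S'" "msg S = msg S'"
  shows "R S = R S'"
proof -
  have "val S = val S'" using assms by (simp add: val_def comb_def fun_eq_iff)
  then have "compat S = compat S'" using assms by (simp add: compat_def fun_eq_iff)
  then show ?thesis by (intro HOL.ext) (simp only: R_eq inner_def assms(1))
qed

text \<open>Exponents drawn during a query can be counted as part of the prior: the elements known
  so far do not depend on them, so the set of compatible encodings is the same before and after the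
  draw.\<close>

lemma R_sample:
  assumes "wf_sym S" "finite A" "A \<inter> vars S = {}"
  shows "R S (\<lambda>x b \<psi>. \<integral>\<^sup>+x'. F x' b \<psi> \<partial>sample_on p x A) = R (S\<lparr>vars := vars S \<union> A\<rparr>) F"
proof -
  let ?S = "S\<lparr>vars := vars S \<union> A\<rparr>"
  have v: "val ?S = val S" by (simp add: val_def comb_def fun_eq_iff)
  have c: "compat ?S x' b = compat S x b" if x': "x' \<in> set_pmf (sample_on p x A)" for x x' b
  proof -
    have "val S x' b r = val S x b r" if "known S (i, e) = Some r" for i e r
    proof -
      have "comb S b r x' = comb S b r x"
        using assms(3) sample_on_off[OF assms(2) x']
        by (intro depD[OF comb_dep[OF assms(1) wfD(11)[OF assms(1) that]]]) blast
      then show ?thesis by (simp add: val_def)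
    qed
    then show ?thesis unfolding compat_def v by auto
  qed
  have "R S (\<lambda>x b \<psi>. \<integral>\<^sup>+x'. F x' b \<psi> \<partial>sample_on p x A) =
    (\<integral>\<^sup>+x. \<integral>\<^sup>+b. \<integral>\<^sup>+x'. inner ?S F x' b \<partial>sample_on p x A \<partial>bernoulli_pmf (1 / 2) \<partial>prior S)"
    unfolding R_eq
  proof (intro nn_integral_cong)
    fix x b
    have "(\<integral>\<^sup>+x'. inner ?S F x' b \<partial>sample_on p x A) =
      (\<integral>\<^sup>+x'. (if compat S x b = {} then 0 else \<integral>\<^sup>+\<psi>. F x' b \<psi> \<partial>pmf_of_set (compat S x b)) \<partial>sample_on p x A)"
      by (intro nn_integral_cong_AE AE_pmfI) (simp add: inner_def c)
    also have "\<dots> = inner S (\<lambda>x b \<psi>. \<integral>\<^sup>+x'. F x' b \<psi> \<partial>sample_on p x A) x b"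
      by (cases "compat S x b = {}")
         (simp_all add: inner_def nn_integral_pmf_commute[of "pmf_of_set (compat S x b)"])
    finally show "inner S (\<lambda>x b \<psi>. \<integral>\<^sup>+x'. F x' b \<psi> \<partial>sample_on p x A) x b =
      (\<integral>\<^sup>+x'. inner ?S F x' b \<partial>sample_on p x A)" by simp
  qed
  also have "\<dots> = (\<integral>\<^sup>+x. \<integral>\<^sup>+x'. \<integral>\<^sup>+b. inner ?S F x' b \<partial>bernoulli_pmf (1 / 2) \<partial>sample_on p x A \<partial>prior S)"
    by (intro nn_integral_cong nn_integral_pmf_commute)
  also have "\<dots> = R ?S F"
    using assms wfD(1)[OF assms(1)] by (simp add: R_eq sample_on_Un Int_commute del: nn_integral_bernoulli_pmf)
  finally show ?thesis .
qed

text \<open>Before the challenge no known element has a message coefficient, so compatibility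
  depends neither on the bit nor on the messages. The bit of the state is a dummy until now; it may
  be identified with the one drawn by the challenger, and the messages may be inserted
  afterwards.\<close>

lemma R_coin:
  assumes "wf_sym S" "pol S = None"
  shows "R S (\<lambda>x b \<psi>. \<integral>\<^sup>+b'. F x b' \<psi> \<partial>bernoulli_pmf (1 / 2)) = R (S\<lparr>msg := \<mu>\<rparr>) F"
proof -
  let ?S = "S\<lparr>msg := \<mu>\<rparr>"
  have c: "compat ?S x b' = compat S x b" for x b b'
  proof -
    have "val ?S x b' r = val S x b r" if "known S (i, e) = Some r" for i e r
    proof -
      have "fst r = 0" using wfD(11)[OF assms(1) that] assms(2) by (auto simp: rep_ok_def split: if_splits)
      then show ?thesis by (simp add: val_def comb_def)
    qed
    then show ?thesis unfolding compat_def by auto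
  qed
  have "inner S (\<lambda>x b \<psi>. \<integral>\<^sup>+b'. F x b' \<psi> \<partial>bernoulli_pmf (1 / 2)) x b =
      (\<integral>\<^sup>+b'. inner ?S F x b' \<partial>bernoulli_pmf (1 / 2))" for x b
  proof (cases "compat S x b = {}")
    case True
    then show ?thesis unfolding inner_def c[of x _ b] by simp
  next
    case False
    then show ?thesis unfolding inner_def c[of x _ b]
      by (simp only: if_False nn_integral_pmf_commute[of "pmf_of_set (compat S x b)"])
  qed
  then show ?thesis by (simp only: R_eq) (simp del: nn_integral_bernoulli_pmf)
qed

section \<open>The challenger reconstructed from state, exponents and bit\<close>

definition chal :: "sym \<Rightarrow> (var \<Rightarrow> int) \<Rightarrow> bool \<Rightarrow> challenger" where
  "chal S x b = \<lparr>
     ch_ek = EncKey 1 (cs S (ver S) * x VBeta mod int p) (x VBeta * x VA mod int p) (ver S),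
     ch_mk = MasterKey (cs S (ver S) * x VBeta mod int p) (x VBeta * x VA mod int p) (ver S),
     ch_updates = (\<lambda>i. if 1 \<le> i \<and> i \<le> ver S then
         \<lparr> u_cp = div_Zp p (cs S i * x VBeta mod int p) (cs S (i - 1) * x VBeta mod int p),
           u_ek = cs S i * x VBeta mod int p,
           u_dk = div_Zp p (cs S (i - 1) * x VBeta mod int p) (cs S i * x VBeta mod int p) \<rparr>
       else undefined),
     ch_hash = table (vars S) x,
     ch_queried = queried S,
     ch_challenge = map_option (\<lambda>P. (P, b)) (pol S) \<rparr>"

lemma chal_known [simp]: "chal (S\<lparr>known := kn\<rparr>) = chal S"
  by (simp add: chal_def fun_eq_iff)

lemma sample_support:
  assumes "wf_sym S" "x \<in> set_pmf (prior S)"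
  shows "x VBeta \<in> {1..<int p}"
  using set_sample_on(1)[OF wfD(1)[OF assms(1)] assms(2) wfD(3)[OF assms(1)]] set_samp[OF p_ge_2]
  by simp

text \<open>The right-hand sides contain neither x nor b, so update quantities can occur in a fixed
  reply.\<close>

lemma u_chal:
  assumes "wf_sym S" "x VBeta \<in> {1..<int p}" "i \<in> {v + 1..ver S}"
  shows "u_dk (ch_updates (chal S x b) i) = cs S (i - 1) * modular_inverse (int p) (cs S i) mod int p"
    and "u_cp (ch_updates (chal S x b) i) = cs S i * modular_inverse (int p) (cs S (i - 1)) mod int p"
  using assms(3) div_Zp_ratio[OF prime wfD(14)[OF assms(1)] assms(2)]
  by (simp_all add: chal_def)

lemma dlog_known:
  assumes "\<psi> \<in> compat S x b" "known S (i, w) = Some r"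
  shows "valid p (\<psi> i) w" "dlog p (\<psi> i) w = val S x b r"
proof -
  have z: "val S x b r \<in> Zp p" using p_ge_2 by (simp add: val_def)
  have w: "\<psi> i (val S x b r) = w" by (rule compatD(2)[OF assms])
  show "valid p (\<psi> i) w" unfolding valid_def using w z by blast
  have "inj_on (\<psi> i) (Zp p)" using compatD(1)[OF assms(1)] by (simp add: encodings_def)
  then show "dlog p (\<psi> i) w = val S x b r" unfolding dlog_def using w z by (metis inv_into_f_f)
qed

lemma encode_dlog: "valid p \<psi> w \<Longrightarrow> \<psi> (dlog p \<psi> w) = w"
  by (simp add: valid_def dlog_def f_inv_into_f)

definition radd :: "int \<times> fn \<Rightarrow> int \<times> fn \<Rightarrow> int \<times> fn" where
  "radd r r' = (fst r + fst r', \<lambda>x. snd r x + snd r' x)"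

definition rscale :: "int \<Rightarrow> int \<times> fn \<Rightarrow> int \<times> fn" where
  "rscale c r = (c * fst r, \<lambda>x. c * snd r x)"

text \<open>Only elements of \<open>G\<^sub>0\<close> are paired; they carry no message coefficient,
  so none arises in the product.\<close>

definition rmult :: "int \<times> fn \<Rightarrow> int \<times> fn \<Rightarrow> int \<times> fn" where
  "rmult r r' = (0, \<lambda>x. snd r x * snd r' x)"

lemma rep_ok_radd: "rep_ok S i r \<Longrightarrow> rep_ok S i r' \<Longrightarrow> rep_ok S i (radd r r')"
  by (auto simp: rep_ok_def radd_def intro: span0_add span1_add split: if_splits)

lemma rep_ok_rscale: "rep_ok S i r \<Longrightarrow> rep_ok S i (rscale c r)"
  by (auto simp: rep_ok_def rscale_def intro: span0_scale span1_scale split: if_splits)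

lemma rep_ok_rmult: "rep_ok S False r \<Longrightarrow> rep_ok S False r' \<Longrightarrow> rep_ok S True (rmult r r')"
  by (auto simp: rep_ok_def rmult_def intro: span0_mult)

lemma val_radd: "val S x b (radd r r') = (val S x b r + val S x b r') mod int p"
proof -
  have "comb S b (radd r r') x = comb S b r x + comb S b r' x"
    by (simp add: comb_def radd_def algebra_simps)
  then show ?thesis by (simp add: val_def mod_add_eq)
qed

lemma val_rscale: "val S x b (rscale c r) = val S x b r * c mod int p"
proof -
  have "comb S b (rscale c r) x = comb S b r x * c" by (simp add: comb_def rscale_def algebra_simps)
  then show ?thesis by (simp add: val_def mod_mult_left_eq)
qed

lemma val_rmult:
  "rep_ok S False r \<Longrightarrow> rep_ok S False r' \<Longrightarrow> val S x b (rmult r r') = val S x b r * val S x b r' mod int p"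
  by (simp add: val_def comb_def rmult_def rep_ok_def mod_simps)

end

section \<open>Symbolic answers to queries\<close>

definition size_of :: "sym \<Rightarrow> nat" where
  "size_of S = card (vars S) + card (dom (known S))"

context generic_group
begin

lemma chal_sel [simp]:
  "ch_ek (chal S x b) = EncKey 1 (cs S (ver S) * x VBeta mod int p) (x VBeta * x VA mod int p) (ver S)"
  "ch_mk (chal S x b) = MasterKey (cs S (ver S) * x VBeta mod int p) (x VBeta * x VA mod int p) (ver S)"
  "ch_hash (chal S x b) = table (vars S) x"
  "ch_queried (chal S x b) = queried S"
  "ch_challenge (chal S x b) = map_option (\<lambda>P. (P, b)) (pol S)"
  by (simp_all add: chal_def)

definition ans ::
  "(symbol list \<Rightarrow> (bool \<Rightarrow> int \<Rightarrow> enc) \<Rightarrow> challenger \<Rightarrow> ennreal) \<Rightarrow> query \<Rightarrow> sym \<Rightarrow>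
    (var \<Rightarrow> int) \<Rightarrow> bool \<Rightarrow> (bool \<Rightarrow> int \<Rightarrow> enc) \<Rightarrow> ennreal" where
  "ans H q S x b \<psi> =
     (\<integral>\<^sup>+z. H (word_of (fst z)) \<psi> (snd z) \<partial>answer p (\<psi> False) (\<psi> True) q (chal S x b))"

end

text \<open>H is the success probability of the rest of the run after a reply, and B bounds its
  expectation in every state to which the query may lead. The budget n limits both the growth of the
  state and, in units of \<open>delta\<close>, the error. This is the shape of one step of the
  induction on the running time.\<close>

locale query_step = generic_group +
  fixes H :: "symbol list \<Rightarrow> (bool \<Rightarrow> int \<Rightarrow> enc) \<Rightarrow> challenger \<Rightarrow> ennreal"
    and B :: ennreal and S :: sym and n :: nat
  assumes wf_sym: "wf_sym S" and size: "size_of S + n \<le> N" and H: "\<And>w \<psi> \<sigma>. H w \<psi> \<sigma> \<le> 1"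
    and continue: "\<And>S' w. wf_sym S' \<Longrightarrow> size_of S' \<le> size_of S + n \<Longrightarrow>
      R S' (\<lambda>x b \<psi>. H w \<psi> (chal S' x b)) \<le> B"
    and n: "1 \<le> n"
begin

abbreviation bound :: ennreal where
  "bound \<equiv> B + ennreal (real n * delta)"

lemma ans_le_1: "ans H q S' x b \<psi> \<le> 1"
proof -
  have "ans H q S' x b \<psi> \<le> (\<integral>\<^sup>+z. 1 \<partial>answer p (\<psi> False) (\<psi> True) q (chal S' x b))"
    unfolding ans_def by (intro nn_integral_mono H)
  then show ?thesis by simp
qed

lemma add_delta_mono: "k \<le> n \<Longrightarrow> B + ennreal (real k * delta) \<le> bound"
  using delta_nonneg by (intro add_left_mono ennreal_leI mult_right_mono) auto

lemma B_le: "B \<le> bound"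
  by simp

text \<open>The reply is a function of the names of finitely many elements. After
  \<open>cover\<close> has entered these names into the table, the reply is one and the same word in
  all remaining worlds, so \<open>continue\<close>, which speaks of fixed replies, applies.\<close>

lemma respond:
  fixes S1 :: sym
  assumes wf1: "wf_sym S1" and size1: "size_of S1 + length rs \<le> size_of S + n" and len: "length rs \<le> n"
    and rs: "\<And>i r. (i, r) \<in> set rs \<Longrightarrow> rep_ok S1 i r"
    and out: "\<And>x b \<psi> nm. x \<in> set_pmf (prior S1) \<Longrightarrow> \<psi> \<in> compat S1 x b \<Longrightarrow>
      (\<And>i r. (i, r) \<in> set rs \<Longrightarrow> \<psi> i (val S1 x b r) = nm i r) \<Longrightarrow> out x b \<psi> = sx nm"
  shows "R S1 (\<lambda>x b \<psi>. H (word_of (out x b \<psi>)) \<psi> (chal S1 x b)) \<le> bound"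
proof -
  let ?F = "\<lambda>x b \<psi>. H (word_of (out x b \<psi>)) \<psi> (chal S1 x b)"
  have "R S1 ?F \<le> B + ennreal (real (length rs) * delta)"
  proof (rule cover[OF wf1 rs])
    show "card (dom (known S1)) + length rs \<le> N" "card (vars S1) \<le> N"
      using size size1 by (auto simp: size_of_def)
    show "?F x b \<psi> \<le> 1" for x b \<psi> by (rule H)
    fix kn
    let ?S = "S1\<lparr>known := kn\<rparr>"
    assume kn: "wf_sym ?S" "known S1 \<subseteq>\<^sub>m kn" "card (dom kn) \<le> card (dom (known S1)) + length rs"
      and named: "\<And>i r. (i, r) \<in> set rs \<Longrightarrow> \<exists>e r'. kn (i, e) = Some r' \<and> eqv S1 r' r"
    from named have "\<forall>ir\<in>set rs. \<exists>e. \<exists>r'. kn (fst ir, e) = Some r' \<and> eqv S1 r' (snd ir)" by auto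
    from bchoice[OF this] obtain nm where
      nm: "\<forall>ir\<in>set rs. \<exists>r'. kn (fst ir, nm ir) = Some r' \<and> eqv S1 r' (snd ir)" by blast
    let ?sx = "sx (\<lambda>i r. nm (i, r))"
    have "R ?S ?F = R ?S (\<lambda>x b \<psi>. H (word_of ?sx) \<psi> (chal ?S x b))"
    proof (rule R_cong)
      fix x b \<psi>
      assume x: "x \<in> set_pmf (prior ?S)" and \<psi>: "\<psi> \<in> compat ?S x b"
      have v: "\<psi> i (val S1 x b r) = e" if "kn (i, e) = Some r" for i e r
        using compatD(2)[OF \<psi>, of i e r] that by simp
      have "\<psi> \<in> compat S1 x b"
        unfolding compat_def
      proof (intro CollectI conjI allI impI)
        show "\<psi> i \<in> encodings p m" for i by (rule compatD(1)[OF \<psi>])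
        show "\<psi> i (val S1 x b r) = e" if "known S1 (i, e) = Some r" for i e r
        proof (rule v)
          have "(i, e) \<in> dom (known S1)" using that by blast
          then show "kn (i, e) = Some r" using kn(2) that unfolding map_le_def by metis
        qed
      qed
      moreover have "\<psi> i (val S1 x b r) = nm (i, r)" if ir: "(i, r) \<in> set rs" for i r
      proof -
        from nm ir obtain r' where r': "kn (i, nm (i, r)) = Some r'" "eqv S1 r' r" by auto
        have "val S1 x b r' = val S1 x b r" using r'(2) unfolding eqv_def by blast
        then show ?thesis using v[OF r'(1)] by simp
      qed
      ultimately have "out x b \<psi> = ?sx" using x by (intro out) simp_all
      then show "?F x b \<psi> = H (word_of ?sx) \<psi> (chal ?S x b)" by simp
    qed
    also have "\<dots> \<le> B"
      using kn size1 by (intro continue) (auto simp: size_of_def)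
    finally show "R ?S ?F \<le> B" .
  qed
  also have "\<dots> \<le> bound" using len by (rule add_delta_mono)
  finally show ?thesis .
qed

lemma reject_le: "R S (\<lambda>x b \<psi>. H w \<psi> (chal S x b)) \<le> bound"
  using continue[OF wf_sym, of w] by (intro order_trans[OF _ B_le]) simp

text \<open>A query with a string that the state does not know may be treated as rejected, at the
  price of one lookup. Only queries about known strings remain.\<close>

lemma op_query:
  assumes F: "\<And>x b \<psi>. (\<exists>(i, w)\<in>W. \<not> valid p (\<psi> i) w) \<Longrightarrow> F x b \<psi> = H (word_of (Node [])) \<psi> (chal S x b)"
    and F1: "\<And>x b \<psi>. F x b \<psi> \<le> 1"
    and known: "(\<And>i w. (i, w) \<in> W \<Longrightarrow> \<exists>r. known S (i, w) = Some r) \<Longrightarrow> R S F \<le> bound"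
  shows "R S F \<le> bound"
proof (cases "\<forall>(i, w)\<in>W. known S (i, w) \<noteq> None")
  case True
  then show ?thesis by (intro known) auto
next
  case False
  then obtain i w where iw: "(i, w) \<in> W" "known S (i, w) = None" by blast
  have "R S F \<le> R S (\<lambda>x b \<psi>. H (word_of (Node [])) \<psi> (chal S x b)) + ennreal (1 / real (p - 1))"
  proof (rule lookup[OF wf_sym _ iw(2)])
    show "card (dom (known S)) \<le> N" using size by (simp add: size_of_def)
    show "F x b \<psi> \<le> indicator {\<psi>. valid p (\<psi> i) w} \<psi> + H (word_of (Node [])) \<psi> (chal S x b)" for x b \<psi>
    proof (cases "valid p (\<psi> i) w")
      case True
      have "F x b \<psi> \<le> 1 + H (word_of (Node [])) \<psi> (chal S x b)"
        using F1[of x b \<psi>] by (rule order_trans) simp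
      then show ?thesis using True by simp
    next
      case False
      then have "F x b \<psi> = H (word_of (Node [])) \<psi> (chal S x b)" using iw(1) by (intro F) blast
      then show ?thesis by simp
    qed
  qed
  also have "\<dots> \<le> bound"
  proof (rule add_mono)
    show "R S (\<lambda>x b \<psi>. H (word_of (Node [])) \<psi> (chal S x b)) \<le> B" using continue[OF wf_sym] by simp
    have "1 / real (p - 1) \<le> 1 * delta" using le_delta(2) by simp
    also have "\<dots> \<le> real n * delta" using n delta_nonneg by (intro mult_right_mono) auto
    finally show "ennreal (1 / real (p - 1)) \<le> ennreal (real n * delta)" by (rule ennreal_leI)
  qed
  finally show ?thesis .
qed

lemma rep_ok_known: "known S (i, w) = Some r \<Longrightarrow> rep_ok S i r"
  using wfD(11)[OF wf_sym] .

lemma ans_reject: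
  "answer p (\<psi> False) (\<psi> True) q (chal S x b) = reject (chal S x b) \<Longrightarrow>
    ans H q S x b \<psi> = H (word_of (Node [])) \<psi> (chal S x b)"
  by (simp add: ans_def reject_def)

lemma reject_query:
  assumes "\<And>x b \<psi>. answer p (\<psi> False) (\<psi> True) q (chal S x b) = reject (chal S x b)"
  shows "R S (ans H q S) \<le> bound"
proof -
  have "R S (ans H q S) = R S (\<lambda>x b \<psi>. H (word_of (Node [])) \<psi> (chal S x b))"
    using assms by (intro R_cong ans_reject)
  then show ?thesis using reject_le by simp
qed

text \<open>g performs on representations what f does on exponents. Inversion is included by taking
  v = w.\<close>

lemma binary_op:
  assumes q: "\<And>\<psi> \<sigma>. answer p (\<psi> False) (\<psi> True) q \<sigma> =
      (if valid p (\<psi> i) v \<and> valid p (\<psi> i) w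
       then return_pmf (Atom (\<psi> j (f (dlog p (\<psi> i) v) (dlog p (\<psi> i) w) mod int p)), \<sigma>) else reject \<sigma>)"
    and ok: "\<And>r r'. rep_ok S i r \<Longrightarrow> rep_ok S i r' \<Longrightarrow> rep_ok S j (g r r')"
    and val: "\<And>x b r r'. rep_ok S i r \<Longrightarrow> rep_ok S i r' \<Longrightarrow>
      val S x b (g r r') = f (val S x b r) (val S x b r') mod int p"
  shows "R S (ans H q S) \<le> bound"
proof (rule op_query[where W = "{(i, v), (i, w)}"])
  show "ans H q S x b \<psi> = H (word_of (Node [])) \<psi> (chal S x b)"
    if "\<exists>(i, w)\<in>{(i, v), (i, w)}. \<not> valid p (\<psi> i) w" for x b \<psi>
    using that by (intro ans_reject) (auto simp: q)
  assume K: "\<And>j u. (j, u) \<in> {(i, v), (i, w)} \<Longrightarrow> \<exists>r. known S (j, u) = Some r"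
  obtain r r' where r: "known S (i, v) = Some r" "known S (i, w) = Some r'"
    using K[of i v] K[of i w] by auto
  have "R S (ans H q S) = R S (\<lambda>x b \<psi>. H (word_of (Atom (\<psi> j (val S x b (g r r'))))) \<psi> (chal S x b))"
  proof (rule R_cong)
    fix x b \<psi> assume \<psi>: "\<psi> \<in> compat S x b"
    show "ans H q S x b \<psi> = H (word_of (Atom (\<psi> j (val S x b (g r r'))))) \<psi> (chal S x b)"
      using dlog_known[OF \<psi> r(1)] dlog_known[OF \<psi> r(2)] val[OF r[THEN rep_ok_known]]
      by (simp add: ans_def q)
  qed
  also have "\<dots> \<le> bound"
    by (rule respond[OF wf_sym, where rs = "[(j, g r r')]" and sx = "\<lambda>nm. Atom (nm j (g r r'))"])
       (use n ok[OF r[THEN rep_ok_known]] in auto)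
  finally show "R S (ans H q S) \<le> bound" .
qed (rule ans_le_1)

lemma Mult0_le: "R S (ans H (Mult0 v w) S) \<le> bound"
  by (rule binary_op[where i = False and j = False and v = v and w = w and f = "(+)" and g = radd])
     (simp_all add: rep_ok_radd val_radd)

lemma Mult1_le: "R S (ans H (Mult1 v w) S) \<le> bound"
  by (rule binary_op[where i = True and j = True and v = v and w = w and f = "(+)" and g = radd])
     (simp_all add: rep_ok_radd val_radd)

lemma Pairing_le: "R S (ans H (Pairing v w) S) \<le> bound"
  by (rule binary_op[where i = False and j = True and v = v and w = w and f = "(*)" and g = rmult])
     (simp_all add: rep_ok_rmult val_rmult)

lemma Inv0_le: "R S (ans H (Inv0 v) S) \<le> bound"
  by (rule binary_op[where i = False and j = False and v = v and w = v and f = "\<lambda>a _. - a" and g = "\<lambda>r _. rscale (-1) r"])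
     (simp_all add: rep_ok_rscale val_rscale)

lemma Inv1_le: "R S (ans H (Inv1 v) S) \<le> bound"
  by (rule binary_op[where i = True and j = True and v = v and w = v and f = "\<lambda>a _. - a" and g = "\<lambda>r _. rscale (-1) r"])
     (simp_all add: rep_ok_rscale val_rscale)

lemma Update_Dec_Key_le: "R S (ans H (Update_Dec_Key dk) S) \<le> bound"
proof (cases "dk_version dk < ver S \<and> distinct (map fst (dk_attrs dk))")
  case False
  then show ?thesis by (intro reject_query) (auto simp: Let_def)
next
  case True
  obtain d v ds where dk: "dk = DecKey d v ds" by (cases dk)
  define U where "U = (\<Prod>i\<in>{v + 1..ver S}. cs S (i - 1) * modular_inverse (int p) (cs S i) mod int p)"
  show ?thesis
  proof (rule op_query[where W = "Pair False ` set_dec_key dk"])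
    show "ans H (Update_Dec_Key dk) S x b \<psi> = H (word_of (Node [])) \<psi> (chal S x b)"
      if "\<exists>(i, w)\<in>Pair False ` set_dec_key dk. \<not> valid p (\<psi> i) w" for x b \<psi>
      using that by (intro ans_reject) (auto simp: Let_def)
    assume K: "\<And>j u. (j, u) \<in> Pair False ` set_dec_key dk \<Longrightarrow> \<exists>r. known S (j, u) = Some r"
    obtain r where r: "known S (False, d) = Some r" using K[of False d] dk by auto
    let ?out = "\<lambda>x b \<psi>. sexp_dec_key (DecKey (\<psi> False (val S x b (rscale U r))) (ver S) ds)"
    have "R S (ans H (Update_Dec_Key dk) S) = R S (\<lambda>x b \<psi>. H (word_of (?out x b \<psi>)) \<psi> (chal S x b))"
    proof (rule R_cong)
      fix x b \<psi> assume x: "x \<in> set_pmf (prior S)" and \<psi>: "\<psi> \<in> compat S x b"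
      have valid: "valid p (\<psi> False) w" if "w \<in> set_dec_key dk" for w
        using K[of False w] that dlog_known[OF \<psi>] by auto
      have "(\<Prod>i\<in>{v + 1..ver S}. u_dk (ch_updates (chal S x b) i)) = U"
        unfolding U_def by (intro prod.cong refl u_chal(1)[where v = v] wf_sym sample_support[OF wf_sym x])
      \<comment> \<open>The other components are decoded and encoded again, which returns the
        submitted strings, so only the new \<open>D\<close> has to be revealed.\<close>
      moreover have "map (map_prod id (map_prod (\<psi> False) (\<psi> False)) \<circ> map_prod id (map_prod (dlog p (\<psi> False)) (dlog p (\<psi> False)))) ds = ds"
      proof (rule map_idI)
        fix z assume z: "z \<in> set ds"
        obtain j y y' where jy: "z = (j, y, y')" by (cases z)
        have "y \<in> set_dec_key dk" "y' \<in> set_dec_key dk" using z jy dk by force+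
        then show "(map_prod id (map_prod (\<psi> False) (\<psi> False)) \<circ> map_prod id (map_prod (dlog p (\<psi> False)) (dlog p (\<psi> False)))) z = z"
          using valid encode_dlog jy by simp
      qed
      ultimately have "map_dec_key (\<psi> False) (UpdateDK p (ch_updates (chal S x b)) (ver S) (map_dec_key (dlog p (\<psi> False)) dk)) =
        DecKey (\<psi> False (val S x b (rscale U r))) (ver S) ds"
        using dlog_known[OF \<psi> r] by (simp add: dk UpdateDK_def val_rscale)
      then show "ans H (Update_Dec_Key dk) S x b \<psi> = H (word_of (?out x b \<psi>)) \<psi> (chal S x b)"
        using valid True by (simp add: ans_def Let_def)
    qed
    also have "\<dots> \<le> bound"
      by (rule respond[OF wf_sym, where rs = "[(False, rscale U r)]" and
            sx = "\<lambda>nm. sexp_dec_key (DecKey (nm False (rscale U r)) (ver S) ds)"])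
         (use n rep_ok_rscale[OF rep_ok_known[OF r]] in auto)
    finally show "R S (ans H (Update_Dec_Key dk) S) \<le> bound" .
  qed (rule ans_le_1)
qed

lemma Update_Ciphertext_le: "R S (ans H (Update_Ciphertext cp) S) \<le> bound"
proof (cases "cp_version cp < ver S \<and> wf_policy (cp_policy cp) \<and> length (cp_leaves cp) = length (leaves (cp_policy cp))")
  case False
  then show ?thesis by (intro reject_query) (auto simp: Let_def)
next
  case True
  obtain P ct d v ds where cp: "cp = Ciphertext P ct d v ds" by (cases cp)
  define U where "U = (\<Prod>i\<in>{v + 1..ver S}. cs S i * modular_inverse (int p) (cs S (i - 1)) mod int p)"
  show ?thesis
  proof (rule op_query[where W = "Pair False ` set1_ciphertext cp \<union> Pair True ` set2_ciphertext cp"])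
    show "ans H (Update_Ciphertext cp) S x b \<psi> = H (word_of (Node [])) \<psi> (chal S x b)"
      if "\<exists>(i, w)\<in>Pair False ` set1_ciphertext cp \<union> Pair True ` set2_ciphertext cp. \<not> valid p (\<psi> i) w" for x b \<psi>
      using that by (intro ans_reject) (auto simp: Let_def)
    assume K: "\<And>j u. (j, u) \<in> Pair False ` set1_ciphertext cp \<union> Pair True ` set2_ciphertext cp \<Longrightarrow> \<exists>r. known S (j, u) = Some r"
    obtain r where r: "known S (False, d) = Some r" using K[of False d] cp by auto
    let ?out = "\<lambda>x b \<psi>. sexp_ciphertext (Ciphertext P ct (\<psi> False (val S x b (rscale U r))) (ver S) ds)"
    have "R S (ans H (Update_Ciphertext cp) S) = R S (\<lambda>x b \<psi>. H (word_of (?out x b \<psi>)) \<psi> (chal S x b))"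
    proof (rule R_cong)
      fix x b \<psi> assume x: "x \<in> set_pmf (prior S)" and \<psi>: "\<psi> \<in> compat S x b"
      have valid: "valid p (\<psi> False) w" if "w \<in> set1_ciphertext cp" for w
        using K[of False w] that dlog_known[OF \<psi>] by auto
      have valid': "valid p (\<psi> True) w" if "w \<in> set2_ciphertext cp" for w
        using K[of True w] that dlog_known[OF \<psi>] by auto
      have "(\<Prod>i\<in>{v + 1..ver S}. u_cp (ch_updates (chal S x b) i)) = U"
        unfolding U_def by (intro prod.cong refl u_chal(2)[where v = v] wf_sym sample_support[OF wf_sym x])
      moreover have "map (map_prod (\<psi> False) (\<psi> False) \<circ> map_prod (dlog p (\<psi> False)) (dlog p (\<psi> False))) ds = ds"
      proof (rule map_idI)
        fix z assume z: "z \<in> set ds"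
        obtain y y' where jy: "z = (y, y')" by (cases z)
        have "y \<in> set1_ciphertext cp" "y' \<in> set1_ciphertext cp" using z jy cp by force+
        then show "(map_prod (\<psi> False) (\<psi> False) \<circ> map_prod (dlog p (\<psi> False)) (dlog p (\<psi> False))) z = z"
          using valid encode_dlog jy by simp
      qed
      moreover have "\<psi> True (dlog p (\<psi> True) ct) = ct" using valid'[of ct] encode_dlog cp by simp
      ultimately have "map_ciphertext (\<psi> False) (\<psi> True) (UpdateCP p (ch_updates (chal S x b)) (ver S)
          (map_ciphertext (dlog p (\<psi> False)) (dlog p (\<psi> True)) cp)) =
        Ciphertext P ct (\<psi> False (val S x b (rscale U r))) (ver S) ds"
        using dlog_known[OF \<psi> r] by (simp add: cp UpdateCP_def val_rscale)
      then show "ans H (Update_Ciphertext cp) S x b \<psi> = H (word_of (?out x b \<psi>)) \<psi> (chal S x b)"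
        using valid valid' True by (simp add: ans_def Let_def)
    qed
    also have "\<dots> \<le> bound"
      by (rule respond[OF wf_sym, where rs = "[(False, rscale U r)]" and
            sx = "\<lambda>nm. sexp_ciphertext (Ciphertext P ct (nm False (rscale U r)) (ver S) ds)"])
         (use n rep_ok_rscale[OF rep_ok_known[OF r]] in auto)
    finally show "R S (ans H (Update_Ciphertext cp) S) \<le> bound" .
  qed (rule ans_le_1)
qed

end

section \<open>Sizes of policies and the states reached by queries\<close>

lemma satisfies_empty: "thresholds_ok P \<Longrightarrow> \<not> satisfies {} P"
proof (induction P rule: thresholds_ok.induct)
  case (2 i k ts)
  then have "filter (satisfies {}) ts = []" by (auto simp: filter_empty_conv)
  with 2 show ?case by simp
qed simp

text \<open>Every child subtree has one node to spare, which pays for one coefficient of its gate;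
  the gate needs k - 1 of them and has at least k children.\<close>

lemma card_coefs: "thresholds_ok P \<Longrightarrow> card (coefs P) + 1 \<le> length (indices P)"
proof (induction P rule: thresholds_ok.induct)
  case (2 i k ts)
  have "card (coefs (Gate i k ts)) \<le> card (VCoef i ` {1..<k}) + card (\<Union>t\<in>set ts. coefs t)"
    unfolding coefs.simps by (rule card_Un_le)
  also have "card (VCoef i ` {1..<k}) \<le> k - 1" using card_image_le[of "{1..<k}" "VCoef i"] by simp
  also have "card (\<Union>t\<in>set ts. coefs t) \<le> (\<Sum>t\<leftarrow>ts. card (coefs t))"
  proof (induction ts)
    case (Cons t ts)
    then show ?case using card_Un_le[of "coefs t" "\<Union>t\<in>set ts. coefs t"] by simp
  qed simp
  finally have "card (coefs (Gate i k ts)) \<le> (k - 1) + (\<Sum>t\<leftarrow>ts. card (coefs t))" by simp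
  moreover have "(\<Sum>t\<leftarrow>ts. card (coefs t)) + length ts \<le> (\<Sum>t\<leftarrow>ts. length (indices t))"
  proof -
    have "(\<Sum>t\<leftarrow>ts. card (coefs t) + 1) \<le> (\<Sum>t\<leftarrow>ts. length (indices t))"
      using 2 by (intro sum_list_mono) auto
    then show ?thesis by (simp add: sum_list_Suc)
  qed
  moreover have "length (indices (Gate i k ts)) = Suc (\<Sum>t\<leftarrow>ts. length (indices t))"
    by (simp add: length_concat o_def)
  moreover have "1 \<le> k" "k \<le> length ts" using 2(2) by simp_all
  ultimately show ?case by linarith
qed simp

lemma length_leaves_le: "length (leaves P) \<le> length (indices P)"
proof (induction P rule: leaves.induct)
  case (2 i k ts)
  have "(\<Sum>t\<leftarrow>ts. length (leaves t)) \<le> (\<Sum>t\<leftarrow>ts. length (indices t))"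
    using 2 by (intro sum_list_mono) auto
  then show ?case by (simp add: length_concat o_def)
qed simp

context generic_group
begin

lemma val_fn: "val S x b (0, f) = f x mod int p"
  by (simp add: val_def comb_def)

lemma sample_Zp_support:
  assumes "wf_sym S" "x \<in> set_pmf (prior S)" "v \<in> vars S"
  shows "x v mod int p = x v"
  using set_sample_on(1)[OF wfD(1)[OF assms(1)] assms(2,3)] set_samp[OF p_ge_2, of v]
  by (auto split: if_splits)

lemma chal_update:
  assumes "x' VBeta = x VBeta" "x' VA = x VA" "cs S' = cs S" "ver S' = ver S"
  shows "chal S' x' b = (chal S x b)\<lparr>ch_hash := table (vars S') x', ch_queried := queried S',
    ch_challenge := map_option (\<lambda>P. (P, b)) (pol S')\<rparr>"
  using assms by (simp add: chal_def cong: if_cong)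

lemma wf_sym_modify:
  assumes "wf_sym S" and e: "extends S S'"
    and eq: "known S' = known S" "nkeys S' = nkeys S" "queried S' = queried S" "vars S' = vars S \<union> A"
    and A: "finite A" "\<And>k. VR k \<notin> A" "\<And>k j. VRJ k j \<notin> A"
    and "\<And>b. span1 S (msg S' b)" "\<And>i. \<not> int p dvd cs S' i" "pol_ok S'"
  shows "wf_sym S'"
proof (rule wfI)
  note w = wfD[OF assms(1)]
  have K: "kattrs S' k = kattrs S k" if "k < nkeys S" for k using e that by (simp add: extends_def)
  show "rep_ok S' i r" if "known S' (i, e') = Some r" for i e' r
    using rep_ok_extends[OF w(11) e] that eq(1) by simp
  show "span1 S' (msg S' b)" for b using span1_extends[OF assms(10) e] .
  show "VR k \<in> vars S' \<Longrightarrow> k < nkeys S'" for k using w(5)[of k] eq A(2) by simp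
  show "VRJ k j \<in> vars S' \<Longrightarrow> k < nkeys S'" for k j using w(6)[of k j] eq A(3) by simp
  show "k < nkeys S' \<Longrightarrow> VR k \<in> vars S'" for k using w(7) eq by simp
  show "k < nkeys S' \<Longrightarrow> finite (kattrs S' k)" for k using w(8) K eq by simp
  show "k < nkeys S' \<Longrightarrow> j \<in> kattrs S' k \<Longrightarrow> VHash j \<in> vars S'" for k j using w(9) K eq by simp
  show "k < nkeys S' \<Longrightarrow> j \<in> kattrs S' k \<Longrightarrow> VRJ k j \<in> vars S'" for k j using w(10) K eq by simp
  show "k < nkeys S' \<Longrightarrow> kattrs S' k = {} \<or> kattrs S' k \<in> queried S'" for k using w(13) K eq by simp
qed (use wfD(1-4)[OF assms(1)] eq A(1) assms(11,12) in simp_all)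

lemma wf_new_hash:
  assumes "wf_sym S"
  shows "wf_sym (S\<lparr>vars := insert (VHash a) (vars S)\<rparr>)" (is "wf_sym ?S")
proof (rule wf_sym_modify[OF assms, where A = "{VHash a}"])
  show "pol_ok ?S" using wfD(15)[OF assms] by (cases "pol S") (auto simp: pol_ok_def)
qed (use wfD(12,14)[OF assms] in \<open>auto simp: extends_def\<close>)

text \<open>For a query of the \<open>D\<close> field, K is empty while \<gamma> need not be: the
  hash values are drawn all the same and change the oracle, but no component that belongs to an
  attribute is revealed.\<close>

definition new_key :: "attribute list \<Rightarrow> attribute set \<Rightarrow> attribute set set \<Rightarrow> sym \<Rightarrow> sym" where
  "new_key \<gamma> K Q S = S\<lparr>
     vars := vars S \<union> insert (VR (nkeys S)) (VRJ (nkeys S) ` set \<gamma> \<union> (VHash ` set \<gamma> - vars S)),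
     nkeys := Suc (nkeys S), kattrs := (kattrs S)(nkeys S := K), queried := Q\<rparr>"

lemma wf_new_key:
  assumes "wf_sym S" "K \<subseteq> set \<gamma>" "K = {} \<or> K \<in> Q" "queried S \<subseteq> Q"
    and "\<And>P. pol S = Some P \<Longrightarrow> \<not> satisfies K P"
  shows "wf_sym (new_key \<gamma> K Q S)" (is "wf_sym ?S")
proof (rule wfI)
  note d = new_key_def
  have e: "extends S ?S" by (auto simp: extends_def d)
  show "rep_ok ?S i r" if "known ?S (i, w) = Some r" for i w r
    using rep_ok_extends[OF wfD(11)[OF assms(1)] e] that by (simp add: d)
  show "span1 ?S (msg ?S b)" for b using span1_extends[OF wfD(12)[OF assms(1)] e] by (simp add: d)
  show "pol_ok ?S"
    using wfD(15)[OF assms(1)] assms(5) by (cases "pol S") (auto simp: pol_ok_def d less_Suc_eq)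
  show "VR k \<in> vars ?S \<Longrightarrow> k < nkeys ?S" for k using wfD(5)[OF assms(1), of k] by (auto simp: d)
  show "VRJ k j \<in> vars ?S \<Longrightarrow> k < nkeys ?S" for k j using wfD(6)[OF assms(1), of k j] by (auto simp: d)
  show "k < nkeys ?S \<Longrightarrow> VR k \<in> vars ?S" for k using wfD(7)[OF assms(1), of k] by (auto simp: d less_Suc_eq)
  show "k < nkeys ?S \<Longrightarrow> finite (kattrs ?S k)" for k
    using wfD(8)[OF assms(1), of k] finite_subset[OF assms(2)] by (auto simp: d less_Suc_eq)
  show "k < nkeys ?S \<Longrightarrow> j \<in> kattrs ?S k \<Longrightarrow> VHash j \<in> vars ?S" for k j
    using wfD(9)[OF assms(1), of k j] assms(2) by (cases "k = nkeys S") (auto simp: d)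
  show "k < nkeys ?S \<Longrightarrow> j \<in> kattrs ?S k \<Longrightarrow> VRJ k j \<in> vars ?S" for k j
    using wfD(10)[OF assms(1), of k j] assms(2) by (cases "k = nkeys S") (auto simp: d)
  show "k < nkeys ?S \<Longrightarrow> kattrs ?S k = {} \<or> kattrs ?S k \<in> queried ?S" for k
    using wfD(13)[OF assms(1), of k] assms(3,4) by (cases "k = nkeys S") (auto simp: d)
  show "\<not> int p dvd cs ?S n" for n using wfD(14)[OF assms(1)] by (simp add: d)
qed (use wfD(1-4)[OF assms(1)] in \<open>simp_all add: new_key_def\<close>)

text \<open>The indeterminate \<beta> stays the same; a new version is merely a new public
  factor.\<close>

definition new_version :: "int \<Rightarrow> sym \<Rightarrow> sym" where
  "new_version c S = S\<lparr>ver := Suc (ver S), cs := (cs S)(Suc (ver S) := c)\<rparr>"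

lemma wf_new_version:
  assumes "wf_sym S" "\<not> int p dvd c"
  shows "wf_sym (new_version c S)"
proof (rule wf_sym_modify[OF assms(1), where A = "{}"])
  show "pol_ok (new_version c S)"
    using wfD(15)[OF assms(1)] by (cases "pol S") (auto simp: pol_ok_def new_version_def)
qed (use wfD(12,14)[OF assms(1)] assms(2) in \<open>auto simp: extends_def new_version_def\<close>)

definition new_challenge :: "policy \<Rightarrow> fn \<Rightarrow> fn \<Rightarrow> sym \<Rightarrow> sym" where
  "new_challenge P f0 f1 S = S\<lparr>
     vars := vars S \<union> insert VS (coefs P \<union> (VHash ` set (leaves P) - vars S)),
     msg := (\<lambda>b. if b then f1 else f0), pol := Some P\<rparr>"

lemma wf_new_msg:
  assumes "wf_sym S" "span1 S f0" "span1 S f1"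
  shows "wf_sym (S\<lparr>msg := \<lambda>b. if b then f1 else f0\<rparr>)" (is "wf_sym ?S")
proof (rule wf_sym_modify[OF assms(1), where A = "{}"])
  show "pol_ok ?S" using wfD(15)[OF assms(1)] by (cases "pol S") (auto simp: pol_ok_def)
qed (use wfD(14)[OF assms(1)] assms in \<open>auto simp: extends_def\<close>)

lemma wf_new_challenge:
  assumes "wf_sym S" "pol S = None" "span1 S f0" "span1 S f1" "wf_policy P" "length (indices P) < p"
    and "\<forall>\<gamma>\<in>queried S. \<not> satisfies \<gamma> P"
  shows "wf_sym (new_challenge P f0 f1 S)" (is "wf_sym ?S")
proof (rule wf_sym_modify[OF assms(1), where A = "insert VS (coefs P \<union> (VHash ` set (leaves P) - vars S))"])
  \<comment> \<open>A key of which only \<open>D\<close> is known has no recorded attributes, and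
    the empty set satisfies no policy. So queries of the \<open>D\<close> field may be made for any
    attribute set.\<close>
  have "\<not> satisfies (kattrs S k) P" if "k < nkeys S" for k
    using wfD(13)[OF assms(1) that] assms(5,7) satisfies_empty by (auto simp: wf_policy_def)
  then show "pol_ok ?S" using assms(5,6) by (auto simp: pol_ok_def new_challenge_def)
  show "VR k \<notin> insert VS (coefs P \<union> (VHash ` set (leaves P) - vars S))"
    "VRJ k j \<notin> insert VS (coefs P \<union> (VHash ` set (leaves P) - vars S))" for k j
    using coefs_indices[of _ P] by blast+
qed (use wfD(14)[OF assms(1)] assms(2-4) in \<open>auto simp: extends_def new_challenge_def finite_coefs\<close>)

end

context query_step
begin

text \<open>Fresh indeterminates first join the prior, then the reply is read off the enlarged
  state. \<open>S0\<close> may differ from S because the challenge inserts its messages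
  beforehand.\<close>

lemma sample_respond:
  fixes S0 S2 :: sym
  assumes "wf_sym S0" "finite A" "A \<inter> vars S0 = {}"
    and S2: "wf_sym S2" "vars S2 = vars S0 \<union> A" "known S2 = known S0" "msg S2 = msg S0"
    and "size_of S2 + length rs \<le> size_of S + n" "length rs \<le> n"
    and "\<And>i r. (i, r) \<in> set rs \<Longrightarrow> rep_ok S2 i r"
    and "\<And>x b \<psi> nm. x \<in> set_pmf (prior S2) \<Longrightarrow> \<psi> \<in> compat S2 x b \<Longrightarrow>
      (\<And>i r. (i, r) \<in> set rs \<Longrightarrow> \<psi> i (val S2 x b r) = nm i r) \<Longrightarrow> out x b \<psi> = sx nm"
    and F: "\<And>x b \<psi>. x \<in> set_pmf (prior S0) \<Longrightarrow> \<psi> \<in> compat S0 x b \<Longrightarrow>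
      F x b \<psi> = (\<integral>\<^sup>+x'. H (word_of (out x' b \<psi>)) \<psi> (chal S2 x' b) \<partial>sample_on p x A)"
  shows "R S0 F \<le> bound"
proof -
  have "R S0 F = R S0 (\<lambda>x b \<psi>. \<integral>\<^sup>+x'. H (word_of (out x' b \<psi>)) \<psi> (chal S2 x' b) \<partial>sample_on p x A)"
    using F by (rule R_cong)
  also have "\<dots> = R (S0\<lparr>vars := vars S0 \<union> A\<rparr>) (\<lambda>x b \<psi>. H (word_of (out x b \<psi>)) \<psi> (chal S2 x b))"
    by (rule R_sample[OF assms(1-3)])
  also have "R (S0\<lparr>vars := vars S0 \<union> A\<rparr>) = R S2"
    by (rule R_state_cong) (simp_all add: S2)
  also have "R S2 (\<lambda>x b \<psi>. H (word_of (out x b \<psi>)) \<psi> (chal S2 x b)) \<le> bound"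
    by (rule respond[OF S2(1) assms(8-11)])
  finally show ?thesis .
qed

lemma Hash_le:
  assumes "2 \<le> n"
  shows "R S (ans H (Hash a) S) \<le> bound"
proof (rule sample_respond[OF wf_sym _ _ wf_new_hash[OF wf_sym, of a]])
  let ?S = "S\<lparr>vars := insert (VHash a) (vars S)\<rparr>" and ?A = "{VHash a} - vars S"
  let ?r = "(0, \<lambda>x. x (VHash a)) :: int \<times> fn"
  show "finite ?A" "?A \<inter> vars S = {}" "vars ?S = vars S \<union> ?A" by auto
  show "size_of ?S + length [(False, ?r)] \<le> size_of S + n"
    using assms wfD(1)[OF wf_sym] by (simp add: size_of_def card_insert_if)
  show "rep_ok ?S i r" if "(i, r) \<in> set [(False, ?r)]" for i r
    using that by (auto simp: rep_ok_def intro!: span0_handle[OF h_hash])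
  show "Atom (\<psi> False (x (VHash a))) = Atom (nm False ?r)"
    if "x \<in> set_pmf (prior ?S)"
      "\<And>i r. (i, r) \<in> set [(False, ?r)] \<Longrightarrow> \<psi> i (val ?S x b r) = nm i r" for x b \<psi> nm
    using that(2)[of False ?r] sample_Zp_support[OF wf_new_hash[OF wf_sym] that(1)] by (simp add: val_fn)
  fix x b \<psi>
  have "chal ?S x' b = (chal S x b)\<lparr>ch_hash := table (insert (VHash a) (vars S)) x'\<rparr>"
    if x': "x' \<in> set_pmf (sample_on p x ?A)" for x'
    using sample_on_off[OF _ x'] by (subst chal_update[of x' x ?S S]) (auto simp: chal_def)
  then show "ans H (Hash a) S x b \<psi> =
      (\<integral>\<^sup>+x'. H (word_of (Atom (\<psi> False (x' (VHash a))))) \<psi> (chal ?S x' b) \<partial>sample_on p x ?A)"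
    unfolding ans_def answer.simps chal_sel hash_conv
    by (simp add: map_pmf_def bind_assoc_pmf bind_return_pmf) (intro nn_integral_cong_AE AE_pmfI, simp)
qed (use assms in simp_all)

text \<open>The budget consists of at most 1 + 2 |\<gamma>| fresh indeterminates and at most as many
  revealed elements.\<close>

lemma new_key_query:
  fixes \<gamma> K Q
  assumes n: "2 + 4 * length \<gamma> \<le> n" and "distinct \<gamma>"
    and key: "K \<subseteq> set \<gamma>" "K = {} \<or> K \<in> Q" "queried S \<subseteq> Q" "\<And>P. pol S = Some P \<Longrightarrow> \<not> satisfies K P"
    and F: "\<And>x b \<psi>. F x b \<psi> = (\<integral>\<^sup>+z. H (word_of (out \<psi> (fst z))) \<psi> (chal S x b\<lparr>ch_hash := snd z, ch_queried := Q\<rparr>)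
      \<partial>KeyGen p (ch_mk (chal S x b)) \<gamma> (ch_hash (chal S x b)))"
    and rs: "length rs \<le> 1 + 2 * length \<gamma>"
      "\<And>i r. (i, r) \<in> set rs \<Longrightarrow> rep_ok (new_key \<gamma> K Q S) i r"
      "\<And>x b \<psi> nm. x \<in> set_pmf (prior (new_key \<gamma> K Q S)) \<Longrightarrow>
        (\<And>i r. (i, r) \<in> set rs \<Longrightarrow> \<psi> i (val (new_key \<gamma> K Q S) x b r) = nm i r) \<Longrightarrow>
        out \<psi> (eval_key p (cs S (ver S)) (ver S) (nkeys S) \<gamma> x) = sx nm"
  shows "R S F \<le> bound"
proof (rule sample_respond[OF wf_sym _ _ wf_new_key[OF wf_sym key]])
  let ?S = "new_key \<gamma> K Q S" and ?k = "nkeys S"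
  let ?A = "insert (VR ?k) (VRJ ?k ` set \<gamma> \<union> (VHash ` set \<gamma> - vars S))"
  let ?dk = "\<lambda>x. eval_key p (cs S (ver S)) (ver S) (nkeys S) \<gamma> x"
  have V: "VRJ ?k j \<notin> vars S" "VR ?k \<notin> vars S" for j using wfD(5,6)[OF wf_sym] by blast+
  show "finite ?A" by simp
  show "?A \<inter> vars S = {}" using V by auto
  show "vars ?S = vars S \<union> ?A" "known ?S = known S" "msg ?S = msg S" by (simp_all add: new_key_def)
  have "card ?A \<le> 1 + 2 * length \<gamma>"
  proof -
    have "card ?A \<le> Suc (card (VRJ ?k ` set \<gamma> \<union> (VHash ` set \<gamma> - vars S)))"
      by (rule card_insert_le_m1) simp_all
    also have "\<dots> \<le> Suc (card (VRJ ?k ` set \<gamma>) + card (VHash ` set \<gamma> - vars S))"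
      using card_Un_le by simp
    also have "card (VHash ` set \<gamma> - vars S) \<le> card (VHash ` set \<gamma>)" by (intro card_mono) auto
    finally show ?thesis
      using card_image_le[of "set \<gamma>" "VRJ ?k"] card_image_le[of "set \<gamma>" VHash] card_length[of \<gamma>] by simp
  qed
  then show "size_of ?S + length rs \<le> size_of S + n"
    using rs(1) n card_Un_le[of "vars S" ?A] unfolding size_of_def new_key_def by simp
  show "length rs \<le> n" using rs(1) n by simp
  show "rep_ok ?S i r" if "(i, r) \<in> set rs" for i r using rs(2) that .
  show "out \<psi> (?dk x) = sx nm"
    if "x \<in> set_pmf (prior ?S)"
      "\<And>i r. (i, r) \<in> set rs \<Longrightarrow> \<psi> i (val ?S x b r) = nm i r" for x b \<psi> nm
    by (rule rs(3)[OF that(1), of \<psi> b]) (rule that(2))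
  fix x b \<psi> assume x: "x \<in> set_pmf (prior S)"
  have "chal ?S x' b = (chal S x b)\<lparr>ch_hash := table (vars S \<union> VHash ` set \<gamma>) x', ch_queried := Q\<rparr>"
    if x': "x' \<in> set_pmf (sample_on p x ?A)" for x'
  proof -
    have "table (vars ?S) x' = table (vars S \<union> VHash ` set \<gamma>) x'"
      by (auto simp: table_def new_key_def fun_eq_iff)
    moreover have "x' VBeta = x VBeta" "x' VA = x VA"
      using sample_on_off[OF _ x', of VBeta] sample_on_off[OF _ x', of VA] by auto
    ultimately show ?thesis
      by (subst chal_update[of x' x ?S S]) (auto simp: chal_def new_key_def)
  qed
  then show "F x b \<psi> = (\<integral>\<^sup>+x'. H (word_of (out \<psi> (?dk x'))) \<psi> (chal ?S x' b) \<partial>sample_on p x ?A)"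
    unfolding F chal_sel
      KeyGen_conv[where x = x and V = "vars S" and k = ?k, OF prime \<open>distinct \<gamma>\<close> V(1) sample_support[OF wf_sym x] wfD(14)[OF wf_sym]]
    by (simp add: nn_integral_cong_AE AE_pmfI cong: nn_integral_cong_AE)
qed

lemma rep_ok_new_key:
  fixes \<gamma> :: "attribute list" and Q
  assumes "wf_sym (new_key \<gamma> K Q S)"
  shows "rep_ok (new_key \<gamma> K Q S) False (0, \<lambda>x. c * (x VA + x (VR (nkeys S))))"
    and "j \<in> K \<Longrightarrow> rep_ok (new_key \<gamma> K Q S) False
          (0, \<lambda>x. x VBeta * x (VR (nkeys S)) + x (VHash j) * x (VRJ (nkeys S) j))"
    and "j \<in> K \<Longrightarrow> rep_ok (new_key \<gamma> K Q S) False (0, \<lambda>x. x (VRJ (nkeys S) j))"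
proof -
  let ?S = "new_key \<gamma> K Q S" and ?k = "nkeys S"
  have k: "?k < nkeys ?S" and K: "kattrs ?S ?k = K" by (simp_all add: new_key_def)
  note v = wfD(3,4)[OF assms] wfD(7)[OF assms k]
  show "rep_ok ?S False (0, \<lambda>x. c * (x VA + x (VR ?k)))"
    using v k by (auto simp: rep_ok_def intro!: span0_scale span0_handle[OF h_D])
  show "rep_ok ?S False (0, \<lambda>x. x VBeta * x (VR ?k) + x (VHash j) * x (VRJ ?k j))" if "j \<in> K"
    using v k K that wfD(9,10)[OF assms k, of j] by (auto simp: rep_ok_def intro!: span0_handle[OF h_Dj])
  show "rep_ok ?S False (0, \<lambda>x. x (VRJ ?k j))" if "j \<in> K"
    using v k K that wfD(9,10)[OF assms k, of j] by (auto simp: rep_ok_def intro!: span0_handle[OF h_Dj'])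
qed

lemma Gen_Dec_Key_le:
  assumes n: "2 + 4 * length \<gamma> \<le> n"
  shows "R S (ans H (Gen_Dec_Key \<gamma>) S) \<le> bound"
proof (cases "distinct \<gamma> \<and> (case pol S of None \<Rightarrow> True | Some P \<Rightarrow> \<not> satisfies (set \<gamma>) P)")
  case False
  then show ?thesis by (intro reject_query) (auto split: option.splits)
next
  case True
  let ?S = "new_key \<gamma> (set \<gamma>) (insert (set \<gamma>) (queried S)) S" and ?k = "nkeys S"
  let ?D = "(0, \<lambda>x. modular_inverse (int p) (cs S (ver S)) * (x VA + x (VR ?k))) :: int \<times> fn"
  let ?Dj = "\<lambda>j. (0, \<lambda>x. x VBeta * x (VR ?k) + x (VHash j) * x (VRJ ?k j)) :: int \<times> fn"
  let ?Dj' = "\<lambda>j. (0, \<lambda>x. x (VRJ ?k j)) :: int \<times> fn"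
  let ?rs = "(False, ?D) # map (\<lambda>j. (False, ?Dj j)) \<gamma> @ map (\<lambda>j. (False, ?Dj' j)) \<gamma>"
  have key: "set \<gamma> \<subseteq> set \<gamma>" "set \<gamma> = {} \<or> set \<gamma> \<in> insert (set \<gamma>) (queried S)"
    "queried S \<subseteq> insert (set \<gamma>) (queried S)" "\<And>P. pol S = Some P \<Longrightarrow> \<not> satisfies (set \<gamma>) P"
    using True by auto
  note wfS = wf_new_key[OF wf_sym key]
  show ?thesis
  proof (rule new_key_query[OF n _ key, where out = "\<lambda>\<psi> dk. sexp_dec_key (map_dec_key (\<psi> False) dk)" and rs = ?rs and
      sx = "\<lambda>nm. sexp_dec_key (DecKey (nm False ?D) (ver S) (map (\<lambda>j. (j, nm False (?Dj j), nm False (?Dj' j))) \<gamma>))"])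
    show "ans H (Gen_Dec_Key \<gamma>) S x b \<psi> = (\<integral>\<^sup>+z. H (word_of (sexp_dec_key (map_dec_key (\<psi> False) (fst z)))) \<psi>
        (chal S x b\<lparr>ch_hash := snd z, ch_queried := insert (set \<gamma>) (queried S)\<rparr>)
      \<partial>KeyGen p (ch_mk (chal S x b)) \<gamma> (ch_hash (chal S x b)))" for x b \<psi>
      using True by (cases "pol S") (simp_all add: ans_def case_prod_unfold)
    show "rep_ok ?S i r" if "(i, r) \<in> set ?rs" for i r
      using that rep_ok_new_key[OF wfS] by auto
    show "sexp_dec_key (map_dec_key (\<psi> False) (eval_key p (cs S (ver S)) (ver S) ?k \<gamma> x)) =
      sexp_dec_key (DecKey (nm False ?D) (ver S) (map (\<lambda>j. (j, nm False (?Dj j), nm False (?Dj' j))) \<gamma>))"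
      if x: "x \<in> set_pmf (prior ?S)"
        and nm: "\<And>i r. (i, r) \<in> set ?rs \<Longrightarrow> \<psi> i (val ?S x b r) = nm i r" for x b \<psi> nm
    proof -
      have D: "nm False ?D = \<psi> False (modular_inverse (int p) (cs S (ver S)) * (x VA + x (VR ?k)) mod int p)"
        using nm[of False ?D] by (simp add: val_fn)
      have Dj: "nm False (?Dj j) = \<psi> False ((x VBeta * x (VR ?k) + x (VHash j) * x (VRJ ?k j)) mod int p)"
        "nm False (?Dj' j) = \<psi> False (x (VRJ ?k j))" if j: "j \<in> set \<gamma>" for j
      proof -
        have "VRJ ?k j \<in> vars ?S" using j by (simp add: new_key_def)
        then show "nm False (?Dj j) = \<psi> False ((x VBeta * x (VR ?k) + x (VHash j) * x (VRJ ?k j)) mod int p)"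
          "nm False (?Dj' j) = \<psi> False (x (VRJ ?k j))"
          using nm[of False "?Dj j"] nm[of False "?Dj' j"] j sample_Zp_support[OF wfS x]
          by (simp_all add: val_fn)
      qed
      show ?thesis by (simp add: eval_key_def D Dj)
    qed
  qed (use True in auto)
qed

lemma Gen_D_Field_le:
  assumes n: "2 + 4 * length \<gamma> \<le> n"
  shows "R S (ans H (Gen_D_Field \<gamma>) S) \<le> bound"
proof (cases "distinct \<gamma>")
  case False
  then show ?thesis by (intro reject_query) simp
next
  case True
  let ?S = "new_key \<gamma> {} (queried S) S" and ?k = "nkeys S"
  let ?D = "(0, \<lambda>x. modular_inverse (int p) (cs S (ver S)) * (x VA + x (VR ?k))) :: int \<times> fn"
  have key: "{} \<subseteq> set \<gamma>" "{} = {} \<or> {} \<in> queried S" "queried S \<subseteq> queried S"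
    "\<And>P. pol S = Some P \<Longrightarrow> \<not> satisfies {} P"
    using wf_SomeD(1)[OF wf_sym] satisfies_empty by (auto simp: wf_policy_def)
  note wfS = wf_new_key[OF wf_sym key]
  show ?thesis
  proof (rule new_key_query[OF n True key, where out = "\<lambda>\<psi> dk. Atom (\<psi> False (dk_D dk))" and rs = "[(False, ?D)]" and
      sx = "\<lambda>nm. Atom (nm False ?D)"])
    show "ans H (Gen_D_Field \<gamma>) S x b \<psi> = (\<integral>\<^sup>+z. H (word_of (Atom (\<psi> False (dk_D (fst z))))) \<psi>
        (chal S x b\<lparr>ch_hash := snd z, ch_queried := queried S\<rparr>)
      \<partial>KeyGen p (ch_mk (chal S x b)) \<gamma> (ch_hash (chal S x b)))" for x b \<psi>
    proof -
      have upd: "chal S x b\<lparr>ch_hash := t, ch_queried := queried S\<rparr> = chal S x b\<lparr>ch_hash := t\<rparr>" for t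
        by (simp add: chal_def)
      show ?thesis unfolding upd using True by (simp add: ans_def case_prod_unfold)
    qed
    show "rep_ok ?S i r" if "(i, r) \<in> set [(False, ?D)]" for i r
      using that rep_ok_new_key[OF wfS] by auto
    show "Atom (\<psi> False (dk_D (eval_key p (cs S (ver S)) (ver S) ?k \<gamma> x))) =
      Atom (nm False ?D)"
      if nm: "\<And>i r. (i, r) \<in> set [(False, ?D)] \<Longrightarrow> \<psi> i (val ?S x b r) = nm i r" for x b \<psi> nm
      using nm[of False ?D] by (simp add: eval_key_def val_fn)
  qed auto
qed

lemma Update_Enc_Key_le:
  assumes n: "3 \<le> n"
  shows "R S (ans H Update_Enc_Key S) \<le> bound"
proof -
  let ?n = "Suc (ver S)"
  let ?us = "\<lambda>c x b. ch_updates (chal (new_version c S) x b)"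
  let ?out = "\<lambda>c x b \<psi>. Node [sexp_enc_key (EncKey (\<psi> False 1) (\<psi> False (c * x VBeta mod int p))
      (\<psi> True (x VBeta * x VA mod int p)) ?n), Node (map (\<lambda>i. num (nat (u_dk (?us c x b i)))) [1..<?n + 1])]"
  have ans: "ans H Update_Enc_Key S x b \<psi> =
      (\<integral>\<^sup>+c. H (word_of (?out c x b \<psi>)) \<psi> (chal (new_version c S) x b) \<partial>sample_Zp_unit p)"
    if x: "x \<in> set_pmf (prior S)" for x b \<psi>
  proof -
    let ?u = "\<lambda>c. \<lparr>u_cp = div_Zp p (c * x VBeta mod int p) (cs S (ver S) * x VBeta mod int p),
      u_ek = c * x VBeta mod int p, u_dk = div_Zp p (cs S (ver S) * x VBeta mod int p) (c * x VBeta mod int p)\<rparr>"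
    have us: "(ch_updates (chal S x b))(?n := ?u c) = ?us c x b" for c
      by (auto simp: chal_def new_version_def fun_eq_iff)
    have us': "(if i = ?n then ?u c else ch_updates (chal S x b) i) = ?us c x b i" for c i
      using fun_cong[OF us[of c], of i] by (simp only: fun_upd_apply)
    have "UpdateMK p (ch_mk (chal S x b)) =
      map_pmf (\<lambda>c. (MasterKey (c * x VBeta mod int p) (x VBeta * x VA mod int p) ?n, ?u c)) (sample_Zp_unit p)"
      unfolding UpdateMK_def
      by (subst sample_Zp_unit_mult[OF prime sample_support[OF wf_sym x], symmetric])
         (simp add: map_pmf_def bind_assoc_pmf bind_return_pmf mult.commute)
    moreover have "chal S x b\<lparr>ch_mk := MasterKey (c * x VBeta mod int p) (x VBeta * x VA mod int p) ?n,
        ch_ek := EncKey 1 (c * x VBeta mod int p) (x VBeta * x VA mod int p) ?n, ch_updates := ?us c x b\<rparr> =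
      chal (new_version c S) x b" for c
      by (simp add: chal_def new_version_def)
    ultimately show ?thesis
      by (simp add: ans_def UpdateEK_def Let_def us us' del: upt_Suc)
  qed
  have "R S (ans H Update_Enc_Key S) = R S (\<lambda>x b \<psi>. \<integral>\<^sup>+c. H (word_of (?out c x b \<psi>)) \<psi>
      (chal (new_version c S) x b) \<partial>sample_Zp_unit p)"
    by (rule R_cong) (rule ans)
  \<comment> \<open>As the ratio of the versions becomes public, c is averaged outside: each value
    of c gives a symbolic state of its own.\<close>
  also have "\<dots> = (\<integral>\<^sup>+c. R S (\<lambda>x b \<psi>. H (word_of (?out c x b \<psi>)) \<psi> (chal (new_version c S) x b)) \<partial>sample_Zp_unit p)"
    by (rule R_integral)
  also have "\<dots> \<le> (\<integral>\<^sup>+c. bound \<partial>sample_Zp_unit p)"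
  proof (intro nn_integral_mono_AE AE_pmfI)
    fix c assume "c \<in> set_pmf (sample_Zp_unit p)"
    then have "c \<in> {1..<int p}" using p_ge_2 by (simp add: sample_Zp_unit_def)
    then have c: "\<not> int p dvd c" by (rule not_dvd_unit[OF prime])
    let ?S = "new_version c S"
    note wfS = wf_new_version[OF wf_sym c]
    let ?g = "(0, \<lambda>x. 1) :: int \<times> fn" and ?h = "(0, \<lambda>x. c * x VBeta) :: int \<times> fn"
      and ?l = "(0, \<lambda>x. x VBeta * x VA) :: int \<times> fn"
    let ?rs = "[(False, ?g), (False, ?h), (True, ?l)]"
    let ?ks = "map (\<lambda>i. num (nat (cs ?S (i - 1) * modular_inverse (int p) (cs ?S i) mod int p))) [1..<?n + 1]"
    have "R ?S (\<lambda>x b \<psi>. H (word_of (?out c x b \<psi>)) \<psi> (chal ?S x b)) \<le> bound"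
    proof (rule respond[OF wfS, where rs = ?rs and
        sx = "\<lambda>nm. Node [sexp_enc_key (EncKey (nm False ?g) (nm False ?h) (nm True ?l) ?n), Node ?ks]"])
      show "size_of ?S + length ?rs \<le> size_of S + n" "length ?rs \<le> n"
        using n by (simp_all add: size_of_def new_version_def)
      show "rep_ok ?S i r" if "(i, r) \<in> set ?rs" for i r
        using that wfD(3,4)[OF wfS]
        by (auto simp: rep_ok_def intro!: span0_scale span0_handle[OF h_one] span0_handle[OF h_beta] span1_l)
      show "?out c x b \<psi> = Node [sexp_enc_key (EncKey (nm False ?g) (nm False ?h) (nm True ?l) ?n), Node ?ks]"
        if x: "x \<in> set_pmf (prior ?S)"
          and nm: "\<And>i r. (i, r) \<in> set ?rs \<Longrightarrow> \<psi> i (val ?S x b r) = nm i r" for x b \<psi> nm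
      proof -
        have "u_dk (?us c x b i) = cs ?S (i - 1) * modular_inverse (int p) (cs ?S i) mod int p"
          if "i \<in> set [1..<?n + 1]" for i
          using that by (intro u_chal(1)[where v = 0] wfS sample_support[OF wfS x]) (auto simp: new_version_def)
        then have ks: "map (\<lambda>i. num (nat (u_dk (?us c x b i)))) [1..<?n + 1] = ?ks" by simp
        show ?thesis unfolding ks
          using nm[of False ?g] nm[of False ?h] nm[of True ?l] p_ge_2 by (simp add: val_fn)
      qed
    qed
    moreover have "R ?S = R S" by (rule R_state_cong) (simp_all add: new_version_def)
    ultimately show "R S (\<lambda>x b \<psi>. H (word_of (?out c x b \<psi>)) \<psi> (chal ?S x b)) \<le> bound"
      by simp
  qed
  finally show ?thesis by simp
qed

end

section \<open>The length of a query as a bound on its cost\<close>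

lemma length_word_of: "1 \<le> length (word_of x)"
  by (cases x) auto

lemma length_word_attrs: "length \<gamma> \<le> length (concat (map (word_of \<circ> Atom) \<gamma>))"
  by (induction \<gamma>) auto

lemma length_word_policy: "length (indices P) \<le> length (word_of (sexp_policy P))"
proof (induction P rule: indices.induct)
  case (2 i k ts)
  have "(\<Sum>t\<leftarrow>ts. length (indices t)) \<le> (\<Sum>t\<leftarrow>ts. length (word_of (sexp_policy t)))"
    using 2 by (intro sum_list_mono) auto
  then show ?case by (simp add: length_concat o_def)
qed (use length_word_of in simp)

context query_step
begin

text \<open>With |P| nodes there are at most 1 + 2 |P| fresh indeterminates (s, coefficients, hash
  values) and at most 2 + 2 |P| revealed elements (two, and two for every leaf), which explains the
  budget.\<close>

lemma Challenge_le:
  assumes n: "3 + 4 * length (indices P) \<le> n"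
  shows "R S (ans H (Challenge m0 m1 P) S) \<le> bound"
proof (cases "pol S = None \<and> length m0 = length m1 \<and> wf_policy P \<and> (\<forall>\<gamma>\<in>queried S. \<not> satisfies \<gamma> P)")
  case False
  then show ?thesis by (intro reject_query) auto
next
  case True
  then have None: "pol S = None" and P: "wf_policy P" and q: "\<forall>\<gamma>\<in>queried S. \<not> satisfies \<gamma> P" by auto
  show ?thesis
  proof (rule op_query[where W = "{(True, m0), (True, m1)}"])
    show "ans H (Challenge m0 m1 P) S x b \<psi> = H (word_of (Node [])) \<psi> (chal S x b)"
      if "\<exists>(i, w)\<in>{(True, m0), (True, m1)}. \<not> valid p (\<psi> i) w" for x b \<psi>
      using that by (intro ans_reject) auto
    assume K: "\<And>j u. (j, u) \<in> {(True, m0), (True, m1)} \<Longrightarrow> \<exists>r. known S (j, u) = Some r"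
    obtain r0 r1 where r: "known S (True, m0) = Some r0" "known S (True, m1) = Some r1"
      using K[of True m0] K[of True m1] by auto
    define f0 where "f0 = snd r0"
    define f1 where "f1 = snd r1"
    have r0: "r0 = (0, f0)" "r1 = (0, f1)" and f: "span1 S f0" "span1 S f1"
      using r[THEN rep_ok_known] None by (auto simp: rep_ok_def f0_def f1_def prod_eq_iff)
    define fb where "fb = (\<lambda>b. if b then f1 else f0)"
    let ?A = "insert VS (coefs P \<union> (VHash ` set (leaves P) - vars S))"
    let ?T = "S\<lparr>msg := fb\<rparr>" and ?S = "new_challenge P f0 f1 S"
    let ?c = "cs S (ver S)" and ?L = "lshares P (\<lambda>x. x VS)"
    let ?cp = "\<lambda>x b. Ciphertext P ((fb b x mod int p + x VBeta * x VA * x VS) mod int p)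
        (?c * (x VBeta * x VS) mod int p) (ver S)
        (map (\<lambda>(a, l). (l x mod int p, x (VHash a) * l x mod int p)) ?L)"
    let ?out = "\<lambda>x b \<psi>. sexp_ciphertext (map_ciphertext (\<psi> False) (\<psi> True) (?cp x b))"
    let ?F = "\<lambda>x b \<psi>. \<integral>\<^sup>+z. H (word_of (sexp_ciphertext (map_ciphertext (\<psi> False) (\<psi> True) (fst z)))) \<psi>
        (chal S x b\<lparr>ch_hash := snd z, ch_challenge := Some (P, b)\<rparr>)
        \<partial>Encrypt p (fb b x mod int p) P (ch_ek (chal S x b)) (table (vars S) x)"
    have chal_b: "chal S x b = chal S x b'" for x b b' using None by (simp add: chal_def)
    have "R S (ans H (Challenge m0 m1 P) S) = R S (\<lambda>x b \<psi>. \<integral>\<^sup>+b'. ?F x b' \<psi> \<partial>bernoulli_pmf (1 / 2))"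
    proof (rule R_cong)
      fix x b \<psi> assume \<psi>: "\<psi> \<in> compat S x b"
      have "dlog p (\<psi> True) (if b' then m1 else m0) = fb b' x mod int p" for b'
        using dlog_known(2)[OF \<psi> r(1)] dlog_known(2)[OF \<psi> r(2)] by (simp add: r0 val_fn fb_def)
      then have "ans H (Challenge m0 m1 P) S x b \<psi> =
        (\<integral>\<^sup>+b'. \<integral>\<^sup>+z. H (word_of (sexp_ciphertext (map_ciphertext (\<psi> False) (\<psi> True) (fst z)))) \<psi>
        (chal S x b\<lparr>ch_hash := snd z, ch_challenge := Some (P, b')\<rparr>)
        \<partial>Encrypt p (fb b' x mod int p) P (ch_ek (chal S x b)) (table (vars S) x) \<partial>bernoulli_pmf (1 / 2))"
        using dlog_known(1)[OF \<psi> r(1)] dlog_known(1)[OF \<psi> r(2)] True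
        by (simp add: ans_def case_prod_unfold del: nn_integral_bernoulli_pmf)
      also have "\<dots> = (\<integral>\<^sup>+b'. ?F x b' \<psi> \<partial>bernoulli_pmf (1 / 2))"
      proof (intro nn_integral_cong)
        fix b'
        show "(\<integral>\<^sup>+z. H (word_of (sexp_ciphertext (map_ciphertext (\<psi> False) (\<psi> True) (fst z)))) \<psi>
          (chal S x b\<lparr>ch_hash := snd z, ch_challenge := Some (P, b')\<rparr>)
          \<partial>Encrypt p (fb b' x mod int p) P (ch_ek (chal S x b)) (table (vars S) x)) = ?F x b' \<psi>"
          by (simp only: chal_b[of x b b'])
      qed
      finally show "ans H (Challenge m0 m1 P) S x b \<psi> = (\<integral>\<^sup>+b'. ?F x b' \<psi> \<partial>bernoulli_pmf (1 / 2))" .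
    qed
    \<comment> \<open>From here on the bit of the state is the bit of the challenge.\<close>
    also have "\<dots> = R ?T ?F" by (rule R_coin[OF wf_sym None])
    also have "\<dots> \<le> bound"
    proof -
      \<comment> \<open>The only component of the reply whose representation involves b: message
        coefficient 1 and nothing else.\<close>
      let ?Ct = "(1, \<lambda>x. 0) :: int \<times> fn" and ?C = "(0, \<lambda>x. ?c * (x VBeta * x VS)) :: int \<times> fn"
      let ?Cy = "\<lambda>l. (0, l) :: int \<times> fn" and ?Cy' = "\<lambda>a l. (0, \<lambda>x. x (VHash a) * l x) :: int \<times> fn"
      let ?rs = "(True, ?Ct) # (False, ?C) # map (\<lambda>(a, l). (False, ?Cy l)) ?L @ map (\<lambda>(a, l). (False, ?Cy' a l)) ?L"
      \<comment> \<open>The size of the policy is covered by the budget of the query, hence by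
        N.\<close>
      have I: "length (indices P) < p" using n size N_less by linarith
      have wf0: "wf_sym ?T" unfolding fb_def by (rule wf_new_msg[OF wf_sym f])
      have wfS: "wf_sym ?S" by (rule wf_new_challenge[OF wf_sym None f P I q])
      have lenL: "length ?L = length (leaves P)" using map_fst_lshares[of P "\<lambda>x. x VS"] by (metis length_map)
      have disj: "?A \<inter> vars S = {}"
        using wf_NoneD[OF wf_sym None] coefs_indices[of _ P] by blast
      show ?thesis
      proof (rule sample_respond[OF wf0 _ _ wfS, where A = ?A and rs = ?rs and out = ?out and
          sx = "\<lambda>nm. sexp_ciphertext (Ciphertext P (nm True ?Ct) (nm False ?C) (ver S)
            (map (\<lambda>(a, l). (nm False (?Cy l), nm False (?Cy' a l))) ?L))"])
        show "finite ?A" by (simp add: finite_coefs)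
        show "?A \<inter> vars ?T = {}" using disj by simp
        show "vars ?S = vars ?T \<union> ?A" "known ?S = known ?T" "msg ?S = msg ?T"
          by (simp_all add: new_challenge_def fb_def)
        have "thresholds_ok P" using P by (simp add: wf_policy_def)
        note le = card_coefs[OF this] length_leaves_le[of P]
        have "card ?A \<le> 1 + length (indices P) + length (indices P)"
        proof -
          have "card ?A \<le> Suc (card (coefs P \<union> (VHash ` set (leaves P) - vars S)))"
            by (rule card_insert_le_m1) simp_all
          also have "\<dots> \<le> Suc (card (coefs P) + card (VHash ` set (leaves P) - vars S))"
            using card_Un_le by simp
          also have "card (VHash ` set (leaves P) - vars S) \<le> card (VHash ` set (leaves P))" by (intro card_mono) auto
          finally show ?thesis
            using card_image_le[of "set (leaves P)" VHash] card_length[of "leaves P"] le by simp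
        qed
        then show "size_of ?S + length ?rs \<le> size_of S + n"
          using n lenL le card_Un_le[of "vars S" ?A] unfolding size_of_def new_challenge_def by simp
        show "length ?rs \<le> n" using n lenL le by simp
        show "rep_ok ?S i r" if ir: "(i, r) \<in> set ?rs" for i r
        proof -
          have pol: "pol ?S = Some P" by (simp add: new_challenge_def)
          note v = wf_SomeD[OF wfS pol] wfD(3)[OF wfS]
          have l: "rep_ok ?S False (?Cy l)" "rep_ok ?S False (?Cy' a l)" if "(a, l) \<in> set ?L" for a l
          proof -
            have "a \<in> set (leaves P)"
              using that by (metis fst_conv image_eqI image_set map_fst_lshares)
            then have "VHash a \<in> vars ?S" using v(5) by blast
            then show "rep_ok ?S False (?Cy l)" "rep_ok ?S False (?Cy' a l)"
              using v that by (auto simp: rep_ok_def intro!: span0_handle[OF h_Cy[OF pol]] span0_handle[OF h_Cy'[OF pol]])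
          qed
          have C: "rep_ok ?S False ?C"
            using v by (auto simp: rep_ok_def intro!: span0_scale span0_handle[OF h_C[OF pol]])
          have Ct: "rep_ok ?S True ?Ct" using pol span1_zero by (simp add: rep_ok_def)
          show ?thesis using ir l C Ct by auto
        qed
        show "?out x b \<psi> = sexp_ciphertext (Ciphertext P (nm True ?Ct) (nm False ?C) (ver S)
            (map (\<lambda>(a, l). (nm False (?Cy l), nm False (?Cy' a l))) ?L))"
          if nm: "\<And>i r. (i, r) \<in> set ?rs \<Longrightarrow> \<psi> i (val ?S x b r) = nm i r" for x b \<psi> nm
        proof -
          have "val ?S x b ?Ct = (fb b x mod int p + x VBeta * x VA * x VS) mod int p"
            by (simp add: val_def comb_def new_challenge_def fb_def mod_simps)
          then have Ct: "nm True ?Ct = \<psi> True ((fb b x mod int p + x VBeta * x VA * x VS) mod int p)"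
            using nm[of True ?Ct] by simp
          have C: "nm False ?C = \<psi> False (?c * (x VBeta * x VS) mod int p)"
            using nm[of False ?C] by (simp add: val_fn)
          have l: "nm False (?Cy l) = \<psi> False (l x mod int p)"
            "nm False (?Cy' a l) = \<psi> False (x (VHash a) * l x mod int p)" if al: "(a, l) \<in> set ?L" for a l
          proof -
            have "(False, ?Cy l) \<in> set ?rs" "(False, ?Cy' a l) \<in> set ?rs" using al by force+
            then show "nm False (?Cy l) = \<psi> False (l x mod int p)"
              "nm False (?Cy' a l) = \<psi> False (x (VHash a) * l x mod int p)"
              using nm[of False "?Cy l"] nm[of False "?Cy' a l"] by (simp_all add: val_fn)
          qed
          have "map (\<lambda>(a, l). (nm False (?Cy l), nm False (?Cy' a l))) ?L =
              map (map_prod (\<psi> False) (\<psi> False) \<circ> (\<lambda>(a, l). (l x mod int p, x (VHash a) * l x mod int p))) ?L"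
            using l by (intro map_cong refl) auto
          then show ?thesis by (simp add: Ct C)
        qed
        fix x b \<psi>
        have off: "x' v = x v" if x': "x' \<in> set_pmf (sample_on p x ?A)" and "v \<in> vars S" for x' v
          using sample_on_off[OF _ x', of v] that(2) disj by (auto simp: finite_coefs)
        have "fb b x' = fb b x" if x': "x' \<in> set_pmf (sample_on p x ?A)" for x'
        proof -
          have "dep (vars S) (fb b)" using f span1_dep by (simp add: fb_def)
          then show ?thesis by (rule depD) (rule off[OF x'])
        qed
        moreover have "chal ?S x' b = (chal S x b)\<lparr>ch_hash := table (vars S \<union> VHash ` set (leaves P)) x', ch_challenge := Some (P, b)\<rparr>"
          if x': "x' \<in> set_pmf (sample_on p x ?A)" for x'
        proof -
          have "table (vars ?S) x' = table (vars S \<union> VHash ` set (leaves P)) x'"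
            using coefs_indices[of _ P] by (force simp: table_def new_challenge_def fun_eq_iff)
          then show ?thesis
            using off[OF x' wfD(3)[OF wf_sym]] off[OF x' wfD(4)[OF wf_sym]]
            by (subst chal_update[of x' x ?S S]) (auto simp: chal_def new_challenge_def)
        qed
        ultimately show "?F x b \<psi> = (\<integral>\<^sup>+x'. H (word_of (?out x' b \<psi>)) \<psi> (chal ?S x' b) \<partial>sample_on p x ?A)"
          unfolding chal_sel Encrypt_conv[where x = x and V = "vars S", OF prime P]
          by (simp add: AE_pmfI cong: nn_integral_cong_AE)
             (intro nn_integral_cong_AE AE_pmfI, simp)
      qed
    qed
    finally show "R S (ans H (Challenge m0 m1 P) S) \<le> bound" .
  qed (rule ans_le_1)
qed

text \<open>Every attribute and every policy node contributes at least one symbol to the word; the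
  factor 10 absorbs the constants of the individual queries.\<close>

lemma query_le:
  assumes "10 * length (word_of (sexp_query q)) \<le> n"
  shows "R S (ans H q S) \<le> bound"
proof (cases q)
  case (Gen_Dec_Key \<gamma>)
  have "R S (ans H (Gen_Dec_Key \<gamma>) S) \<le> bound"
    by (rule Gen_Dec_Key_le) (use assms Gen_Dec_Key length_word_attrs[of \<gamma>] in simp)
  then show ?thesis by (simp only: Gen_Dec_Key)
next
  case (Gen_D_Field \<gamma>)
  have "R S (ans H (Gen_D_Field \<gamma>) S) \<le> bound"
    by (rule Gen_D_Field_le) (use assms Gen_D_Field length_word_attrs[of \<gamma>] in simp)
  then show ?thesis by (simp only: Gen_D_Field)
next
  case (Challenge m0 m1 P)
  have "R S (ans H (Challenge m0 m1 P) S) \<le> bound"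
    by (rule Challenge_le) (use assms Challenge length_word_policy[of P] in simp)
  then show ?thesis by (simp only: Challenge)
next
  case (Hash a)
  have "R S (ans H (Hash a) S) \<le> bound"
    by (rule Hash_le) (use assms Hash  in simp)
  then show ?thesis by (simp only: Hash)
next
  case Update_Enc_Key
  have "R S (ans H Update_Enc_Key S) \<le> bound"
    by (rule Update_Enc_Key_le) (use assms Update_Enc_Key  in simp)
  then show ?thesis by (simp only: Update_Enc_Key)
qed (simp_all only: Mult0_le Mult1_le Inv0_le Inv1_le Pairing_le Update_Dec_Key_le Update_Ciphertext_le)

lemma environment_le:
  assumes "10 * length w \<le> n"
  shows "R S (\<lambda>x b \<psi>. \<integral>\<^sup>+z. H (fst z) \<psi> (snd z) \<partial>environment p (\<psi> False) (\<psi> True) w (chal S x b))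
    \<le> bound"
proof (cases "decode_query w")
  case None
  then have "R S (\<lambda>x b \<psi>. \<integral>\<^sup>+z. H (fst z) \<psi> (snd z) \<partial>environment p (\<psi> False) (\<psi> True) w (chal S x b)) =
    R S (\<lambda>x b \<psi>. H (word_of (Node [])) \<psi> (chal S x b))"
    by (simp add: environment_def reject_def)
  then show ?thesis using reject_le by simp
next
  case (Some q)
  then have w: "w = word_of (sexp_query q)"
    by (auto simp: decode_query_def f_inv_into_f split: if_splits)
       (metis comp_apply f_inv_into_f rangeI)
  have "R S (\<lambda>x b \<psi>. \<integral>\<^sup>+z. H (fst z) \<psi> (snd z) \<partial>environment p (\<psi> False) (\<psi> True) w (chal S x b)) = R S (ans H q S)"
    using Some by (simp add: environment_def ans_def[abs_def])
  then show ?thesis using query_le[of q] assms w by simp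
qed

end

section \<open>The advantage of the adversary\<close>

definition won :: "bool option \<times> challenger \<Rightarrow> ennreal" where
  "won z = (case ch_challenge (snd z) of None \<Rightarrow> 0 | Some (P, b) \<Rightarrow> of_bool (fst z = Some b))"

lemma won_le_1: "won z \<le> 1"
  by (simp add: won_def split: option.splits prod.splits)

context generic_group
begin

definition win :: "machine \<Rightarrow> nat \<Rightarrow> config \<Rightarrow> (bool \<Rightarrow> int \<Rightarrow> enc) \<Rightarrow> challenger \<Rightarrow> ennreal" where
  "win A t c \<psi> \<sigma> = (\<integral>\<^sup>+z. won z \<partial>run A (environment p (\<psi> False) (\<psi> True)) t c \<sigma>)"

lemma win_le_1: "win A t c \<psi> \<sigma> \<le> 1"
proof -
  have "win A t c \<psi> \<sigma> \<le> (\<integral>\<^sup>+z. 1 \<partial>run A (environment p (\<psi> False) (\<psi> True)) t c \<sigma>)"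
    unfolding win_def by (intro nn_integral_mono won_le_1)
  then show ?thesis by simp
qed

text \<open>The bit is uniform and independent of the exponents, and the fixed guess does not read
  the encodings. Exponents with collisions can only lower the left-hand side.\<close>

lemma guess_le: "R S (\<lambda>x b \<psi>. of_bool (b0 = b)) \<le> 1 / 2"
proof -
  have "R S (\<lambda>x b \<psi>. of_bool (b0 = b)) \<le>
      (\<integral>\<^sup>+x. \<integral>\<^sup>+b. of_bool (b0 = b) \<partial>bernoulli_pmf (1 / 2) \<partial>prior S)"
    unfolding R_eq by (intro nn_integral_mono) (simp add: inner_def)
  also have "\<dots> = 1 / 2"
    by (cases b0) (simp_all add: ennreal_divide_numeral divide_ennreal_def)
  finally show ?thesis .
qed

text \<open>|outbox| + t bounds the symbols that can still be sent: a step writes at most one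
  symbol, and sending empties the outbox. So each query is paid for by the symbols of its own word,
  however the machine divides its time among queries.\<close>

lemma run_le:
  assumes "wf_sym S" "size_of S + 10 * (length (outbox c) + t) \<le> N"
  shows "R S (\<lambda>x b \<psi>. win A t c \<psi> (chal S x b)) \<le>
    1 / 2 + ennreal (real (10 * (length (outbox c) + t)) * delta)"
  using assms
proof (induction t arbitrary: c S)
  case 0
  have "win A 0 c \<psi> (chal S x b) = 0" for x b \<psi>
    by (simp add: win_def won_def split: option.splits prod.splits)
  then show ?case using R_const_le[of S 0] by simp
next
  case (Suc t)
  let ?bound = "1 / 2 + ennreal (real (10 * (length (outbox c) + Suc t)) * delta)"
  define F where "F = (\<lambda>coin x b \<psi>. (let i = fetch A c coin; c' = execute i c in
     (case control_of i of
        Continue \<Rightarrow> win A t c' \<psi> (chal S x b)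
      | Ask \<Rightarrow> (\<integral>\<^sup>+z. win A t (deliver (fst z) c') \<psi> (snd z)
          \<partial>environment p (\<psi> False) (\<psi> True) (outbox c') (chal S x b))
      | Halt b0 \<Rightarrow> won (Some b0, chal S x b))))"
  have "win A (Suc t) c \<psi> (chal S x b) = (\<integral>\<^sup>+coin. F coin x b \<psi> \<partial>bernoulli_pmf (1 / 2))" for x b \<psi>
    unfolding win_def run.simps nn_integral_bind_pmf F_def Let_def
    by (intro nn_integral_cong) (auto split: control.splits simp: case_prod_unfold)
  then have "R S (\<lambda>x b \<psi>. win A (Suc t) c \<psi> (chal S x b)) =
      (\<integral>\<^sup>+coin. R S (F coin) \<partial>bernoulli_pmf (1 / 2))"
    by (simp only: R_integral)
  also have "\<dots> \<le> (\<integral>\<^sup>+coin. ?bound \<partial>bernoulli_pmf (1 / 2))"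
  proof (intro nn_integral_mono)
    fix coin
    define i where "i = fetch A c coin"
    define c' where "c' = execute i c"
    have out: "length (outbox c') \<le> length (outbox c) + 1"
      by (simp add: c'_def execute_def split: option.splits)
    show "R S (F coin) \<le> ?bound"
    proof (cases "control_of i")
      case Continue
      have "R S (F coin) = R S (\<lambda>x b \<psi>. win A t c' \<psi> (chal S x b))"
        unfolding F_def using Continue by (simp add: Let_def i_def[symmetric] c'_def[symmetric])
      also have "\<dots> \<le> 1 / 2 + ennreal (real (10 * (length (outbox c') + t)) * delta)"
        using Suc.prems out by (intro Suc.IH) auto
      also have "\<dots> \<le> ?bound"
        using out delta_nonneg by (intro add_left_mono ennreal_leI mult_right_mono) auto
      finally show ?thesis .
    next
      case (Halt b0)
      have "R S (F coin) \<le> R S (\<lambda>x b \<psi>. of_bool (b0 = b))"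
        unfolding F_def using Halt
        by (intro R_mono) (auto simp: Let_def i_def[symmetric] won_def split: option.splits)
      also have "\<dots> \<le> 1 / 2" by (rule guess_le)
      also have "\<dots> \<le> ?bound" by simp
      finally show ?thesis .
    next
      case Ask
      \<comment> \<open>The step that sends the message may itself add one symbol to it.\<close>
      let ?n = "10 * (length (outbox c) + 1)"
      interpret query_step p m N "\<lambda>w \<psi> \<sigma>. win A t (deliver w c') \<psi> \<sigma>"
        "1 / 2 + ennreal (real (10 * t) * delta)" S ?n
      proof unfold_locales
        show "wf_sym S" by (rule Suc.prems)
        show "size_of S + ?n \<le> N" using Suc.prems by simp
        show "win A t (deliver w c') \<psi> \<sigma> \<le> 1" for w \<psi> \<sigma> by (rule win_le_1)
        show "R S' (\<lambda>x b \<psi>. win A t (deliver w c') \<psi> (chal S' x b)) \<le> 1 / 2 + ennreal (real (10 * t) * delta)"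
          if "wf_sym S'" "size_of S' \<le> size_of S + ?n" for S' w
          using Suc.IH[of S' "deliver w c'"] that Suc.prems by (simp add: deliver_def)
      qed simp
      have "R S (F coin) = R S (\<lambda>x b \<psi>. \<integral>\<^sup>+z. win A t (deliver (fst z) c') \<psi> (snd z)
          \<partial>environment p (\<psi> False) (\<psi> True) (outbox c') (chal S x b))"
        unfolding F_def using Ask by (simp add: Let_def i_def[symmetric] c'_def[symmetric])
      also have "\<dots> \<le> 1 / 2 + ennreal (real (10 * t) * delta) + ennreal (real ?n * delta)"
        using out by (intro environment_le) simp
      also have "\<dots> = 1 / 2 + ennreal (real (10 * t) * delta + real ?n * delta)"
        using delta_nonneg by (simp add: add.assoc ennreal_plus)
      also have "real (10 * t) * delta + real ?n * delta = real (10 * (length (outbox c) + Suc t)) * delta"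
        by (simp add: algebra_simps)
      finally show ?thesis .
    qed
  qed
  finally show ?case by simp
qed

section \<open>The initial state and the whole game\<close>

definition initial_sym :: sym where
  "initial_sym = \<lparr>vars = {VBeta, VA}, known = Map.empty, msg = (\<lambda>_ _. 0), nkeys = 0,
     kattrs = (\<lambda>_. {}), pol = None, ver = 0, cs = (\<lambda>_. 1), queried = {}\<rparr>"

lemma wf_initial: "wf_sym initial_sym"
proof (rule wfI)
  show "pol_ok initial_sym" by (simp add: pol_ok_def initial_sym_def)
  show "\<not> int p dvd cs initial_sym n" for n using p_ge_2 by (simp add: initial_sym_def)
qed (simp_all add: initial_sym_def span1_zero)

abbreviation initial_challenger :: "(var \<Rightarrow> int) \<Rightarrow> challenger" where
  "initial_challenger x \<equiv>
     \<lparr>ch_ek = EncKey 1 (x VBeta) (x VBeta * x VA mod int p) 0,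
      ch_mk = MasterKey (x VBeta) (x VBeta * x VA mod int p) 0,
      ch_updates = (\<lambda>i. undefined), ch_hash = Map.empty, ch_queried = {}, ch_challenge = None\<rparr>"

lemma chal_initial:
  assumes "x VBeta \<in> {1..<int p}"
  shows "chal initial_sym x b = initial_challenger x"
  using assms by (auto simp: chal_def initial_sym_def table_def fun_eq_iff)

text \<open>The two independent draws are exchanged, so that \<beta> is available when \<alpha> =
  \<beta> a is substituted.\<close>

lemma Setup_conv:
  "Setup p = map_pmf (\<lambda>x. (EncKey 1 (x VBeta) (x VBeta * x VA mod int p) 0,
      MasterKey (x VBeta) (x VBeta * x VA mod int p) 0)) (sample_on p (\<lambda>_. 0) {VBeta, VA})"
proof -
  have "Setup p = do { \<beta> \<leftarrow> sample_Zp_unit p; \<alpha> \<leftarrow> sample_Zp p;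
      return_pmf (EncKey 1 \<beta> \<alpha> 0, MasterKey \<beta> \<alpha> 0) }"
    unfolding Setup_def by (rule bind_commute_pmf)
  also have "\<dots> = do { \<beta> \<leftarrow> sample_Zp_unit p; \<alpha> \<leftarrow> map_pmf (\<lambda>r. \<beta> * r mod int p) (sample_Zp p);
      return_pmf (EncKey 1 \<beta> \<alpha> 0, MasterKey \<beta> \<alpha> 0) }"
    using p_ge_2 by (intro bind_pmf_cong refl) (simp add: sample_Zp_mult[OF prime] sample_Zp_unit_def)
  also have "\<dots> = map_pmf (\<lambda>x. (EncKey 1 (x VBeta) (x VBeta * x VA mod int p) 0,
      MasterKey (x VBeta) (x VBeta * x VA mod int p) 0)) (sample_on p (\<lambda>_. 0) {VBeta, VA})"
    by (simp add: sample_on_insert samp_def map_pmf_def bind_assoc_pmf bind_return_pmf)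
  finally show ?thesis .
qed

lemma encodings_nonempty: "encodings p m \<noteq> {}"
proof -
  have fin: "finite {bs :: bool list. length bs = m}"
    using finite_lists_length_eq[of "UNIV :: bool set" m] by simp
  have "p \<le> p ^ 3" using p_ge_2 by (simp add: self_le_power)
  then have "card (Zp p) \<le> card {bs :: bool list. length bs = m}"
    using card_lists_length_eq[of "UNIV :: bool set" m] m_large by simp
  then obtain f where "f ` Zp p \<subseteq> {bs :: bool list. length bs = m}" "inj_on f (Zp p)"
    using card_le_inj[of "Zp p" "{bs :: bool list. length bs = m}"] fin by auto
  then have "restrict f (Zp p) \<in> encodings p m" by (auto simp: encodings_def)
  then show ?thesis by blast
qed

lemma compat_initial: "compat initial_sym x b = {\<psi>. \<forall>i. \<psi> i \<in> encodings p m}"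
  by (simp add: compat_def initial_sym_def)

lemma pmf_of_set_encodings:
  "pmf_of_set {\<psi> :: bool \<Rightarrow> int \<Rightarrow> enc. \<forall>i. \<psi> i \<in> encodings p m} =
     do { \<psi>0 \<leftarrow> pmf_of_set (encodings p m); \<psi>1 \<leftarrow> pmf_of_set (encodings p m);
          return_pmf (\<lambda>i. if i then \<psi>1 else \<psi>0) }"
proof -
  let ?E = "encodings p m" and ?f = "\<lambda>(\<psi>0, \<psi>1) i. if i then \<psi>1 else \<psi>0 :: int \<Rightarrow> enc"
  have "bij_betw ?f (?E \<times> ?E) {\<psi>. \<forall>i. \<psi> i \<in> ?E}"
    by (rule bij_betwI[where g = "\<lambda>\<psi>. (\<psi> False, \<psi> True)"]) (auto simp: fun_eq_iff)
  then have "pmf_of_set {\<psi>. \<forall>i. \<psi> i \<in> ?E} = map_pmf ?f (pmf_of_set (?E \<times> ?E))"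
    using encodings_nonempty finite_encodings by (intro map_pmf_of_set_bij_betw[symmetric]) auto
  also have "pmf_of_set (?E \<times> ?E) = pair_pmf (pmf_of_set ?E) (pmf_of_set ?E)"
  proof (rule pmf_eqI)
    fix z
    show "pmf (pmf_of_set (?E \<times> ?E)) z = pmf (pair_pmf (pmf_of_set ?E) (pmf_of_set ?E)) z"
      using encodings_nonempty finite_encodings
      by (cases z) (simp add: pmf_pair indicator_def card_cartesian_product)
  qed
  finally show ?thesis by (simp add: pair_pmf_def map_pmf_def bind_assoc_pmf bind_return_pmf)
qed

text \<open>In the initial state the table is empty, so every pair of encodings is compatible, and
  the bit of the state is not yet visible in the challenger. Averaging over worlds is therefore the
  plain game.\<close>

lemma Game2_eq:
  "emeasure (Game2 p m A t \<kappa>) {True} = R initial_sym (\<lambda>x b \<psi>.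
     win A t (initial_config \<kappa> (word_of (Node [num p, sexp_enc_key (EncKey (\<psi> False 1) (\<psi> False (x VBeta))
       (\<psi> True (x VBeta * x VA mod int p)) 0)]))) \<psi> (chal initial_sym x b))" (is "_ = R _ ?F")
proof -
  let ?E = "{\<psi> :: bool \<Rightarrow> int \<Rightarrow> enc. \<forall>i. \<psi> i \<in> encodings p m}"
  have fin: "finite ?E" and ne: "?E \<noteq> {}"
    using finite_compat[of initial_sym] encodings_nonempty by (auto simp: compat_initial)
  have b: "?F x b \<psi> = ?F x False \<psi>" for x b \<psi> by (simp add: chal_def initial_sym_def)
  have won: "(\<integral>\<^sup>+z. indicator {True} (case ch_challenge (snd z) of None \<Rightarrow> False | Some (P, b) \<Rightarrow> fst z = Some b) \<partial>measure_pmf M) =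
      (\<integral>\<^sup>+z. won z \<partial>measure_pmf M)" for M
    by (intro nn_integral_cong) (auto simp: won_def split: option.splits)
  have "R initial_sym ?F = (\<integral>\<^sup>+x. \<integral>\<^sup>+b. \<integral>\<^sup>+\<psi>. ?F x False \<psi> \<partial>pmf_of_set ?E \<partial>bernoulli_pmf (1 / 2) \<partial>sample_on p (\<lambda>_. 0) {VBeta, VA})"
  proof -
    have "inner initial_sym ?F x b' = (\<integral>\<^sup>+\<psi>. ?F x False \<psi> \<partial>pmf_of_set ?E)" for x b'
      unfolding inner_def compat_initial using ne by (simp only: if_False b[where x = x and b = b'])
    then show ?thesis by (simp only: R_eq) (simp add: initial_sym_def del: nn_integral_bernoulli_pmf)
  qed
  also have "\<dots> = (\<integral>\<^sup>+\<psi>. \<integral>\<^sup>+x. ?F x False \<psi> \<partial>sample_on p (\<lambda>_. 0) {VBeta, VA} \<partial>pmf_of_set ?E)"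
    by (subst nn_integral_pmf_commute) (simp del: nn_integral_bernoulli_pmf)
  also have "\<dots> = (\<integral>\<^sup>+\<psi>0. \<integral>\<^sup>+\<psi>1. \<integral>\<^sup>+x. ?F x False (\<lambda>i. if i then \<psi>1 else \<psi>0)
      \<partial>sample_on p (\<lambda>_. 0) {VBeta, VA} \<partial>pmf_of_set (encodings p m) \<partial>pmf_of_set (encodings p m))"
    unfolding pmf_of_set_encodings by (simp del: word_of.simps)
  also have "\<dots> = emeasure (Game2 p m A t \<kappa>) {True}"
  proof -
    have eq: "?F x False (\<lambda>i. if i then \<psi>1 else \<psi>0) =
      (\<integral>\<^sup>+z. won z \<partial>run A (environment p \<psi>0 \<psi>1) t
         (initial_config \<kappa> (word_of (Node [num p, sexp_enc_key (map_enc_key \<psi>0 \<psi>1 (EncKey 1 (x VBeta) (x VBeta * x VA mod int p) 0))])))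
         (initial_challenger x))"
      if x: "x \<in> set_pmf (sample_on p (\<lambda>_. 0) {VBeta, VA})" for x \<psi>0 \<psi>1
    proof -
      have "x VBeta \<in> {1..<int p}"
        using x by (intro sample_support[OF wf_initial]) (simp add: initial_sym_def)
      then show ?thesis by (simp add: chal_initial win_def)
    qed
    have "emeasure (Game2 p m A t \<kappa>) {True} = (\<integral>\<^sup>+w. indicator {True} w \<partial>Game2 p m A t \<kappa>)" by simp
    also have "\<dots> = (\<integral>\<^sup>+\<psi>0. \<integral>\<^sup>+\<psi>1. \<integral>\<^sup>+x. (\<integral>\<^sup>+z. won z \<partial>run A (environment p \<psi>0 \<psi>1) t
         (initial_config \<kappa> (word_of (Node [num p, sexp_enc_key (map_enc_key \<psi>0 \<psi>1 (EncKey 1 (x VBeta) (x VBeta * x VA mod int p) 0))])))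
         (initial_challenger x))
      \<partial>sample_on p (\<lambda>_. 0) {VBeta, VA} \<partial>pmf_of_set (encodings p m) \<partial>pmf_of_set (encodings p m))"
      unfolding Game2_def Setup_conv nn_integral_bind_pmf nn_integral_map_pmf case_prod_unfold
        nn_integral_return_pmf[OF zero_le] fst_conv snd_conv won[unfolded case_prod_unfold] ..
    also have "\<dots> = (\<integral>\<^sup>+\<psi>0. \<integral>\<^sup>+\<psi>1. \<integral>\<^sup>+x. ?F x False (\<lambda>i. if i then \<psi>1 else \<psi>0)
      \<partial>sample_on p (\<lambda>_. 0) {VBeta, VA} \<partial>pmf_of_set (encodings p m) \<partial>pmf_of_set (encodings p m))"
      by (intro nn_integral_cong nn_integral_cong_AE AE_pmfI eq[symmetric])
    finally show ?thesis by (rule sym)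
  qed
  finally show ?thesis by (rule sym)
qed

text \<open>The first message is treated like a reply that reveals g, h and l. Together with the
  indeterminates \<beta> and a this gives a state of size at most 5 before the first step, hence 5 +
  10 t.\<close>

lemma Game2_le:
  assumes "5 + 10 * t \<le> N"
  shows "emeasure (Game2 p m A t \<kappa>) {True} \<le> ennreal (1 / 2 + (10 * real t + 3) * delta)"
proof -
  have size_initial: "size_of initial_sym = 2" by (simp add: size_of_def initial_sym_def)
  interpret query_step p m N "\<lambda>w \<psi> \<sigma>. win A t (initial_config \<kappa> w) \<psi> \<sigma>"
    "1 / 2 + ennreal (real (10 * t) * delta)" initial_sym 3
  proof unfold_locales
    show "wf_sym initial_sym" by (rule wf_initial)
    show "size_of initial_sym + 3 \<le> N" using assms by (simp add: size_initial)
    show "win A t (initial_config \<kappa> w) \<psi> \<sigma> \<le> 1" for w \<psi> \<sigma> by (rule win_le_1)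
    show "R S' (\<lambda>x b \<psi>. win A t (initial_config \<kappa> w) \<psi> (chal S' x b)) \<le> 1 / 2 + ennreal (real (10 * t) * delta)"
      if "wf_sym S'" "size_of S' \<le> size_of initial_sym + 3" for S' w
      using run_le[OF that(1), of "initial_config \<kappa> w" t A] that assms
      by (simp add: initial_config_def size_initial)
  qed simp
  let ?g = "(0, \<lambda>x. 1) :: int \<times> fn" and ?h = "(0, \<lambda>x. x VBeta) :: int \<times> fn"
    and ?l = "(0, \<lambda>x. x VBeta * x VA) :: int \<times> fn"
  let ?rs = "[(False, ?g), (False, ?h), (True, ?l)]"
  have "emeasure (Game2 p m A t \<kappa>) {True} \<le> 1 / 2 + ennreal (real (10 * t) * delta) + ennreal (real 3 * delta)"
    unfolding Game2_eq
  proof (rule respond[OF wf_initial, where rs = ?rs and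
      sx = "\<lambda>nm. Node [num p, sexp_enc_key (EncKey (nm False ?g) (nm False ?h) (nm True ?l) 0)]"])
    show "rep_ok initial_sym i r" if "(i, r) \<in> set ?rs" for i r
      using that wfD(3,4)[OF wf_initial]
      by (auto simp: rep_ok_def intro!: span0_handle[OF h_one] span0_handle[OF h_beta] span1_l)
    show "Node [num p, sexp_enc_key (EncKey (\<psi> False 1) (\<psi> False (x VBeta)) (\<psi> True (x VBeta * x VA mod int p)) 0)] =
      Node [num p, sexp_enc_key (EncKey (nm False ?g) (nm False ?h) (nm True ?l) 0)]"
      if x: "x \<in> set_pmf (prior initial_sym)"
        and nm: "\<And>i r. (i, r) \<in> set ?rs \<Longrightarrow> \<psi> i (val initial_sym x b r) = nm i r" for x b \<psi> nm
      using nm[of False ?g] nm[of False ?h] nm[of True ?l] p_ge_2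
        sample_Zp_support[OF wf_initial x wfD(3)[OF wf_initial]]
      by (simp add: val_fn)
  qed simp_all
  also have "1 / 2 = ennreal (1 / 2)" by (simp add: divide_ennreal_def)
  also have "ennreal (1 / 2) + ennreal (real (10 * t) * delta) = ennreal (1 / 2 + real (10 * t) * delta)"
    using delta_nonneg by (intro ennreal_plus[symmetric]) auto
  also have "\<dots> + ennreal (real 3 * delta) = ennreal (1 / 2 + real (10 * t) * delta + real 3 * delta)"
    using delta_nonneg by (intro ennreal_plus[symmetric]) auto
  also have "1 / 2 + real (10 * t) * delta + real 3 * delta = 1 / 2 + (10 * real t + 3) * delta"
    by (simp add: algebra_simps)
  finally show ?thesis .
qed

lemma advantage_le:
  assumes "5 + 10 * t \<le> N"
  shows "advantage p m A t \<kappa> \<le> (10 * real t + 3) * delta"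
proof -
  have "measure_pmf.prob (Game2 p m A t \<kappa>) {True} \<le> 1 / 2 + (10 * real t + 3) * delta"
  proof -
    have "ennreal (measure_pmf.prob (Game2 p m A t \<kappa>) {True}) \<le> ennreal (1 / 2 + (10 * real t + 3) * delta)"
      using Game2_le[OF assms, of A \<kappa>] by (simp only: measure_pmf.emeasure_eq_measure)
    moreover have "0 \<le> 1 / 2 + (10 * real t + 3) * delta" using delta_nonneg by simp
    ultimately show ?thesis by (simp only: ennreal_le_iff)
  qed
  then show ?thesis by (simp add: advantage_def)
qed

end

section \<open>Asymptotics\<close>

lemma poly_nat_le_power:
  fixes T :: "nat poly"
  assumes "1 \<le> x"
  shows "poly T x \<le> (\<Sum>i\<le>degree T. coeff T i) * x ^ degree T"
proof -
  have "poly T x = (\<Sum>i\<le>degree T. coeff T i * x ^ i)" by (rule poly_altdef)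
  also have "\<dots> \<le> (\<Sum>i\<le>degree T. coeff T i * x ^ degree T)"
    using assms by (intro sum_mono mult_left_mono power_increasing) auto
  finally show ?thesis by (simp add: sum_distrib_right)
qed

lemma eventually_poly_less_exp: "eventually (\<lambda>n. C * real n ^ e < 2 ^ n) sequentially"
proof -
  have "(\<lambda>n. C * (real n ^ e / 2 ^ n)) \<longlonglongrightarrow> C * 0"
    by (intro tendsto_mult tendsto_const) real_asymp
  then have "eventually (\<lambda>n. C * (real n ^ e / 2 ^ n) < 1) sequentially"
    by (intro order_tendstoD(2)) auto
  then show ?thesis by eventually_elim (simp add: field_simps)
qed

text \<open>Take N = 5 + 10 t. From p \<ge> 2^(\<kappa> - 1) follows p - 1 \<ge> 2^\<kappa> / 4, and
  4 N^2 + 1 \<le> 5 N^2, so the constant is 20 = 5 * 4. The prime p is odd because it exceeds N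
  \<ge> 5.\<close>

lemma advantage_bound:
  fixes p m t \<kappa> :: nat
  assumes "prime p" "floorlog 2 p = \<kappa>" "real m > 3 * log 2 (real p)" "\<kappa> \<ge> 2" "5 + 10 * t < 2 ^ (\<kappa> - 1)"
  shows "advantage p m A t \<kappa> \<le> 20 * (5 + 10 * real t) ^ 3 / 2 ^ \<kappa>"
proof -
  let ?K = "5 + 10 * t"
  have p0: "p > 0" using assms(1) prime_gt_0_nat by blast
  have p: "2 ^ (\<kappa> - 1) \<le> p" using floorlog_bounds[of p 2] p0 assms(2) by simp
  interpret generic_group p m ?K
  proof
    show "prime p" by (rule assms)
    show "?K < p" using p assms(5) by simp
    show "odd p" using p assms(1,5) prime_odd_nat[of p] by simp
    have "real (p ^ 3) = 2 powr (3 * log 2 (real p))"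
      using p0 by (simp add: powr_mult_base powr_powr[symmetric] mult.commute[of 3] powr_realpow)
    also have "\<dots> < 2 powr real m" using assms(3) by simp
    also have "\<dots> = real (2 ^ m)" by (simp add: powr_realpow)
    finally show "p ^ 3 < 2 ^ m" by (simp only: of_nat_less_iff)
  qed
  have q: "2 ^ \<kappa> / 4 \<le> real (p - 1)"
  proof -
    have "2 ^ \<kappa> = (4 :: real) * 2 ^ (\<kappa> - 2)" using assms(4) by (simp add: power_diff)
    moreover have "2 ^ (\<kappa> - 2) + 1 \<le> 2 * (2 ^ (\<kappa> - 2) :: nat)" by simp
    moreover have "2 * (2 ^ (\<kappa> - 2) :: nat) = 2 ^ (\<kappa> - 1)"
      using assms(4) by (metis Suc_diff_Suc Suc_1 Suc_le_lessD power_Suc)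
    ultimately have "2 ^ (\<kappa> - 2) \<le> p - 1" using p by linarith
    then have "real (2 ^ (\<kappa> - 2)) \<le> real (p - 1)" by (simp only: of_nat_le_iff)
    then show ?thesis using \<open>2 ^ \<kappa> = 4 * 2 ^ (\<kappa> - 2)\<close> by simp
  qed
  have "advantage p m A t \<kappa> \<le> (10 * real t + 3) * delta" by (rule advantage_le) simp
  also have "\<dots> \<le> real ?K * (5 * real ?K ^ 2 / (2 ^ \<kappa> / 4))"
  proof (rule mult_mono)
    have "1 \<le> real ?K ^ 2" by (rule one_le_power) simp
    then have "4 * real ?K * real ?K + 1 \<le> 5 * real ?K ^ 2" by (simp only: power2_eq_square)
    then show "delta \<le> 5 * real ?K ^ 2 / (2 ^ \<kappa> / 4)"
      unfolding delta_def using q by (intro frac_le) auto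
  qed (use delta_nonneg in auto)
  also have "\<dots> = 20 * (5 + 10 * real t) ^ 3 / 2 ^ \<kappa>"
    by (simp add: power2_eq_square power3_eq_cube)
  finally show ?thesis .
qed

theorem theorem2:
  fixes p m :: "nat \<Rightarrow> nat" and A :: machine and T :: "nat poly"
  assumes "\<And>\<kappa>. \<kappa> \<ge> 2 \<Longrightarrow> prime (p \<kappa>)"
    and "\<And>\<kappa>. \<kappa> \<ge> 2 \<Longrightarrow> floorlog 2 (p \<kappa>) = \<kappa>"
    and "\<And>\<kappa>. \<kappa> \<ge> 2 \<Longrightarrow> real (m \<kappa>) > 3 * log 2 (real (p \<kappa>))"
    and "wf_machine A"
    and "runs_in_time A T"
  shows "\<not> non_negligible (\<lambda>\<kappa>. advantage (p \<kappa>) (m \<kappa>) A (poly T \<kappa>) \<kappa>)"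
proof
  assume "non_negligible (\<lambda>\<kappa>. advantage (p \<kappa>) (m \<kappa>) A (poly T \<kappa>) \<kappa>)"
  then obtain c where c: "\<exists>\<^sub>F \<kappa> in sequentially. advantage (p \<kappa>) (m \<kappa>) A (poly T \<kappa>) \<kappa> \<ge> 1 / real \<kappa> ^ c"
    by (auto simp: non_negligible_def)
  define C where "C = real (5 + 10 * (\<Sum>i\<le>degree T. coeff T i))"
  define d where "d = degree T"
  have K: "5 + 10 * real (poly T \<kappa>) \<le> C * real \<kappa> ^ d" if "1 \<le> \<kappa>" for \<kappa>
  proof -
    have "5 + 10 * poly T \<kappa> \<le> (5 + 10 * (\<Sum>i\<le>degree T. coeff T i)) * \<kappa> ^ d"
    proof -
      have "5 + 10 * poly T \<kappa> \<le> 5 * \<kappa> ^ d + 10 * ((\<Sum>i\<le>degree T. coeff T i) * \<kappa> ^ d)"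
        using poly_nat_le_power[OF that, of T] one_le_power[OF that, of d] unfolding d_def by linarith
      then show ?thesis by (simp add: algebra_simps)
    qed
    then have "real (5 + 10 * poly T \<kappa>) \<le> real ((5 + 10 * (\<Sum>i\<le>degree T. coeff T i)) * \<kappa> ^ d)"
      by (simp only: of_nat_le_iff)
    then show ?thesis by (simp add: C_def)
  qed
  have "\<forall>\<^sub>F \<kappa> in sequentially. \<kappa> \<ge> 2" by (rule eventually_ge_at_top)
  \<comment> \<open>This growth condition yields the size bound required by
    \<open>advantage_bound\<close>; the next one pushes the resulting bound below 1 /
    \<kappa>^c.\<close>
  moreover have "\<forall>\<^sub>F \<kappa> in sequentially. (2 * C) * real \<kappa> ^ d < 2 ^ \<kappa>" by (rule eventually_poly_less_exp)
  moreover have "\<forall>\<^sub>F \<kappa> in sequentially. (20 * C ^ 3) * real \<kappa> ^ (3 * d + c) < 2 ^ \<kappa>"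
    by (rule eventually_poly_less_exp)
  ultimately have "\<forall>\<^sub>F \<kappa> in sequentially. \<not> advantage (p \<kappa>) (m \<kappa>) A (poly T \<kappa>) \<kappa> \<ge> 1 / real \<kappa> ^ c"
  proof eventually_elim
    case (elim \<kappa>)
    let ?t = "poly T \<kappa>"
    have k: "5 + 10 * real ?t \<le> C * real \<kappa> ^ d" using elim by (intro K) simp
    have "2 * real (5 + 10 * ?t) < 2 * 2 ^ (\<kappa> - 1)"
      using k elim by (simp add: power_eq_if)
    then have "real (5 + 10 * ?t) < real (2 ^ (\<kappa> - 1))" by simp
    then have t: "5 + 10 * ?t < 2 ^ (\<kappa> - 1)" by (simp only: of_nat_less_iff)
    have "advantage (p \<kappa>) (m \<kappa>) A ?t \<kappa> \<le> 20 * (5 + 10 * real ?t) ^ 3 / 2 ^ \<kappa>"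
      using assms(1-3) elim(1) t by (intro advantage_bound)
    also have "\<dots> \<le> 20 * (C * real \<kappa> ^ d) ^ 3 / 2 ^ \<kappa>"
      using k by (intro divide_right_mono mult_left_mono power_mono) auto
    also have "\<dots> < 1 / real \<kappa> ^ c"
    proof -
      have frac: "a / y < 1 / z" if "a * z < y" "0 < y" "0 < z" for a y z :: real
        using that by (simp add: field_simps)
      have "(20 * (C * real \<kappa> ^ d) ^ 3) * real \<kappa> ^ c = (20 * C ^ 3) * ((real \<kappa> ^ d) ^ 3 * real \<kappa> ^ c)"
        by (simp add: power_mult_distrib)
      also have "(real \<kappa> ^ d) ^ 3 * real \<kappa> ^ c = real \<kappa> ^ (3 * d + c)"
        by (simp only: power_add power_mult[symmetric] mult.commute[of d 3])
      finally show ?thesis using elim by (intro frac) simp_all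
    qed
    finally show ?case by simp
  qed
  then show False using c by (simp add: frequently_def)
qed

end
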